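(* Let $\mathcal{H}$ be a separable infinite-dimensional real Hilbert space, $X$ an isonormal Gaussian process on $\mathcal{H}$ defined on a probability space $(\Omega,\mathcal{F},\mathbb{P})$, $K\subset\mathcal{H}$ a GB convex body and $h_K(X)$ its support function. Then for almost every $\omega\in\Omega$, $Dh_K(X)(\omega)$ is the unique maximal point of $K$ at state $\omega$.
   Context: An isonormal Gaussian process on $\mathcal{H}$ is a family $X=(X_v)_{v\in\mathcal{H}}$ of centred jointly Gaussian random variables with $\mathbb{E}[X_vX_u]=(v,u)_{\mathcal{H}}$ and $X_{av+bu}=aX_v+bX_u$. A convex body in $\mathcal{H}$ is a non-empty compact convex subset; it is Gaussian bounded (GB) if for every countable $C\subset K$, $\sup_{v\in C}X_v<\infty$ almost surely. The support function is the random variable $h_K(X)=\sup_{v\in K}X_v$, the supremum being taken over a countable dense subset of $K$ (a.s. independent of the choice). A point $v\in K$ is a maximal point of $K$ at state $\omega\in\Omega$ if for every $\varepsilon>0$, $\sup\{X_w(\omega):w\in K\cap B_{\mathcal{H}}(v,\varepsilon)\}=h_K(X)(\omega)$, where $B_{\mathcal{H}}(v,\varepsilon)$ is the ball of radius $\varepsilon$ about $v$ and suprema are understood over a fixed countable dense subset of $K$. Malliavin derivative: for $\varphi=f(X_{v_1},\dots,X_{v_n})$ with $f$ smooth and all its derivatives of at most polynomial growth, $D\varphi=\sum_j\partial_jf(X_{v_1},\dots,X_{v_n})v_j$; $D$ also denotes the closure of this operator from $L^2(\Omega)$ to $L^2(\Omega;\mathcal{H})$, with domain $\mathbb{D}^{1,2}$.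 For every GB convex body $K$, $h_K(X)\in\mathbb{D}^{1,2}$. *)

theory Defs
  imports "HOL-Probability.Probability"
begin

text \<open>
  A separable real Hilbert space is a type of sort
  \<open>{real_inner, banach, second_countable_topology}\<close>: for metric spaces, second countability is
  separability.  Random variables are functions rather than equivalence classes, so identities
  between random variables are required almost surely only.
\<close>

definition infinite_dimensional :: "'h::real_vector itself \<Rightarrow> bool" where
  "infinite_dimensional _ \<longleftrightarrow> \<not> (\<exists>B :: 'h set. finite B \<and> span B = UNIV)"

section \<open>Isonormal Gaussian processes\<close>

text \<open>The degenerate case of variance zero is included.\<close>

definition centred_gaussian :: "'w measure \<Rightarrow> ('w \<Rightarrow> real) \<Rightarrow> bool" where
  "centred_gaussian M Y \<longleftrightarrow>
     Y \<in> borel_measurable M \<and>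
     ((AE \<omega> in M. Y \<omega> = 0) \<or> (\<exists>\<sigma>>0. distributed M lborel Y (normal_density 0 \<sigma>)))"

definition centred_jointly_gaussian :: "'w measure \<Rightarrow> ('i \<Rightarrow> 'w \<Rightarrow> real) \<Rightarrow> bool" where
  "centred_jointly_gaussian M X \<longleftrightarrow>
     (\<forall>S c. finite S \<longrightarrow> centred_gaussian M (\<lambda>\<omega>. \<Sum>i\<in>S. c i * X i \<omega>))"

definition isonormal_gaussian_process ::
  "'w measure \<Rightarrow> ('h::real_inner \<Rightarrow> 'w \<Rightarrow> real) \<Rightarrow> bool" where
  "isonormal_gaussian_process M X \<longleftrightarrow>
     centred_jointly_gaussian M X \<and>
     (\<forall>v u. (\<integral>\<omega>. X v \<omega> * X u \<omega> \<partial>M) = v \<bullet> u) \<and>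
     (\<forall>a b v u. AE \<omega> in M. X (a *\<^sub>R v + b *\<^sub>R u) \<omega> = a * X v \<omega> + b * X u \<omega>)"

section \<open>Gaussian bounded convex bodies, support functions and maximal points\<close>

definition convex_body :: "'h::real_normed_vector set \<Rightarrow> bool" where
  "convex_body K \<longleftrightarrow> K \<noteq> {} \<and> compact K \<and> convex K"

definition gaussian_bounded :: "'w measure \<Rightarrow> ('h \<Rightarrow> 'w \<Rightarrow> real) \<Rightarrow> 'h set \<Rightarrow> bool" where
  "gaussian_bounded M X K \<longleftrightarrow>
     (\<forall>C. countable C \<and> C \<subseteq> K \<longrightarrow> (AE \<omega> in M. bdd_above ((\<lambda>v. X v \<omega>) ` C)))"

definition countable_dense_subset :: "'h::topological_space set \<Rightarrow> 'h set \<Rightarrow> bool" where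
  "countable_dense_subset C K \<longleftrightarrow> countable C \<and> C \<subseteq> K \<and> K \<subseteq> closure C"

text \<open>
  Below, \<open>C\<close> is the fixed countable dense subset of the convex body over which suprema are taken.
  The real-valued supremum has its usual meaning only where the set is bounded above, that is,
  almost surely when the body is Gaussian bounded.
\<close>

definition support_function :: "('h \<Rightarrow> 'w \<Rightarrow> real) \<Rightarrow> 'h set \<Rightarrow> 'w \<Rightarrow> real" where
  "support_function X C \<omega> = (SUP v\<in>C. X v \<omega>)"

definition maximal_point ::
  "('h::metric_space \<Rightarrow> 'w \<Rightarrow> real) \<Rightarrow> 'h set \<Rightarrow> 'h set \<Rightarrow> 'w \<Rightarrow> 'h \<Rightarrow> bool" where
  "maximal_point X C K \<omega> v \<longleftrightarrow>
     v \<in> K \<and> (\<forall>\<epsilon>>0. (SUP w\<in>C \<inter> ball v \<epsilon>. X w \<omega>) = support_function X C \<omega>)"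

definition unique_maximal_point ::
  "('h::metric_space \<Rightarrow> 'w \<Rightarrow> real) \<Rightarrow> 'h set \<Rightarrow> 'h set \<Rightarrow> 'w \<Rightarrow> 'h \<Rightarrow> bool" where
  "unique_maximal_point X C K \<omega> v \<longleftrightarrow>
     maximal_point X C K \<omega> v \<and> (\<forall>w. maximal_point X C K \<omega> w \<longrightarrow> w = v)"

section \<open>The Malliavin derivative\<close>

text \<open>
  A function on \<open>\<real>\<^sup>n\<close>, with \<open>n\<close> varying, is a function of sequences that depends only on the
  coordinates with index below \<open>n\<close>; for such functions continuity in the product topology is
  continuity on \<open>\<real>\<^sup>n\<close>.
\<close>

definition partial_deriv ::
  "nat \<Rightarrow> ((nat \<Rightarrow> real) \<Rightarrow> real) \<Rightarrow> (nat \<Rightarrow> real) \<Rightarrow> real" where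
  "partial_deriv i f x = deriv (\<lambda>t. f (x(i := t))) (x i)"

definition iterated_partial_deriv ::
  "nat list \<Rightarrow> ((nat \<Rightarrow> real) \<Rightarrow> real) \<Rightarrow> (nat \<Rightarrow> real) \<Rightarrow> real" where
  "iterated_partial_deriv is f = foldr partial_deriv is f"

text \<open>
  Smoothness is existence and continuity of the partial derivatives of all orders; the empty list
  of indices gives the conditions on \<open>f\<close> itself.
\<close>

definition smooth_polynomial_growth :: "nat \<Rightarrow> ((nat \<Rightarrow> real) \<Rightarrow> real) \<Rightarrow> bool" where
  "smooth_polynomial_growth n f \<longleftrightarrow>
     (\<forall>x y. (\<forall>i<n. x i = y i) \<longrightarrow> f x = f y) \<and>
     (\<forall>is. set is \<subseteq> {..<n} \<longrightarrow>
        continuous_on UNIV (iterated_partial_deriv is f) \<and>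
        (\<forall>x. \<forall>i<n. (\<lambda>t. iterated_partial_deriv is f (x(i := t))) field_differentiable at (x i)) \<and>
        (\<exists>C k. \<forall>x. \<bar>iterated_partial_deriv is f x\<bar> \<le> C * (1 + (\<Sum>i<n. \<bar>x i\<bar>)) ^ k))"

definition smooth_malliavin_derivative ::
  "('h::real_vector \<Rightarrow> 'w \<Rightarrow> real) \<Rightarrow> ('w \<Rightarrow> real) \<Rightarrow> ('w \<Rightarrow> 'h) \<Rightarrow> bool" where
  "smooth_malliavin_derivative X \<phi> u \<longleftrightarrow>
     (\<exists>n f v. smooth_polynomial_growth n f \<and>
        \<phi> = (\<lambda>\<omega>. f (\<lambda>i. X (v i) \<omega>)) \<and>
        u = (\<lambda>\<omega>. \<Sum>j<n. partial_deriv j f (\<lambda>i. X (v i) \<omega>) *\<^sub>R v j))"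

text \<open>
  The distance is an extended nonnegative integral, so the convergence below is not affected by
  the convention that the Bochner integral of a non-integrable function is zero.
\<close>

definition L2_tendsto ::
  "'w measure \<Rightarrow> (nat \<Rightarrow> 'w \<Rightarrow> 'b::real_normed_vector) \<Rightarrow> ('w \<Rightarrow> 'b) \<Rightarrow> bool" where
  "L2_tendsto M F G \<longleftrightarrow>
     ((\<lambda>m. \<integral>\<^sup>+\<omega>. ennreal ((norm (F m \<omega> - G \<omega>))\<^sup>2) \<partial>M) \<longlonglongrightarrow> 0)"

text \<open>
  The graph of the closed operator, i.e. the closure in \<open>L\<^sup>2(\<Omega>) \<times> L\<^sup>2(\<Omega>; H)\<close> of the graph of the
  derivative on smooth random variables.  Square integrability of \<open>\<phi>\<close> and \<open>u\<close> is automatic for an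
  isonormal process, since smooth random variables and their derivatives have finite moments.
\<close>

definition has_malliavin_derivative ::
  "'w measure \<Rightarrow> ('h::{real_inner, banach, second_countable_topology} \<Rightarrow> 'w \<Rightarrow> real) \<Rightarrow>
   ('w \<Rightarrow> real) \<Rightarrow> ('w \<Rightarrow> 'h) \<Rightarrow> bool" where
  "has_malliavin_derivative M X \<phi> u \<longleftrightarrow>
     \<phi> \<in> borel_measurable M \<and> u \<in> borel_measurable M \<and>
     (\<exists>F U. (\<forall>m. smooth_malliavin_derivative X (F m) (U m)) \<and>
            L2_tendsto M F \<phi> \<and> L2_tendsto M U u)"

text \<open>
  A representative of the derivative, meaningful for \<open>\<phi>\<close> in the domain of the closed operator and
  unspecified otherwise.  By closability, any two representatives agree almost surely.
\<close>

definition malliavin_derivative ::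
  "'w measure \<Rightarrow> ('h::{real_inner, banach, second_countable_topology} \<Rightarrow> 'w \<Rightarrow> real) \<Rightarrow>
   ('w \<Rightarrow> real) \<Rightarrow> 'w \<Rightarrow> 'h" where
  "malliavin_derivative M X \<phi> = (SOME u. has_malliavin_derivative M X \<phi> u)"

end

theory Submission
  imports Defs "HOL-Real_Asymp.Real_Asymp"
begin

text \<open>
Let \<open>c 0, c 1, \<dots>\<close> enumerate the countable dense set \<open>C\<close> and let
\<open>F\<^sub>n = (1/n) ln (\<Sum>i<n. exp (n X (c i)))\<close>.  This is a smooth function of
\<open>X (c 0), \<dots>, X (c (n - 1))\<close>; it lies between the maximum of these variables and the maximum
plus \<open>ln n / n\<close>, so \<open>F\<^sub>n\<close> tends to \<open>h = support_function X C\<close>.  Its Malliavin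
derivative is the barycentre of the points \<open>c i\<close> under the Gibbs weights proportional to
\<open>exp (n X (c i))\<close>.  Suppose that \<open>K\<close> has just one maximal point \<open>v\<close> at the given state.  Then,
by compactness, \<open>X\<close> stays below \<open>h\<close> by a fixed gap \<open>\<delta>\<close> away from \<open>v\<close>, and all the points
there together carry Gibbs weight at most \<open>n exp (- n \<delta> / 2)\<close> for large \<open>n\<close>; so the derivative of \<open>F\<^sub>n\<close>
tends to \<open>v\<close>.  Both convergences hold in \<open>L\<^sup>2\<close> by dominated convergence, hence the random maximal
point is a Malliavin derivative of \<open>h\<close>, and it is the only one because the derivative is closable.

Three facts about the process make this work.

\<^item> The maximal point is almost surely unique (\<open>maximal_point_unique\<close>).  Two different maximal
  points lie in two balls that are separated by a direction \<open>w\<close>.  Splitting off the independent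
  component \<open>X w\<close>, the suprema over the two balls become convex functions of the value of \<open>X w\<close>
  whose slopes are separated, so they agree for at most one value of a variable that has a density.

\<^item> The supremum is square integrable (\<open>sup_square_integrable\<close>).  This is the rotation argument of
  Fernique applied to \<open>sup \<bar>X (c i)\<bar>\<close>.

\<^item> The derivative is closable (\<open>malliavin_derivative_unique\<close>).  Integration by parts shows that the
  difference \<open>Z\<close> of two candidate derivatives in direction \<open>w\<close> is orthogonal to every smooth
  functional.  As \<open>Z\<close> is itself an \<open>L\<^sup>2\<close> limit of smooth functionals, it vanishes.

All three use equalities in law between processes derived from \<open>X\<close>.  Since the hypothesis only
concerns the laws of finite linear combinations, they rest on the uniqueness of joint characteristic
functions (\<open>process_law_unique\<close>), which is reduced to the one-dimensional theorem of Levy.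
\<close>

section \<open>Characteristic functions determine the law of a process\<close>

lemma integrable_weight_cis:
  assumes "integrable M W" "f \<in> borel_measurable M"
  shows "integrable M (\<lambda>x. W x *\<^sub>R cis (f x))"
proof (rule Bochner_Integration.integrable_bound[OF assms(1)])
  note [measurable] = assms(2) borel_measurable_integrable[OF assms(1)]
  show "(\<lambda>x. W x *\<^sub>R cis (f x)) \<in> borel_measurable M"
    unfolding cis_conv_exp by measurable
qed auto

text \<open>
Integrable weights replace conditioning: they let the one-dimensional uniqueness theorem act on one
coordinate of a vector while all the others are kept in the weight.
\<close>

lemma weighted_law_char:
  fixes X :: "'a \<Rightarrow> real"
  assumes W: "integrable M W" "\<And>x. 0 \<le> W x" and X: "X \<in> borel_measurable M"
    and m: "m = (\<integral>x. W x \<partial>M)" "0 < m"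
  defines "\<mu> \<equiv> distr (density M (\<lambda>x. ennreal (W x / m))) borel X"
  shows "real_distribution \<mu>"
    and "char \<mu> t = (\<integral>x. W x *\<^sub>R cis (t * X x) \<partial>M) / m"
    and "A \<in> sets borel \<Longrightarrow> measure \<mu> A = (\<integral>x. W x * indicator A (X x) \<partial>M) / m"
proof -
  note [measurable] = X borel_measurable_integrable[OF W(1)]
  have "emeasure (density M (\<lambda>x. ennreal (W x / m))) (space M) = (\<integral>\<^sup>+x. ennreal (W x / m) \<partial>M)"
    by (simp add: emeasure_density cong: nn_integral_cong)
  also have "\<dots> = ennreal (\<integral>x. W x / m \<partial>M)"
    using W m by (intro nn_integral_eq_integral) auto
  also have "\<dots> = 1"
    using m W(1) by simp
  finally have ps: "prob_space (density M (\<lambda>x. ennreal (W x / m)))"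
    by (intro prob_spaceI) simp
  show rd: "real_distribution \<mu>"
    unfolding \<mu>_def using ps
    by (intro prob_space.real_distribution_distr) auto
  show "char \<mu> t = (\<integral>x. W x *\<^sub>R cis (t * X x) \<partial>M) / m"
  proof -
    have "char \<mu> t = (\<integral>x. cis (t * X x) \<partial>density M (\<lambda>x. ennreal (W x / m)))"
      unfolding char_def \<mu>_def by (subst integral_distr) (auto simp: cis_conv_exp)
    also have "\<dots> = (\<integral>x. (W x / m) *\<^sub>R cis (t * X x) \<partial>M)"
      using W m by (subst integral_density) (auto simp: cis_conv_exp)
    also have "\<dots> = (\<integral>x. (W x *\<^sub>R cis (t * X x)) / m \<partial>M)"
      by (intro Bochner_Integration.integral_cong) (auto simp: scaleR_conv_of_real)
    finally show ?thesis by simp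
  qed
  show "measure \<mu> A = (\<integral>x. W x * indicator A (X x) \<partial>M) / m" if [measurable]: "A \<in> sets borel"
  proof -
    have "measure \<mu> A = (\<integral>x. indicator A x \<partial>\<mu>)"
      using that by (simp add: \<mu>_def)
    also have "\<dots> = (\<integral>x. indicator A (X x) \<partial>density M (\<lambda>x. ennreal (W x / m)))"
      unfolding \<mu>_def by (subst integral_distr) auto
    also have "\<dots> = (\<integral>x. (W x * indicator A (X x)) / m \<partial>M)"
      using W m by (subst integral_density) auto
    finally show ?thesis by simp
  qed
qed

lemma weighted_char_unique:
  fixes X :: "'a \<Rightarrow> real" and Y :: "'b \<Rightarrow> real"
  assumes W: "integrable M W" "\<And>x. 0 \<le> W x" and X: "X \<in> borel_measurable M"
    and V: "integrable N V" "\<And>x. 0 \<le> V x" and Y: "Y \<in> borel_measurable N"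
    and eq: "\<And>t. (\<integral>x. W x *\<^sub>R cis (t * X x) \<partial>M) = (\<integral>x. V x *\<^sub>R cis (t * Y x) \<partial>N)"
    and A: "A \<in> sets borel"
  shows "(\<integral>x. W x * indicator A (X x) \<partial>M) = (\<integral>x. V x * indicator A (Y x) \<partial>N)"
proof -
  define m where "m = (\<integral>x. W x \<partial>M)"
  have "complex_of_real (\<integral>x. W x \<partial>M) = complex_of_real (\<integral>x. V x \<partial>N)"
    using eq[of 0] by (simp add: scaleR_conv_of_real flip: integral_complex_of_real)
  then have m2: "m = (\<integral>x. V x \<partial>N)"
    by (simp add: m_def)
  have "0 \<le> m" unfolding m_def using W by simp
  show ?thesis
  proof (cases "m = 0")
    case True
    have "AE x in M. W x = 0" "AE x in N. V x = 0"
      using integral_nonneg_eq_0_iff_AE[OF W(1)] integral_nonneg_eq_0_iff_AE[OF V(1)]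
        True m_def m2 W V by auto
    then have "(\<integral>x. W x * indicator A (X x) \<partial>M) = 0" "(\<integral>x. V x * indicator A (Y x) \<partial>N) = 0"
      by (auto intro!: integral_eq_zero_AE)
    then show ?thesis by simp
  next
    case False
    with \<open>0 \<le> m\<close> have "0 < m" by simp
    note M = weighted_law_char[OF W X m_def this]
    note N = weighted_law_char[OF V Y m2 \<open>0 < m\<close>]
    have "distr (density M (\<lambda>x. ennreal (W x / m))) borel X =
          distr (density N (\<lambda>x. ennreal (V x / m))) borel Y"
      using M(1) N(1) by (rule Levy_uniqueness) (simp add: fun_eq_iff M(2) N(2) eq)
    then show ?thesis
      using M(3)[OF A] N(3)[OF A] \<open>0 < m\<close> by simp
  qed
qed

text \<open>
The coordinates are peeled off one at a time.  To insert a coordinate \<open>j\<close> we have to know that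
multiplying the weight by the indicator of \<open>X j \<in> A j\<close> on both sides preserves the equality of the
characteristic functions of the remaining coordinates.  If \<open>\<theta>\<close> is a linear combination of these, the
weights \<open>W\<close>, \<open>W (1 + cos \<theta>)\<close> and \<open>W (1 + sin \<theta>)\<close> are nonnegative, so
\<open>weighted_char_unique\<close> applies to each of them, and \<open>W cis \<theta>\<close> is a linear combination of them.
\<close>

lemma joint_char_unique:
  fixes X :: "'i \<Rightarrow> 'a \<Rightarrow> real" and Y :: "'i \<Rightarrow> 'b \<Rightarrow> real"
  assumes "finite S"
    and X: "\<And>i. X i \<in> borel_measurable M" and Y: "\<And>i. Y i \<in> borel_measurable N"
    and A: "\<And>i. A i \<in> sets borel"
    and W: "integrable M W" "\<And>x. 0 \<le> W x" and V: "integrable N V" "\<And>x. 0 \<le> V x"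
    and eq: "\<And>c. (\<integral>x. W x *\<^sub>R cis (\<Sum>i\<in>S. c i * X i x) \<partial>M) =
                  (\<integral>x. V x *\<^sub>R cis (\<Sum>i\<in>S. c i * Y i x) \<partial>N)"
  shows "(\<integral>x. W x * (\<Prod>i\<in>S. indicator (A i) (X i x)) \<partial>M) =
         (\<integral>x. V x * (\<Prod>i\<in>S. indicator (A i) (Y i x)) \<partial>N)"
  using assms(1) W V eq
proof (induction S arbitrary: W V rule: finite_induct)
  case empty
  have "complex_of_real (\<integral>x. W x \<partial>M) = complex_of_real (\<integral>x. V x \<partial>N)"
    using empty(5)[of "\<lambda>_. 0"] by (simp add: scaleR_conv_of_real flip: integral_complex_of_real)
  then show ?case by simp
next
  case (insert j S)
  note [measurable] = X Y A borel_measurable_integrable[OF insert(4)]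
    borel_measurable_integrable[OF insert(6)]
  note W = insert(4,5) and V = insert(6,7)
  have eq: "(\<integral>x. W x *\<^sub>R cis (t * X j x + (\<Sum>i\<in>S. c i * X i x)) \<partial>M) =
            (\<integral>x. V x *\<^sub>R cis (t * Y j x + (\<Sum>i\<in>S. c i * Y i x)) \<partial>N)" for t c
  proof -
    have "(\<Sum>i\<in>insert j S. (c(j := t)) i * Z i) = t * Z j + (\<Sum>i\<in>S. c i * Z i)" for Z :: "'i \<Rightarrow> real"
      using insert(1,2) by (auto intro!: sum.cong)
    with insert(8)[of "c(j := t)"] show ?thesis by simp
  qed
  let ?I = "\<lambda>x. indicator (A j) (X j x) :: real" and ?J = "\<lambda>x. indicator (A j) (Y j x) :: real"
  have key: "(\<integral>x. (W x * ?I x) *\<^sub>R cis (\<Sum>i\<in>S. c i * X i x) \<partial>M) =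
             (\<integral>x. (V x * ?J x) *\<^sub>R cis (\<Sum>i\<in>S. c i * Y i x) \<partial>N)" for c
  proof -
    let ?a = "\<lambda>x. \<Sum>i\<in>S. c i * X i x" and ?b = "\<lambda>x. \<Sum>i\<in>S. c i * Y i x"
    have [measurable]: "?a \<in> borel_measurable M" "?b \<in> borel_measurable N" by measurable
    have e0: "(\<integral>x. W x *\<^sub>R cis (t * X j x) \<partial>M) = (\<integral>x. V x *\<^sub>R cis (t * Y j x) \<partial>N)" for t
      using eq[of t "\<lambda>_. 0"] by simp
    have ep: "(\<integral>x. W x *\<^sub>R cis (t * X j x + ?a x) \<partial>M) = (\<integral>x. V x *\<^sub>R cis (t * Y j x + ?b x) \<partial>N)" for t
      by (rule eq)
    have em: "(\<integral>x. W x *\<^sub>R cis (t * X j x - ?a x) \<partial>M) = (\<integral>x. V x *\<^sub>R cis (t * Y j x - ?b x) \<partial>N)" for t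
      using eq[of t "\<lambda>i. - c i"] by (simp add: sum_negf)
    have iM: "integrable M (\<lambda>x. W x *\<^sub>R cis (t * X j x))"
      "integrable M (\<lambda>x. W x *\<^sub>R cis (t * X j x + ?a x))"
      "integrable M (\<lambda>x. W x *\<^sub>R cis (t * X j x - ?a x))" for t
      by (intro integrable_weight_cis W; measurable)+
    have iN: "integrable N (\<lambda>x. V x *\<^sub>R cis (t * Y j x))"
      "integrable N (\<lambda>x. V x *\<^sub>R cis (t * Y j x + ?b x))"
      "integrable N (\<lambda>x. V x *\<^sub>R cis (t * Y j x - ?b x))" for t
      by (intro integrable_weight_cis V; measurable)+
    have c: "(w * (1 + cos a)) *\<^sub>R cis u = w *\<^sub>R cis u + (1/2) *\<^sub>R (w *\<^sub>R cis (u + a) + w *\<^sub>R cis (u - a))"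
      and s: "(w * (1 + sin a)) *\<^sub>R cis u = w *\<^sub>R cis u + (\<i>/2) * (w *\<^sub>R cis (u - a) - w *\<^sub>R cis (u + a))"
      for w a u :: real
      by (simp_all add: complex_eq_iff cos_add cos_diff sin_add sin_diff field_simps)
    have bw: "integrable M (\<lambda>x. W x * (1 + f (?a x)))" "integrable N (\<lambda>x. V x * (1 + f (?b x)))"
      if "\<And>x. \<bar>f x\<bar> \<le> 1" and [measurable]: "f \<in> borel_measurable borel" for f :: "real \<Rightarrow> real"
    proof -
      have "\<bar>1 + f x\<bar> \<le> 2" for x using that(1)[of x] by linarith
      then have *: "norm (w * (1 + f x)) \<le> norm (2 * w)" for w x
        using mult_left_mono[of "\<bar>1 + f x\<bar>" 2 "\<bar>w\<bar>"] by (simp add: abs_mult)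
      show "integrable M (\<lambda>x. W x * (1 + f (?a x)))"
        by (rule Bochner_Integration.integrable_bound[of _ "\<lambda>x. 2 * W x"], use W(1) in simp,
            measurable, rule AE_I2, rule *)
      show "integrable N (\<lambda>x. V x * (1 + f (?b x)))"
        by (rule Bochner_Integration.integrable_bound[of _ "\<lambda>x. 2 * V x"], use V(1) in simp,
            measurable, rule AE_I2, rule *)
    qed
    have nn: "0 \<le> W x * (1 + cos a)" "0 \<le> W x * (1 + sin a)" for x a
      using W(2)[of x] cos_ge_minus_one[of a] sin_ge_minus_one[of a]
      by (intro mult_nonneg_nonneg; linarith)+
    have nn': "0 \<le> V x * (1 + cos a)" "0 \<le> V x * (1 + sin a)" for x a
      using V(2)[of x] cos_ge_minus_one[of a] sin_ge_minus_one[of a]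
      by (intro mult_nonneg_nonneg; linarith)+
    have r0: "(\<integral>x. W x * ?I x \<partial>M) = (\<integral>x. V x * ?J x \<partial>N)"
      by (rule weighted_char_unique) (use W V e0 in auto)
    have rc: "(\<integral>x. (W x * (1 + cos (?a x))) * ?I x \<partial>M) = (\<integral>x. (V x * (1 + cos (?b x))) * ?J x \<partial>N)"
    proof (rule weighted_char_unique)
      show "(\<integral>x. (W x * (1 + cos (?a x))) *\<^sub>R cis (t * X j x) \<partial>M) =
            (\<integral>x. (V x * (1 + cos (?b x))) *\<^sub>R cis (t * Y j x) \<partial>N)" for t
        unfolding c using iM iN e0 ep em by simp
    qed (use bw[of cos] nn nn' in auto)
    have rs: "(\<integral>x. (W x * (1 + sin (?a x))) * ?I x \<partial>M) = (\<integral>x. (V x * (1 + sin (?b x))) * ?J x \<partial>N)"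
    proof (rule weighted_char_unique)
      show "(\<integral>x. (W x * (1 + sin (?a x))) *\<^sub>R cis (t * X j x) \<partial>M) =
            (\<integral>x. (V x * (1 + sin (?b x))) *\<^sub>R cis (t * Y j x) \<partial>N)" for t
        unfolding s using iM iN e0 ep em by simp
    qed (use bw[of sin] nn nn' in auto)
    have iI: "integrable M (\<lambda>x. f x * ?I x)" if "integrable M f" for f :: "'a \<Rightarrow> real"
      by (rule Bochner_Integration.integrable_bound[OF that])
         (use that in \<open>auto simp: indicator_def\<close>)
    have iJ: "integrable N (\<lambda>x. f x * ?J x)" if "integrable N f" for f :: "'b \<Rightarrow> real"
      by (rule Bochner_Integration.integrable_bound[OF that])
         (use that in \<open>auto simp: indicator_def\<close>)
    have d: "(w * i) *\<^sub>R cis u = of_real ((w * (1 + cos u)) * i - w * i) + \<i> * of_real ((w * (1 + sin u)) * i - w * i)"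
      for w i u :: real
      by (simp add: complex_eq_iff algebra_simps)
    have rc': "(\<integral>x. (W x * (1 + cos (?a x))) * ?I x - W x * ?I x \<partial>M) = (\<integral>x. (V x * (1 + cos (?b x))) * ?J x - V x * ?J x\<partial>N)"
      using rc r0 bw[of cos] W(1) V(1) by (subst (1 2) Bochner_Integration.integral_diff) (auto intro!: iI iJ)
    have rs': "(\<integral>x. (W x * (1 + sin (?a x))) * ?I x - W x * ?I x \<partial>M) = (\<integral>x. (V x * (1 + sin (?b x))) * ?J x - V x * ?J x\<partial>N)"
      using rs r0 bw[of sin] W(1) V(1) by (subst (1 2) Bochner_Integration.integral_diff) (auto intro!: iI iJ)
    have i1: "integrable M (\<lambda>x. (W x * (1 + cos (?a x))) * ?I x - W x * ?I x)"
       "integrable M (\<lambda>x. (W x * (1 + sin (?a x))) * ?I x - W x * ?I x)"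
       "integrable N (\<lambda>x. (V x * (1 + cos (?b x))) * ?J x - V x * ?J x)"
       "integrable N (\<lambda>x. (V x * (1 + sin (?b x))) * ?J x - V x * ?J x)"
      using bw[of cos] bw[of sin] W(1) V(1) by (intro Bochner_Integration.integrable_diff iI iJ; simp)+
    show ?thesis
      unfolding d using i1 rc' rs'
      by (subst (1 2) Bochner_Integration.integral_add)
         (auto intro!: integrable_of_real simp del: of_real_diff of_real_mult of_real_add)
  qed
  have "(\<integral>x. (W x * ?I x) * (\<Prod>i\<in>S. indicator (A i) (X i x)) \<partial>M) =
        (\<integral>x. (V x * ?J x) * (\<Prod>i\<in>S. indicator (A i) (Y i x)) \<partial>N)"
  proof (rule insert.IH[OF _ _ _ _ key])
    show "integrable M (\<lambda>x. W x * ?I x)"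
      by (rule Bochner_Integration.integrable_bound[OF W(1)]) (auto simp: indicator_def)
    show "integrable N (\<lambda>x. V x * ?J x)"
      by (rule Bochner_Integration.integrable_bound[OF V(1)]) (auto simp: indicator_def)
  qed (use W V in auto)
  then show ?case
    using insert(1,2) by (simp add: mult.assoc)
qed

lemma measurable_process:
  "(\<And>i. X i \<in> borel_measurable M) \<Longrightarrow> (\<lambda>\<omega> i. X i \<omega>) \<in> measurable M (PiM UNIV (\<lambda>_. borel))"
  by (intro measurable_PiM_single') auto

lemma process_law_unique:
  fixes X :: "'i \<Rightarrow> 'a \<Rightarrow> real" and Y :: "'i \<Rightarrow> 'b \<Rightarrow> real"
  assumes "prob_space M" "prob_space N"
    and X: "\<And>i. X i \<in> borel_measurable M" and Y: "\<And>i. Y i \<in> borel_measurable N"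
    and eq: "\<And>S c. finite S \<Longrightarrow> (\<integral>x. cis (\<Sum>i\<in>S. c i * X i x) \<partial>M) =
                  (\<integral>x. cis (\<Sum>i\<in>S. c i * Y i x) \<partial>N)"
  shows "distr M (PiM UNIV (\<lambda>_. borel)) (\<lambda>x i. X i x) = distr N (PiM UNIV (\<lambda>_. borel)) (\<lambda>x i. Y i x)"
proof (rule measure_eqI_PiM_infinite)
  interpret M: prob_space M by fact
  interpret N: prob_space N by fact
  note [measurable] = measurable_process[OF X] measurable_process[OF Y] X Y
  interpret D: prob_space "distr M (PiM UNIV (\<lambda>_. borel)) (\<lambda>x i. X i x)"
    by (rule M.prob_space_distr) measurable
  interpret D': prob_space "distr N (PiM UNIV (\<lambda>_. borel)) (\<lambda>x i. Y i x)"
    by (rule N.prob_space_distr) measurable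
  show "finite_measure (distr M (PiM UNIV (\<lambda>_. borel)) (\<lambda>x i. X i x))" by unfold_locales
  fix A :: "'i \<Rightarrow> real set" and J :: "'i set" assume J: "finite J" and AJ: "\<And>i. i \<in> J \<Longrightarrow> A i \<in> sets borel"
  define A' where "A' i = (if i \<in> J then A i else UNIV)" for i
  have [measurable]: "A' i \<in> sets borel" for i using AJ by (auto simp: A'_def)
  let ?E = "prod_emb UNIV (\<lambda>_. borel) J (Pi\<^sub>E J A)"
  have E: "?E \<in> sets (PiM UNIV (\<lambda>_. borel))" using J AJ by (intro sets_PiM_I) auto
  have ind: "indicator ?E z = (1::real) * (\<Prod>i\<in>J. indicator (A' i) (z i))" for z :: "'i \<Rightarrow> real"
    using J by (auto simp: indicator_def prod_emb_def A'_def PiE_iff extensional_def restrict_def)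
  have "(\<integral>x. (1::real) * (\<Prod>i\<in>J. indicator (A' i) (X i x)) \<partial>M) = (\<integral>x. 1 * (\<Prod>i\<in>J. indicator (A' i) (Y i x)) \<partial>N)"
    by (rule joint_char_unique[OF J, where W="\<lambda>_. 1" and V="\<lambda>_. 1" and A=A'])
       (use eq[OF J] X Y in auto)
  then have "(\<integral>x. indicator ?E (\<lambda>i. X i x) \<partial>M) = (\<integral>x. indicator ?E (\<lambda>i. Y i x) \<partial>N :: real)"
    unfolding ind by simp
  then have "(\<integral>z. indicator ?E z \<partial>distr M (PiM UNIV (\<lambda>_. borel)) (\<lambda>x i. X i x)) =
     (\<integral>z. indicator ?E z \<partial>distr N (PiM UNIV (\<lambda>_. borel)) (\<lambda>x i. Y i x) :: real)"
    using E by (simp add: integral_distr del: Bochner_Integration.integral_indicator)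
  then have "measure (distr M (PiM UNIV (\<lambda>_. borel)) (\<lambda>x i. X i x)) ?E =
     measure (distr N (PiM UNIV (\<lambda>_. borel)) (\<lambda>x i. Y i x)) ?E"
    using E by simp
  then show "distr M (PiM UNIV (\<lambda>_. borel)) (\<lambda>x i. X i x) ?E = distr N (PiM UNIV (\<lambda>_. borel)) (\<lambda>x i. Y i x) ?E"
    by (simp add: D.emeasure_eq_measure D'.emeasure_eq_measure)
qed auto

section \<open>Laws of an isonormal process\<close>

locale isonormal = prob_space M for M :: "'w measure" +
  fixes X :: "'h::{real_inner, banach, second_countable_topology} \<Rightarrow> 'w \<Rightarrow> real"
  assumes isonormal: "isonormal_gaussian_process M X"
begin

lemma X_gaussian: "centred_gaussian M (X v)"
proof -
  have "\<forall>S c. finite S \<longrightarrow> centred_gaussian M (\<lambda>\<omega>. \<Sum>i\<in>S. c i * X i \<omega>)"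
    using isonormal by (simp add: isonormal_gaussian_process_def centred_jointly_gaussian_def)
  from this[rule_format, of "{v}" "\<lambda>_. 1"] show ?thesis by simp
qed

lemma measurable_X [measurable]: "X v \<in> borel_measurable M"
  using X_gaussian[of v] by (simp add: centred_gaussian_def)

lemma measurable_path [measurable]: "(\<lambda>\<omega> v. X v \<omega>) \<in> measurable M (PiM UNIV (\<lambda>_. borel))"
  by (rule measurable_process) simp

lemma covariance: "(\<integral>\<omega>. X v \<omega> * X u \<omega> \<partial>M) = v \<bullet> u"
  using isonormal by (simp add: isonormal_gaussian_process_def)

lemma X_linear: "AE \<omega> in M. X (a *\<^sub>R v + b *\<^sub>R u) \<omega> = a * X v \<omega> + b * X u \<omega>"
  using isonormal by (simp add: isonormal_gaussian_process_def)

lemma X_zero: "AE \<omega> in M. X 0 \<omega> = 0"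
  using X_linear[of 0 0 0 0] by simp

lemma X_sum: "finite S \<Longrightarrow> AE \<omega> in M. X (\<Sum>i\<in>S. c i *\<^sub>R f i) \<omega> = (\<Sum>i\<in>S. c i * X (f i) \<omega>)"
proof (induction S rule: finite_induct)
  case empty
  then show ?case using X_zero by simp
next
  case (insert i S)
  show ?case
    using insert.IH X_linear[of "c i" "f i" 1 "\<Sum>i\<in>S. c i *\<^sub>R f i"]
    by eventually_elim (use insert.hyps in simp)
qed

lemma X_standardized:
  assumes "v \<noteq> 0"
  shows "distributed M lborel (\<lambda>\<omega>. X v \<omega> / norm v) std_normal_density"
proof -
  have not0: "\<not> (AE \<omega> in M. X v \<omega> = 0)"
  proof
    assume "AE \<omega> in M. X v \<omega> = 0"
    then have "(\<integral>\<omega>. X v \<omega> * X v \<omega> \<partial>M) = (\<integral>\<omega>. 0 \<partial>M)"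
      by (intro integral_cong_AE) auto
    then show False using covariance[of v v] assms by simp
  qed
  then obtain \<sigma> where \<sigma>: "\<sigma> > 0" "distributed M lborel (X v) (normal_density 0 \<sigma>)"
    using X_gaussian[of v] unfolding centred_gaussian_def by auto
  have "expectation (X v) = 0" "variance (X v) = \<sigma>\<^sup>2"
    by (rule normal_distributed_expectation[OF \<sigma>] normal_distributed_variance[OF \<sigma>])+
  then have "\<sigma>\<^sup>2 = (norm v)\<^sup>2"
    using covariance[of v v] by (simp add: power2_eq_square dot_square_norm)
  with \<sigma>(1) have "\<sigma> = norm v" by (simp add: power2_eq_iff_nonneg)
  with \<sigma> show ?thesis
    using normal_standard_normal_convert[of \<sigma> "X v" 0] by simp
qed

lemma char_X: "(\<integral>\<omega>. cis (X v \<omega>) \<partial>M) = exp (- (norm v)\<^sup>2 / 2)"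
proof (cases "v = 0")
  case True
  have "(\<integral>\<omega>. cis (X 0 \<omega>) \<partial>M) = (\<integral>\<omega>. 1 \<partial>M)"
    using X_zero by (intro integral_cong_AE) (auto simp: cis_conv_exp)
  with True show ?thesis by (simp add: prob_space)
next
  case False
  note D = X_standardized[OF False]
  have "distr M lborel (\<lambda>\<omega>. X v \<omega> / norm v) = std_normal_distribution"
    using distributed_distr_eq_density[OF D] by simp
  then have "distr M borel (\<lambda>\<omega>. X v \<omega> / norm v) = std_normal_distribution"
    by (simp cong: distr_cong)
  then have "(\<integral>\<omega>. iexp (norm v * (X v \<omega> / norm v)) \<partial>M) = char std_normal_distribution (norm v)"
    unfolding char_def by (subst integral_distr[symmetric, of _ M borel]) auto
  with False show ?thesis
    by (simp add: char_std_normal_distribution cis_conv_exp)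
qed

text \<open>
It is through this formula that the Gaussian law and the covariance enter the equalities in law below.
\<close>

lemma char_sum:
  assumes "finite S"
  shows "(\<integral>\<omega>. cis (\<Sum>i\<in>S. c i * X (f i) \<omega>) \<partial>M) = exp (- (norm (\<Sum>i\<in>S. c i *\<^sub>R f i))\<^sup>2 / 2)"
proof -
  have "(\<integral>\<omega>. cis (\<Sum>i\<in>S. c i * X (f i) \<omega>) \<partial>M) = (\<integral>\<omega>. cis (X (\<Sum>i\<in>S. c i *\<^sub>R f i) \<omega>) \<partial>M)"
    using X_sum[OF assms, of c f] unfolding cis_conv_exp
    by (intro integral_cong_AE) auto
  then show ?thesis by (simp add: char_X)
qed

lemma law_reflect:
  "distr M (PiM UNIV (\<lambda>_. borel)) (\<lambda>\<omega> v. X v \<omega>) = distr M (PiM UNIV (\<lambda>_. borel)) (\<lambda>\<omega> v. - X v \<omega>)"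
proof (rule process_law_unique)
  fix S :: "'h set" and c :: "'h \<Rightarrow> real" assume "finite S"
  then show "(\<integral>\<omega>. cis (\<Sum>i\<in>S. c i * X i \<omega>) \<partial>M) = (\<integral>\<omega>. cis (\<Sum>i\<in>S. c i * - X i \<omega>) \<partial>M)"
    using char_sum[of S c "\<lambda>v. v"] char_sum[of S "\<lambda>v. - c v" "\<lambda>v. v"] by (simp add: sum_negf)
qed (auto intro: prob_space_axioms)

text \<open>
Splitting \<open>v\<close> into its part along \<open>w\<close> and its part orthogonal to \<open>w\<close> makes \<open>X v\<close> a multiple
of the standard normal variable \<open>X w\<close> plus a variable that is uncorrelated with \<open>X w\<close>, hence
independent of it.  On the right the independence is expressed by a product space.
\<close>

lemma law_decouple:
  assumes w: "norm w = 1"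
  shows "distr M (PiM UNIV (\<lambda>_. borel)) (\<lambda>\<omega> v. X v \<omega>) =
    distr (M \<Otimes>\<^sub>M std_normal_distribution) (PiM UNIV (\<lambda>_. borel))
      (\<lambda>p v. X (v - (v \<bullet> w) *\<^sub>R w) (fst p) + (v \<bullet> w) * snd p)"
proof (rule process_law_unique)
  interpret G: real_distribution std_normal_distribution by (rule real_dist_normal_dist)
  interpret P: pair_prob_space M std_normal_distribution ..
  show "prob_space (M \<Otimes>\<^sub>M std_normal_distribution)" by (rule P.P.prob_space_axioms)
  fix S :: "'h set" and c :: "'h \<Rightarrow> real" assume S: "finite S"
  define u where "u = (\<Sum>v\<in>S. c v *\<^sub>R v)"
  have [measurable]: "cis \<in> borel_measurable borel" unfolding cis_conv_exp[abs_def] by measurable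
  have "(\<integral>p. cis (\<Sum>i\<in>S. c i * (X (i - (i \<bullet> w) *\<^sub>R w) (fst p) + (i \<bullet> w) * snd p)) \<partial>(M \<Otimes>\<^sub>M std_normal_distribution))
    = (\<integral>\<omega>. (\<integral>s. cis (\<Sum>i\<in>S. c i * (X (i - (i \<bullet> w) *\<^sub>R w) \<omega> + (i \<bullet> w) * s)) \<partial>std_normal_distribution) \<partial>M)"
    by (subst P.integral_fst'[symmetric]) (auto intro!: P.P.integrable_const_bound[where B=1])
  also have "\<dots> = (\<integral>\<omega>. (\<integral>s. cis (\<Sum>i\<in>S. c i * X (i - (i \<bullet> w) *\<^sub>R w) \<omega>) * cis ((u \<bullet> w) * s) \<partial>std_normal_distribution) \<partial>M)"
    by (intro Bochner_Integration.integral_cong refl)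
       (simp add: u_def inner_sum_left sum_distrib_right sum.distrib distrib_left cis_mult mult.assoc)
  also have "\<dots> = (\<integral>\<omega>. cis (\<Sum>i\<in>S. c i * X (i - (i \<bullet> w) *\<^sub>R w) \<omega>) \<partial>M) * char std_normal_distribution (u \<bullet> w)"
    unfolding char_def cis_conv_exp by simp
  also have "\<dots> = exp (- (norm (\<Sum>v\<in>S. c v *\<^sub>R (v - (v \<bullet> w) *\<^sub>R w)))\<^sup>2 / 2 - (u \<bullet> w)\<^sup>2 / 2)"
    unfolding char_sum[OF S] char_std_normal_distribution of_real_mult[symmetric] exp_add[symmetric]
    by simp
  also have "(\<Sum>v\<in>S. c v *\<^sub>R (v - (v \<bullet> w) *\<^sub>R w)) = u - (u \<bullet> w) *\<^sub>R w"
    by (simp add: u_def algebra_simps sum_subtractf scaleR_sum_left inner_sum_left)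
  also have "- (norm (u - (u \<bullet> w) *\<^sub>R w))\<^sup>2 / 2 - (u \<bullet> w)\<^sup>2 / 2 = - (norm u)\<^sup>2 / 2"
  proof -
    have "w \<bullet> w = 1" using w by (simp add: dot_square_norm)
    then have "(norm (u - (u \<bullet> w) *\<^sub>R w))\<^sup>2 = (norm u)\<^sup>2 - (u \<bullet> w)\<^sup>2"
      unfolding power2_norm_eq_inner
      by (simp add: inner_diff_left inner_diff_right inner_commute power2_eq_square)
    then show ?thesis by (simp add: diff_divide_distrib)
  qed
  finally show "(\<integral>\<omega>. cis (\<Sum>i\<in>S. c i * X i \<omega>) \<partial>M) =
    (\<integral>p. cis (\<Sum>i\<in>S. c i * (X (i - (i \<bullet> w) *\<^sub>R w) (fst p) + (i \<bullet> w) * snd p)) \<partial>(M \<Otimes>\<^sub>M std_normal_distribution))"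
    using char_sum[OF S, of c "\<lambda>v. v"] by (simp add: u_def)
qed (auto intro: prob_space_axioms)

text \<open>
Rotating two independent copies by half a right angle gives two independent copies again.
The pair of copies is one process indexed by vectors together with a flag.
\<close>

lemma law_rotate:
  "distr (M \<Otimes>\<^sub>M M) (PiM UNIV (\<lambda>_. borel)) (\<lambda>p (v, b). X v (if b then fst p else snd p)) =
   distr (M \<Otimes>\<^sub>M M) (PiM UNIV (\<lambda>_. borel))
     (\<lambda>p (v, b). (if b then X v (fst p) - X v (snd p) else X v (fst p) + X v (snd p)) / sqrt 2)"
proof -
  interpret P: pair_prob_space M M ..
  have [measurable]: "cis \<in> borel_measurable borel" unfolding cis_conv_exp[abs_def] by measurable
  have split: "(\<Sum>i\<in>S. h i) = (\<Sum>v\<in>fst ` S. (if (v, True) \<in> S then h (v, True) else 0) + (if (v, False) \<in> S then h (v, False) else 0))"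
    if "finite S" for S :: "('h \<times> bool) set" and h :: "'h \<times> bool \<Rightarrow> real"
  proof -
    have "(\<Sum>i\<in>S. h i) = (\<Sum>i\<in>fst ` S \<times> UNIV. if i \<in> S then h i else 0)"
      using that by (intro sum.mono_neutral_cong_left) (auto simp: image_iff, metis fst_conv)
    also have "\<dots> = (\<Sum>v\<in>fst ` S. \<Sum>b\<in>UNIV. if (v, b) \<in> S then h (v, b) else 0)"
      by (subst sum.cartesian_product) simp
    finally show ?thesis
      by (simp add: UNIV_bool add.commute)
  qed
  have F: "(\<integral>p. cis (\<Sum>v\<in>T. a v * X v (fst p) + b v * X v (snd p)) \<partial>(M \<Otimes>\<^sub>M M)) =
     exp (- ((norm (\<Sum>v\<in>T. a v *\<^sub>R v))\<^sup>2 + (norm (\<Sum>v\<in>T. b v *\<^sub>R v))\<^sup>2) / 2)"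
    if "finite T" for T and a b :: "'h \<Rightarrow> real"
  proof -
    have "(\<integral>p. cis (\<Sum>v\<in>T. a v * X v (fst p) + b v * X v (snd p)) \<partial>(M \<Otimes>\<^sub>M M)) =
      (\<integral>\<omega>. (\<integral>\<omega>'. cis (\<Sum>v\<in>T. a v * X v \<omega> + b v * X v \<omega>') \<partial>M) \<partial>M)"
      by (subst P.integral_fst'[symmetric]) (auto intro!: P.P.integrable_const_bound[where B=1])
    also have "\<dots> = (\<integral>\<omega>. cis (\<Sum>v\<in>T. a v * X v \<omega>) * (\<integral>\<omega>'. cis (\<Sum>v\<in>T. b v * X v \<omega>') \<partial>M) \<partial>M)"
      by (simp add: sum.distrib flip: cis_mult)
    also have "\<dots> = exp (- (norm (\<Sum>v\<in>T. a v *\<^sub>R v))\<^sup>2 / 2) * exp (- (norm (\<Sum>v\<in>T. b v *\<^sub>R v))\<^sup>2 / 2)"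
      using that by (simp add: char_sum[of T _ "\<lambda>v. v"])
    finally show ?thesis
      by (simp add: exp_add[symmetric] add_divide_distrib flip: of_real_mult)
  qed
  have "(\<lambda>p i. case i of (v, b) \<Rightarrow> X v (if b then fst p else snd p)) = (\<lambda>p i. X (fst i) (if snd i then fst p else snd p))"
     "(\<lambda>p i. case i of (v, b) \<Rightarrow> (if b then X v (fst p) - X v (snd p) else X v (fst p) + X v (snd p)) / sqrt 2)
    = (\<lambda>p i. (if snd i then X (fst i) (fst p) - X (fst i) (snd p) else X (fst i) (fst p) + X (fst i) (snd p)) / sqrt 2)"
    by (auto simp: fun_eq_iff)
  moreover have "distr (M \<Otimes>\<^sub>M M) (PiM UNIV (\<lambda>_. borel)) (\<lambda>p i. X (fst i) (if snd i then fst p else snd p)) =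
   distr (M \<Otimes>\<^sub>M M) (PiM UNIV (\<lambda>_. borel))
     (\<lambda>p i. (if snd i then X (fst i) (fst p) - X (fst i) (snd p) else X (fst i) (fst p) + X (fst i) (snd p)) / sqrt 2)"
  proof (rule process_law_unique)
    show "prob_space (M \<Otimes>\<^sub>M M)" "prob_space (M \<Otimes>\<^sub>M M)" by (rule P.P.prob_space_axioms)+
    show "(\<lambda>p. X (fst i) (if snd i then fst p else snd p)) \<in> borel_measurable (M \<Otimes>\<^sub>M M)" for i
      by (cases "snd i") auto
    fix S :: "('h \<times> bool) set" and c :: "'h \<times> bool \<Rightarrow> real" assume S: "finite S"
    define T a b where "T = fst ` S" and "a v = (if (v, True) \<in> S then c (v, True) else 0)"
      and "b v = (if (v, False) \<in> S then c (v, False) else 0)" for v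
    have T: "finite T" using S by (simp add: T_def)
    have 1: "(\<Sum>i\<in>S. c i * X (fst i) (if snd i then fst p else snd p)) =
      (\<Sum>v\<in>T. a v * X v (fst p) + b v * X v (snd p))" for p
      by (subst split[OF S]) (auto simp: T_def a_def b_def intro!: sum.cong)
    have 2: "(\<Sum>i\<in>S. c i * ((if snd i then X (fst i) (fst p) - X (fst i) (snd p) else X (fst i) (fst p) + X (fst i) (snd p)) / sqrt 2)) =
      (\<Sum>v\<in>T. ((a v + b v) / sqrt 2) * X v (fst p) + ((b v - a v) / sqrt 2) * X v (snd p))" for p
      by (subst split[OF S]) (auto simp: T_def a_def b_def left_diff_distrib right_diff_distrib distrib_left distrib_right add_divide_distrib diff_divide_distrib intro!: sum.cong)
    define A B where "A = (\<Sum>v\<in>T. a v *\<^sub>R v)" and "B = (\<Sum>v\<in>T. b v *\<^sub>R v)"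
    have s: "(\<Sum>v\<in>T. ((a v + b v) / sqrt 2) *\<^sub>R v) = (1 / sqrt 2) *\<^sub>R (A + B)"
      "(\<Sum>v\<in>T. ((b v - a v) / sqrt 2) *\<^sub>R v) = (1 / sqrt 2) *\<^sub>R (B - A)"
      unfolding A_def B_def sum.distrib[symmetric] sum_subtractf[symmetric] scaleR_sum_right
      by (auto intro!: sum.cong simp flip: scaleR_add_left scaleR_diff_left)
    have "(norm A)\<^sup>2 + (norm B)\<^sup>2 = (norm ((1 / sqrt 2) *\<^sub>R (A + B)))\<^sup>2 + (norm ((1 / sqrt 2) *\<^sub>R (B - A)))\<^sup>2"
      by (simp add: power_mult_distrib power_divide power2_norm_eq_inner algebra_simps inner_commute)
    then show "(\<integral>p. cis (\<Sum>i\<in>S. c i * X (fst i) (if snd i then fst p else snd p)) \<partial>(M \<Otimes>\<^sub>M M)) =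
      (\<integral>p. cis (\<Sum>i\<in>S. c i * ((if snd i then X (fst i) (fst p) - X (fst i) (snd p) else X (fst i) (fst p) + X (fst i) (snd p)) / sqrt 2)) \<partial>(M \<Otimes>\<^sub>M M))"
      unfolding 1 2 F[OF T] s by (simp add: A_def B_def)
  qed measurable
  ultimately show ?thesis by simp
qed

section \<open>Square integrability of suprema\<close>


text \<open>
If \<open>\<bar>x - y\<bar> \<le> s \<surd>2\<close> and \<open>\<bar>x + y\<bar> > 2 r \<surd>2\<close>, then both \<open>\<bar>x\<bar>\<close> and
\<open>\<bar>y\<bar>\<close> exceed \<open>(2 r - s) / \<surd>2 \<ge> r\<close>.  Applied to two independent copies and their rotation
by \<open>law_rotate\<close>, this bounds the tail at \<open>2 r\<close>, times the probability that the
supremum stays below \<open>s\<close>, by the square of the tail at \<open>r\<close>.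
\<close>

lemma tail_doubling:
  fixes c :: "nat \<Rightarrow> 'h" and s r :: real
  defines "G \<equiv> \<lambda>t::real. prob {\<omega> \<in> space M. \<exists>i. t < \<bar>X (c i) \<omega>\<bar>}"
  assumes "0 \<le> s" "2 * s \<le> r"
  shows "G (2 * r) * (1 - G s) \<le> (G r)\<^sup>2"
proof -
  interpret P: pair_prob_space M M ..
  let ?D = "PiM UNIV (\<lambda>_. borel) :: ('h \<times> bool \<Rightarrow> real) measure"
  define E where "E = {z \<in> space ?D. (\<forall>i. \<bar>z (c i, True)\<bar> \<le> s) \<and> (\<exists>i. 2 * r < \<bar>z (c i, False)\<bar>)}"
  have E[measurable]: "E \<in> sets ?D" unfolding E_def by measurable
  define Z1 Z2 where "Z1 = (\<lambda>p (v, b). X v (if b then fst p else snd p))"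
    and "Z2 = (\<lambda>p (v, b). (if b then X v (fst p) - X v (snd p) else X v (fst p) + X v (snd p)) / sqrt 2)"
  have Z1[measurable]: "Z1 \<in> measurable (M \<Otimes>\<^sub>M M) ?D"
  proof -
    have "(\<lambda>p i. X (fst i) (if snd i then fst p else snd p)) \<in> measurable (M \<Otimes>\<^sub>M M) ?D"
    proof (rule measurable_process)
      show "(\<lambda>p. X (fst i) (if snd i then fst p else snd p)) \<in> borel_measurable (M \<Otimes>\<^sub>M M)" for i
        by (cases "snd i") auto
    qed
    then show ?thesis by (simp add: Z1_def split_beta')
  qed
  have Z2[measurable]: "Z2 \<in> measurable (M \<Otimes>\<^sub>M M) ?D"
  proof -
    have "(\<lambda>p i. (if snd i then X (fst i) (fst p) - X (fst i) (snd p) else X (fst i) (fst p) + X (fst i) (snd p)) / sqrt 2) \<in> measurable (M \<Otimes>\<^sub>M M) ?D"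
      by (rule measurable_process) measurable
    then show ?thesis by (simp add: Z2_def split_beta')
  qed
  let ?L = "{\<omega> \<in> space M. \<forall>i. \<bar>X (c i) \<omega>\<bar> \<le> s}" and ?B = "\<lambda>t. {\<omega> \<in> space M. \<exists>i. t < \<bar>X (c i) \<omega>\<bar>}"
  have meas[measurable]: "?L \<in> sets M" "?B t \<in> sets M" for t by measurable
  have "?L = space M - ?B s" by (auto simp: not_less, meson leD)
  then have L: "prob ?L = 1 - G s"
    unfolding G_def by (simp add: prob_compl)
  have "prob ?L * prob (?B (2 * r)) = P.P.prob (?L \<times> ?B (2 * r))"
    using emeasure_pair_measure_Times[OF meas(1) meas(2)[of "2 * r"]]
    by (simp add: emeasure_eq_measure P.P.emeasure_eq_measure flip: ennreal_mult)
  also have "?L \<times> ?B (2 * r) = Z1 -` E \<inter> space (M \<Otimes>\<^sub>M M)"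
    by (auto simp: E_def Z1_def space_pair_measure space_PiM)
  also have "P.P.prob \<dots> = measure (distr (M \<Otimes>\<^sub>M M) ?D Z1) E"
    by (simp add: measure_distr)
  also have "\<dots> = measure (distr (M \<Otimes>\<^sub>M M) ?D Z2) E"
    using law_rotate by (simp add: Z1_def Z2_def)
  also have "\<dots> = P.P.prob (Z2 -` E \<inter> space (M \<Otimes>\<^sub>M M))"
    by (simp add: measure_distr)
  also have "\<dots> \<le> P.P.prob (?B r \<times> ?B r)"
  proof (rule P.P.finite_measure_mono)
    show "Z2 -` E \<inter> space (M \<Otimes>\<^sub>M M) \<subseteq> ?B r \<times> ?B r"
    proof
      fix p assume p: "p \<in> Z2 -` E \<inter> space (M \<Otimes>\<^sub>M M)"
      let ?x = "\<lambda>i. X (c i) (fst p)" and ?y = "\<lambda>i. X (c i) (snd p)"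
      have small: "\<bar>?x i - ?y i\<bar> \<le> sqrt 2 * s" for i
        using p by (auto simp: E_def Z2_def field_simps)
      obtain i where i: "sqrt 2 * (2 * r) < \<bar>?x i + ?y i\<bar>"
        using p by (auto simp: E_def Z2_def field_simps)
      \<comment> \<open>As \<open>s \<le> r / 2\<close>, it suffices that \<open>3 \<surd>2 \<ge> 4\<close>, for which \<open>1.4\<close> is close enough to \<open>\<surd>2\<close>.\<close>
      have "sqrt 2 * (4 * r - 2 * s) \<ge> sqrt 2 * (3 * r)"
        using assms by (intro mult_left_mono) auto
      moreover have "1.4 \<le> sqrt 2" by (rule real_le_rsqrt) (simp add: power2_eq_square)
      then have "1.4 * (3 * r) \<le> sqrt 2 * (3 * r)" using assms by (intro mult_right_mono) auto
      ultimately have "4 * r \<le> sqrt 2 * (4 * r - 2 * s)" using assms by linarith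
      with small[of i] i assms have "r < \<bar>?x i\<bar>" "r < \<bar>?y i\<bar>" by (auto simp: algebra_simps)
      with p show "p \<in> ?B r \<times> ?B r" by (auto simp: space_pair_measure)
    qed
  qed measurable
  also have "\<dots> = (G r)\<^sup>2"
    using emeasure_pair_measure_Times[OF meas(2)[of r] meas(2)[of r]]
    by (simp add: G_def emeasure_eq_measure P.P.emeasure_eq_measure power2_eq_square flip: ennreal_mult)
  finally show ?thesis using L by (simp add: G_def mult.commute)
qed

text \<open>
Gaussian boundedness only bounds the process from above; the lower bound comes from symmetry.
\<close>

lemma bdd_above_imp_bounded:
  fixes c :: "nat \<Rightarrow> 'h"
  assumes bdd: "AE \<omega> in M. bdd_above (range (\<lambda>i. X (c i) \<omega>))"
  shows "AE \<omega> in M. \<exists>n::nat. \<forall>i. \<bar>X (c i) \<omega>\<bar> \<le> real n"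
proof -
  have nat_bound: "bdd_above (range f) \<longleftrightarrow> (\<exists>n::nat. \<forall>i. f i \<le> real n)" for f :: "nat \<Rightarrow> real"
    by (auto simp: bdd_above_def) (meson order_trans real_arch_simple)
  have [measurable]: "Measurable.pred (PiM UNIV (\<lambda>_::'h. borel :: real measure)) (\<lambda>z. \<exists>n::nat. \<forall>i. z (c i) \<le> real n)"
    by measurable
  have "AE z in distr M (PiM UNIV (\<lambda>_. borel)) (\<lambda>\<omega> v. X v \<omega>). \<exists>n::nat. \<forall>i. z (c i) \<le> real n"
    using bdd by (subst AE_distr_iff) (auto simp: nat_bound)
  then have "AE \<omega> in M. \<exists>n::nat. \<forall>i. - X (c i) \<omega> \<le> real n"
    unfolding law_reflect by (subst (asm) AE_distr_iff) (auto intro!: measurable_process)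
  with bdd show ?thesis
  proof eventually_elim
    case (elim \<omega>)
    then obtain n m where *: "\<And>i. X (c i) \<omega> \<le> real n" "\<And>i. - X (c i) \<omega> \<le> real m"
      unfolding nat_bound by blast
    have "\<bar>X (c i) \<omega>\<bar> \<le> real (max n m)" for i
      using *(1)[of i] *(2)[of i] by (auto simp: abs_le_iff of_nat_max)
    then show ?case by blast
  qed
qed

text \<open>
By \<open>tail_doubling\<close> the tail of the supremum decays at least like \<open>8\<^sup>-\<^sup>k\<close> along the levels
\<open>a k = 2\<^sup>k a\<^sub>0\<close>, while the square of the level grows like \<open>4\<^sup>k\<close>.
\<close>

lemma sup_square_integrable:
  fixes c :: "nat \<Rightarrow> 'h"
  assumes bdd: "AE \<omega> in M. bdd_above (range (\<lambda>i. X (c i) \<omega>))"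
  obtains Z where "integrable M Z" "AE \<omega> in M. \<forall>i. (X (c i) \<omega>)\<^sup>2 \<le> Z \<omega>"
proof -
  define B where "B t = {\<omega> \<in> space M. \<exists>i. t < \<bar>X (c i) \<omega>\<bar>}" for t :: real
  have [measurable]: "B t \<in> sets M" for t unfolding B_def by measurable
  note bounded = bdd_above_imp_bounded[OF bdd]
  have "(\<lambda>n. prob (B (real n))) \<longlonglongrightarrow> prob (\<Inter>n. B (real n))"
    by (rule finite_Lim_measure_decseq)
       (auto simp: B_def decseq_def intro: order.strict_trans1[OF of_nat_mono])
  also have "prob (\<Inter>n. B (real n)) = 0"
  proof -
    have "AE \<omega> in M. \<omega> \<notin> (\<Inter>n. B (real n))"
      using bounded by eventually_elim (auto simp: B_def not_less)
    then show ?thesis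
      by (subst prob_eq_0) auto
  qed
  finally have "eventually (\<lambda>n. prob (B (real n)) < 1/16) sequentially"
    by (rule order_tendstoD) simp
  then obtain n where n: "prob (B (real (Suc n))) < 1/16"
    unfolding eventually_sequentially by (meson le_SucI order_refl)
  define s where "s = real (Suc n)"
  define a where "a k = 2 ^ k * (2 * s)" for k :: nat
  have s: "0 < s" "prob (B s) < 1/16" using n by (simp_all add: s_def)
  have a_pos: "0 < a k" for k using s by (simp add: a_def)
  have a_ge: "2 * s \<le> a k" for k using s mult_right_mono[of 1 "2 ^ k" "2 * s"] by (simp add: a_def)
  have decay: "prob (B (a k)) \<le> (1/8) ^ k" for k
  proof (induction k)
    case 0
    then show ?case by simp
  next
    case (Suc k)
    have "prob (B (a k)) \<le> prob (B s)"
    proof (rule finite_measure_mono)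
      have "s \<le> a k" using a_ge[of k] s by simp
      then show "B (a k) \<subseteq> B s" by (auto simp: B_def intro: order.strict_trans1)
    qed simp
    then have le: "prob (B (a k)) \<le> 1/16" using s by simp
    have "prob (B (a (Suc k))) * (15/16) \<le> prob (B (2 * a k)) * (1 - prob (B s))"
      using s by (auto simp: a_def mult.assoc intro!: mult_mono)
    also have "\<dots> \<le> (prob (B (a k)))\<^sup>2"
      using tail_doubling[of s "a k" c] s a_ge[of k] by (simp add: B_def)
    also have "\<dots> \<le> prob (B (a k)) * (1/16)"
      unfolding power2_eq_square using le by (intro mult_left_mono) auto
    \<comment> \<open>The factor is \<open>(1/16) / (15/16) = 1/15\<close>; any factor below \<open>1/4\<close> would do.\<close>
    finally have "prob (B (a (Suc k))) \<le> prob (B (a k)) / 15" by simp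
    also have "\<dots> \<le> prob (B (a k)) / 8" by (simp add: field_simps)
    also have "\<dots> \<le> (1/8) ^ Suc k" using Suc by simp
    finally show ?case .
  qed
  define f where "f \<omega> = ennreal ((a 0)\<^sup>2) + (\<Sum>k. ennreal ((a (Suc k))\<^sup>2) * indicator (B (a k)) \<omega>)" for \<omega>
  have f[measurable]: "f \<in> borel_measurable M" unfolding f_def by measurable
  have "(\<integral>\<^sup>+\<omega>. f \<omega> \<partial>M) = ennreal ((a 0)\<^sup>2) + (\<Sum>k. ennreal ((a (Suc k))\<^sup>2) * emeasure M (B (a k)))"
    unfolding f_def
    by (subst nn_integral_add) (auto simp: nn_integral_suminf nn_integral_cmult_indicator emeasure_space_1)
  also have "\<dots> \<le> ennreal ((a 0)\<^sup>2) + (\<Sum>k. ennreal (16 * s\<^sup>2 * (1/2) ^ k))"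
  proof (intro add_left_mono suminf_le)
    show "ennreal ((a (Suc k))\<^sup>2) * emeasure M (B (a k)) \<le> ennreal (16 * s\<^sup>2 * (1/2) ^ k)" for k
    proof -
      have "(a (Suc k))\<^sup>2 * prob (B (a k)) \<le> (a (Suc k))\<^sup>2 * (1/8) ^ k"
        using decay by (intro mult_left_mono) auto
      also have "\<dots> = 16 * s\<^sup>2 * ((2 ^ k)\<^sup>2 * (1/8) ^ k)"
        by (simp add: a_def power_mult_distrib)
      also have "(2 ^ k)\<^sup>2 * (1/8) ^ k = (1/2 :: real) ^ k"
        by (simp add: power2_eq_square flip: power_mult_distrib)
      finally show ?thesis
        by (simp add: emeasure_eq_measure flip: ennreal_mult)
    qed
  qed auto
  also have "\<dots> < \<infinity>"
  proof -
    have "summable (\<lambda>k. 16 * s\<^sup>2 * (1/2::real) ^ k)" by (intro summable_mult summable_geometric) simp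
    then have "(\<Sum>k. ennreal (16 * s\<^sup>2 * (1/2) ^ k)) \<noteq> top"
      by (rule ennreal_suminf_neq_top) auto
    then show ?thesis by (simp add: less_top)
  qed
  finally have fin: "(\<integral>\<^sup>+\<omega>. f \<omega> \<partial>M) < \<infinity>" .
  then have "AE \<omega> in M. f \<omega> \<noteq> \<infinity>"
    by (intro nn_integral_PInf_AE) auto
  moreover have "AE \<omega> in M. \<forall>i. ennreal ((X (c i) \<omega>)\<^sup>2) \<le> f \<omega>"
    using bounded AE_space
  proof eventually_elim
    case (elim \<omega>)
    then obtain n :: nat where n: "\<And>i. \<bar>X (c i) \<omega>\<bar> \<le> real n" by blast
    show ?case
    proof
      fix j
      show "ennreal ((X (c j) \<omega>)\<^sup>2) \<le> f \<omega>"
      proof (cases "\<bar>X (c j) \<omega>\<bar> \<le> a 0")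
        case True
        then have "(X (c j) \<omega>)\<^sup>2 \<le> (a 0)\<^sup>2" by (rule abs_le_square_iff[THEN iffD1, OF order_trans]) simp
        then have "ennreal ((X (c j) \<omega>)\<^sup>2) \<le> ennreal ((a 0)\<^sup>2)" by (rule ennreal_leI)
        then show ?thesis unfolding f_def by (rule order_trans) simp
      next
        case False
        have ex: "\<exists>k. \<bar>X (c j) \<omega>\<bar> \<le> a k"
        proof -
          obtain k where "real n / (2 * s) < 2 ^ k" using real_arch_pow[of 2 "real n / (2 * s)"] by auto
          then have "real n \<le> a k" using s by (simp add: a_def field_simps)
          then show ?thesis using n[of j] by (meson order_trans)
        qed
        define k where "k = (LEAST k. \<bar>X (c j) \<omega>\<bar> \<le> a k)"
        have k: "\<bar>X (c j) \<omega>\<bar> \<le> a k" unfolding k_def using ex by (rule LeastI_ex)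
        with False obtain m where m: "k = Suc m" by (cases k) auto
        have "\<not> \<bar>X (c j) \<omega>\<bar> \<le> a m" using not_less_Least[of m "\<lambda>k. \<bar>X (c j) \<omega>\<bar> \<le> a k"] m by (simp add: k_def)
        then have B: "\<omega> \<in> B (a m)" using elim by (auto simp: B_def not_le)
        have "(X (c j) \<omega>)\<^sup>2 \<le> (a (Suc m))\<^sup>2"
          using k m a_pos[of k] by (auto simp: abs_le_square_iff[symmetric])
        then have "ennreal ((X (c j) \<omega>)\<^sup>2) \<le> ennreal ((a (Suc m))\<^sup>2) * indicator (B (a m)) \<omega>"
          using B by (simp add: ennreal_leI)
        also have "\<dots> \<le> (\<Sum>k. ennreal ((a (Suc k))\<^sup>2) * indicator (B (a k)) \<omega>)"
        proof -
          have "g m \<le> (\<Sum>k. g k)" for g :: "nat \<Rightarrow> ennreal"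
            using sum_le_suminf[of g "{m}"] by simp
          then show ?thesis .
        qed
        also have "\<dots> \<le> f \<omega>" unfolding f_def by simp
        finally show ?thesis .
      qed
    qed
  qed
  ultimately have "AE \<omega> in M. \<forall>i. (X (c i) \<omega>)\<^sup>2 \<le> enn2real (f \<omega>)"
  proof eventually_elim
    case (elim \<omega>)
    then have "ennreal ((X (c i) \<omega>)\<^sup>2) \<le> ennreal (enn2real (f \<omega>))" for i by (simp add: less_top)
    then show ?case by (simp add: ennreal_le_iff)
  qed
  moreover have "integrable M (\<lambda>\<omega>. enn2real (f \<omega>))"
  proof (rule integrableI_bounded)
    have "(\<integral>\<^sup>+\<omega>. ennreal (norm (enn2real (f \<omega>))) \<partial>M) \<le> (\<integral>\<^sup>+\<omega>. f \<omega> \<partial>M)"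
      by (intro nn_integral_mono) (simp add: ennreal_enn2real_if)
    then show "(\<integral>\<^sup>+\<omega>. ennreal (norm (enn2real (f \<omega>))) \<partial>M) < \<infinity>"
      using fin by (rule order.strict_trans1)
  qed measurable
  ultimately show thesis using that by blast
qed

end

section \<open>Maximal points\<close>

lemma ereal_cSUP:
  fixes x :: "'a \<Rightarrow> real"
  assumes "A \<noteq> {}" "bdd_above (x ` A)"
  shows "(SUP a\<in>A. ereal (x a)) = ereal (SUP a\<in>A. x a)"
proof (rule antisym)
  show "(SUP a\<in>A. ereal (x a)) \<le> ereal (SUP a\<in>A. x a)"
    using assms by (auto intro!: SUP_least cSUP_upper)
  obtain a where a: "a \<in> A" using assms by blast
  obtain B where B: "\<And>a. a \<in> A \<Longrightarrow> x a \<le> B" using assms by (auto simp: bdd_above_def)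
  have "ereal (x a) \<le> (SUP a\<in>A. ereal (x a))" using a by (rule SUP_upper)
  moreover have "(SUP a\<in>A. ereal (x a)) \<le> ereal B" using B by (auto intro!: SUP_least)
  ultimately obtain r where r: "(SUP a\<in>A. ereal (x a)) = ereal r"
    by (cases "SUP a\<in>A. ereal (x a)") auto
  have "x a \<le> r" if "a \<in> A" for a
    using SUP_upper[OF that, of "\<lambda>a. ereal (x a)"] r by simp
  then show "ereal (SUP a\<in>A. x a) \<le> (SUP a\<in>A. ereal (x a))"
    using assms r by (auto intro!: cSUP_least)
qed

context isonormal
begin

text \<open>
Condition on the component orthogonal to \<open>w\<close>, using \<open>law_decouple\<close>.  As a function of the value
\<open>s\<close> of \<open>X w\<close>, the supremum over \<open>A\<close> has slopes at most \<open>\<alpha>\<close> and the supremum over \<open>B\<close>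
has slopes at least \<open>\<beta> > \<alpha>\<close>, so the two agree for at most one \<open>s\<close>.  Extended reals give the
suprema their usual meaning at every state.
\<close>

lemma separated_sups_differ:
  fixes A B :: "'h set"
  assumes "countable A" "countable B" "A \<noteq> {}" "B \<noteq> {}"
    and w: "norm w = 1" and "\<alpha> < \<beta>"
    and A: "\<And>v. v \<in> A \<Longrightarrow> v \<bullet> w \<le> \<alpha>" and B: "\<And>v. v \<in> B \<Longrightarrow> \<beta> \<le> v \<bullet> w"
  shows "AE \<omega> in M. \<not> ((SUP v\<in>A. ereal (X v \<omega>)) = (SUP v\<in>B. ereal (X v \<omega>)) \<and> (SUP v\<in>A. ereal (X v \<omega>)) \<noteq> \<infinity>)"
proof -
  interpret G: real_distribution std_normal_distribution by (rule real_dist_normal_dist)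
  interpret P: pair_prob_space M std_normal_distribution ..
  let ?D = "PiM UNIV (\<lambda>_. borel) :: ('h \<Rightarrow> real) measure"
  define S where "S = (\<lambda>(A :: 'h set) z. SUP v\<in>A. ereal (z v) :: ereal)"
  have [measurable]: "S A' \<in> borel_measurable ?D" if "countable A'" for A' :: "'h set"
    unfolding S_def using that by measurable
  have [measurable]: "S A \<in> borel_measurable ?D" "S B \<in> borel_measurable ?D" using assms(1,2) by simp_all
  define T where "T = (\<lambda>p v. X (v - (v \<bullet> w) *\<^sub>R w) (fst p) + (v \<bullet> w) * snd p)"
  have T[measurable]: "T \<in> measurable (M \<Otimes>\<^sub>M std_normal_distribution) ?D"
    unfolding T_def by (rule measurable_process) measurable
  have Q_sets[measurable]: "Measurable.pred ?D (\<lambda>z. \<not> (S A z = S B z \<and> S A z \<noteq> \<infinity>))"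
    unfolding pred_def by (intro sets.sets_Collect borel_measurable_eq) auto
  have "AE p in M \<Otimes>\<^sub>M std_normal_distribution. \<not> (S A (T p) = S B (T p) \<and> S A (T p) \<noteq> \<infinity>)"
  proof (rule P.AE_pair_measure)
    show "{p \<in> space (M \<Otimes>\<^sub>M std_normal_distribution). \<not> (S A (T p) = S B (T p) \<and> S A (T p) \<noteq> \<infinity>)}
      \<in> sets (M \<Otimes>\<^sub>M std_normal_distribution)"
      by measurable
    have "AE s in std_normal_distribution. \<not> (S A (T (\<omega>, s)) = S B (T (\<omega>, s)) \<and> S A (T (\<omega>, s)) \<noteq> \<infinity>)" for \<omega>
    proof -
      define Q where "Q s \<longleftrightarrow> S A (T (\<omega>, s)) = S B (T (\<omega>, s)) \<and> S A (T (\<omega>, s)) \<noteq> \<infinity>" for s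
      have no: False if "s < t" "Q s" "Q t" for s t
      proof -
        have "S A (T (\<omega>, t)) \<le> S A (T (\<omega>, s)) + ereal (\<alpha> * (t - s))"
          unfolding S_def
        proof (rule SUP_least)
          fix v assume v: "v \<in> A"
          have "(v \<bullet> w) * (t - s) \<le> \<alpha> * (t - s)" using A[OF v] that by (intro mult_right_mono) auto
          then have "T (\<omega>, t) v \<le> T (\<omega>, s) v + \<alpha> * (t - s)" by (simp add: T_def algebra_simps)
          then have "ereal (T (\<omega>, t) v) \<le> ereal (T (\<omega>, s) v) + ereal (\<alpha> * (t - s))" by simp
          also have "\<dots> \<le> (SUP v\<in>A. ereal (T (\<omega>, s) v)) + ereal (\<alpha> * (t - s))"
            using v by (intro add_right_mono SUP_upper)
          finally show "ereal (T (\<omega>, t) v) \<le> (SUP v\<in>A. ereal (T (\<omega>, s) v)) + ereal (\<alpha> * (t - s))" .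
        qed
        moreover have "S B (T (\<omega>, s)) \<le> S B (T (\<omega>, t)) + ereal (- \<beta> * (t - s))"
          unfolding S_def
        proof (rule SUP_least)
          fix v assume v: "v \<in> B"
          have "\<beta> * (t - s) \<le> (v \<bullet> w) * (t - s)" using B[OF v] that by (intro mult_right_mono) auto
          then have "T (\<omega>, s) v \<le> T (\<omega>, t) v + - \<beta> * (t - s)" by (simp add: T_def algebra_simps)
          then have "ereal (T (\<omega>, s) v) \<le> ereal (T (\<omega>, t) v) + ereal (- \<beta> * (t - s))" by simp
          also have "\<dots> \<le> (SUP v\<in>B. ereal (T (\<omega>, t) v)) + ereal (- \<beta> * (t - s))"
            using v by (intro add_right_mono SUP_upper)
          finally show "ereal (T (\<omega>, s) v) \<le> (SUP v\<in>B. ereal (T (\<omega>, t) v)) + ereal (- \<beta> * (t - s))" .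
        qed
        moreover have "S A (T (\<omega>, u)) \<noteq> -\<infinity>" for u
        proof -
          obtain v where "v \<in> A" using assms(3) by blast
          then have "ereal (T (\<omega>, u) v) \<le> S A (T (\<omega>, u))" unfolding S_def by (intro SUP_upper)
          then show ?thesis by auto
        qed
        then have "\<exists>a. S A (T (\<omega>, u)) = ereal a" if "Q u" for u
          using that unfolding Q_def by (metis ereal_cases)
        then obtain a b where ab: "S A (T (\<omega>, s)) = ereal a" "S A (T (\<omega>, t)) = ereal b"
          using \<open>Q s\<close> \<open>Q t\<close> by blast
        moreover have "S B (T (\<omega>, s)) = ereal a" "S B (T (\<omega>, t)) = ereal b"
          using that ab unfolding Q_def by auto
        moreover have "\<alpha> * (t - s) < \<beta> * (t - s)" using assms(6) that by simp
        ultimately show False by simp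
      qed
      show ?thesis
      proof (cases "\<exists>s. Q s")
        case True
        then obtain s where "Q s" by blast
        then have "\<not> Q t" if "t \<noteq> s" for t using no[of s t] no[of t s] that by (cases "s < t") auto
        moreover have "AE t in std_normal_distribution. t \<noteq> s"
          using AE_lborel_singleton[of s] by (subst AE_density) auto
        ultimately show ?thesis unfolding Q_def[symmetric] by auto
      next
        case False
        then show ?thesis unfolding Q_def[symmetric] by auto
      qed
    qed
    then show "AE \<omega> in M. AE s in std_normal_distribution. \<not> (S A (T (\<omega>, s)) = S B (T (\<omega>, s)) \<and> S A (T (\<omega>, s)) \<noteq> \<infinity>)"
      by simp
  qed
  then have "AE z in distr (M \<Otimes>\<^sub>M std_normal_distribution) ?D T. \<not> (S A z = S B z \<and> S A z \<noteq> \<infinity>)"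
    by (subst AE_distr_iff[OF T Q_sets[unfolded pred_def]])
  then have "AE z in distr M ?D (\<lambda>\<omega> v. X v \<omega>). \<not> (S A z = S B z \<and> S A z \<noteq> \<infinity>)"
    unfolding law_decouple[OF w] T_def .
  then have "AE \<omega> in M. \<not> (S A (\<lambda>v. X v \<omega>) = S B (\<lambda>v. X v \<omega>) \<and> S A (\<lambda>v. X v \<omega>) \<noteq> \<infinity>)"
    by (subst (asm) AE_distr_iff[OF measurable_path Q_sets[unfolded pred_def]])
  then show ?thesis by (simp add: S_def)
qed

text \<open>
The balls have a quarter of the distance of the centres as radius, so projecting on the line through
the centres separates them.
\<close>

lemma disjoint_ball_sups_differ:
  assumes "countable C" "p \<in> C" "q \<in> C" "p \<noteq> q"
  defines "r \<equiv> dist p q / 4"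
  shows "AE \<omega> in M. \<not> ((SUP v\<in>C \<inter> ball q r. ereal (X v \<omega>)) = (SUP v\<in>C \<inter> ball p r. ereal (X v \<omega>)) \<and>
           (SUP v\<in>C \<inter> ball q r. ereal (X v \<omega>)) \<noteq> \<infinity>)"
proof -
  define w where "w = (p - q) /\<^sub>R norm (p - q)"
  have w: "norm w = 1" using assms(4) by (simp add: w_def)
  have r: "0 < r" using assms(4) by (simp add: r_def)
  have pq: "p \<bullet> w - q \<bullet> w = 4 * r"
    using assms(4) unfolding inner_diff_left[symmetric] w_def r_def
    by (simp add: dist_norm dot_square_norm power2_eq_square)
  have close: "\<bar>(v - u) \<bullet> w\<bar> \<le> r" if "v \<in> ball u r" for u v
    using Cauchy_Schwarz_ineq2[of "v - u" w] that w by (simp add: dist_norm norm_minus_commute)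
  show ?thesis
  proof (rule separated_sups_differ[OF _ _ _ _ w])
    show "q \<bullet> w + r < p \<bullet> w - r" using pq r by simp
    show "v \<bullet> w \<le> q \<bullet> w + r" if "v \<in> C \<inter> ball q r" for v
      using close[of v q] that by (simp add: inner_diff_left)
    show "p \<bullet> w - r \<le> v \<bullet> w" if "v \<in> C \<inter> ball p r" for v
      using close[of v p] that by (simp add: inner_diff_left)
  qed (use assms r in auto)
qed

text \<open>
Only countably many pairs of balls are needed, namely those centred in \<open>C\<close>: two different maximal
points are separated by such a pair, over both of which the supremum is \<open>h\<close>.
\<close>

lemma maximal_point_unique:
  assumes C: "countable_dense_subset C K" and bdd: "AE \<omega> in M. bdd_above ((\<lambda>v. X v \<omega>) ` C)"
  shows "AE \<omega> in M. \<forall>v w. maximal_point X C K \<omega> v \<longrightarrow> maximal_point X C K \<omega> w \<longrightarrow> v = w"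
proof -
  have cC: "countable C" and dense: "K \<subseteq> closure C" using C by (auto simp: countable_dense_subset_def)
  let ?S = "\<lambda>\<omega> p r. SUP v\<in>C \<inter> ball p r. ereal (X v \<omega>)"
  have "AE \<omega> in M. \<forall>(p, q)\<in>{(p, q)\<in>C \<times> C. p \<noteq> q}.
      \<not> (?S \<omega> q (dist p q / 4) = ?S \<omega> p (dist p q / 4) \<and> ?S \<omega> q (dist p q / 4) \<noteq> \<infinity>)"
  proof (subst AE_ball_countable)
    show "countable {(p, q)\<in>C \<times> C. p \<noteq> q}"
      using cC by (intro countable_subset[OF _ countable_SIGMA[of C "\<lambda>_. C"]]) auto
  qed (use disjoint_ball_sups_differ[OF cC] in auto)
  with bdd show ?thesis
  proof eventually_elim
    case (elim \<omega>)
    let ?h = "support_function X C \<omega>"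
    have large: "?S \<omega> p r = ereal ?h" if v: "maximal_point X C K \<omega> v" "dist p v < r" for p v r
    proof -
      define e where "e = r - dist p v"
      have e: "0 < e" using v by (simp add: e_def)
      have sub: "ball v e \<subseteq> ball p r"
      proof
        fix u assume "u \<in> ball v e"
        then show "u \<in> ball p r" using dist_triangle[of p u v] by (simp add: e_def)
      qed
      have "v \<in> closure C" using v dense by (auto simp: maximal_point_def)
      then obtain u where u: "u \<in> C" "dist u v < e" using e by (auto simp: closure_approachable)
      then have ne: "C \<inter> ball v e \<noteq> {}" by (auto simp: dist_commute)
      have b: "bdd_above ((\<lambda>v. X v \<omega>) ` (C \<inter> E))" for E
        using elim(1) by (rule bdd_above_mono) auto
      have "ereal ?h = ereal (SUP w\<in>C \<inter> ball v e. X w \<omega>)"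
        using v e by (simp add: maximal_point_def)
      also have "\<dots> = ?S \<omega> v e" using ne b by (simp add: ereal_cSUP)
      also have "\<dots> \<le> ?S \<omega> p r" using sub by (intro SUP_subset_mono) auto
      finally have 1: "ereal ?h \<le> ?S \<omega> p r" .
      have "?S \<omega> p r \<le> (SUP v\<in>C. ereal (X v \<omega>))" by (intro SUP_subset_mono) auto
      also have "\<dots> = ereal ?h" using u elim(1) by (subst ereal_cSUP) (auto simp: support_function_def)
      finally show ?thesis using 1 by (rule antisym)
    qed
    show ?case
    proof (intro allI impI, rule ccontr)
      fix v w assume vw: "maximal_point X C K \<omega> v" "maximal_point X C K \<omega> w" "v \<noteq> w"
      have pos: "0 < dist v w / 8" using vw by simp
      moreover have "v \<in> closure C" "w \<in> closure C" using vw dense by (auto simp: maximal_point_def)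
      ultimately obtain p q where p: "p \<in> C" "dist p v < dist v w / 8" and q: "q \<in> C" "dist q w < dist v w / 8"
        unfolding closure_approachable by blast
      have "dist v w \<le> dist p v + dist p q + dist q w"
        using dist_triangle[of v w p] dist_triangle[of p w q] by (simp add: dist_commute)
      \<comment> \<open>The centres are more than three quarters of \<open>dist v w\<close> apart, and \<open>3/16 > 1/8\<close>.\<close>
      with p q pos have d: "dist v w / 8 < dist p q / 4" by linarith
      then have "p \<noteq> q" using vw by auto
      moreover have "?S \<omega> q (dist p q / 4) = ereal ?h" "?S \<omega> p (dist p q / 4) = ereal ?h"
        using large[OF vw(1), of p] large[OF vw(2), of q] p q d by auto
      ultimately show False using bspec[OF elim(2), of "(p, q)"] p q by simp
    qed
  qed
qed

end

text \<open>
Maximising sequences accumulate at maximal points.  This gives both existence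
(\<open>maximal_point_exists\<close>) and the gap away from a unique maximal point.
\<close>

lemma maximal_point_limit:
  fixes X :: "'h::metric_space \<Rightarrow> 'w \<Rightarrow> real"
  assumes "compact K" "C \<subseteq> K" "bdd_above ((\<lambda>v. X v \<omega>) ` C)"
    and c: "\<And>n. c n \<in> C" "(\<lambda>n. X (c n) \<omega>) \<longlonglongrightarrow> support_function X C \<omega>"
  obtains v r where "strict_mono r" "(c \<circ> r) \<longlonglongrightarrow> v" "maximal_point X C K \<omega> v"
proof -
  obtain v r where v: "v \<in> K" "strict_mono r" "(c \<circ> r) \<longlonglongrightarrow> v"
    using \<open>compact K\<close> c(1) assms(2) unfolding compact_def by (metis subset_iff)
  let ?h = "support_function X C \<omega>"
  have "(SUP w\<in>C \<inter> ball v e. X w \<omega>) = ?h" if e: "0 < e" for e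
  proof -
    have ev: "eventually (\<lambda>n. c (r n) \<in> C \<inter> ball v e) sequentially"
      using tendstoD[OF v(3) e] c(1) by (auto simp: dist_commute)
    have b: "bdd_above ((\<lambda>v. X v \<omega>) ` (C \<inter> ball v e))"
      using assms(3) by (rule bdd_above_mono) auto
    show ?thesis
    proof (rule antisym)
      show "(SUP w\<in>C \<inter> ball v e. X w \<omega>) \<le> ?h"
        unfolding support_function_def using ev assms(3)
        by (intro cSUP_subset_mono) (auto simp: eventually_sequentially)
      have "(\<lambda>n. X (c (r n)) \<omega>) \<longlonglongrightarrow> ?h"
        using LIMSEQ_subseq_LIMSEQ[OF c(2) v(2)] by (simp add: o_def)
      then show "?h \<le> (SUP w\<in>C \<inter> ball v e. X w \<omega>)"
        by (rule tendsto_upperbound) (use ev b in \<open>auto elim!: eventually_mono intro!: cSUP_upper\<close>)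
    qed
  qed
  with v show thesis using that by (auto simp: maximal_point_def)
qed

lemma near_supremum_sequence:
  fixes x :: "'a \<Rightarrow> real"
  assumes "A \<noteq> {}" "bdd_above (x ` A)"
  obtains c :: "nat \<Rightarrow> 'a" where "\<And>n. c n \<in> A" "(\<lambda>n. x (c n)) \<longlonglongrightarrow> (SUP a\<in>A. x a)"
proof -
  have "\<exists>a\<in>A. (SUP a\<in>A. x a) - 1 / real (Suc n) < x a" for n
    using assms by (subst less_cSUP_iff[symmetric]) auto
  then obtain c where c: "\<And>n. c n \<in> A" "\<And>n. (SUP a\<in>A. x a) - 1 / real (Suc n) < x (c n)"
    by metis
  have "(\<lambda>n. (SUP a\<in>A. x a) - 1 / real (Suc n)) \<longlonglongrightarrow> (SUP a\<in>A. x a) - 0"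
    using LIMSEQ_inverse_real_of_nat by (intro tendsto_intros) (simp add: divide_inverse)
  then have "(\<lambda>n. x (c n)) \<longlonglongrightarrow> (SUP a\<in>A. x a)"
    unfolding diff_zero by (rule tendsto_sandwich[OF _ _ _ tendsto_const, rotated 2])
       (use c assms in \<open>auto intro!: always_eventually cSUP_upper intro: less_imp_le simp: algebra_simps\<close>)
  with c that show thesis by blast
qed

lemma maximal_point_exists:
  fixes X :: "'h::metric_space \<Rightarrow> 'w \<Rightarrow> real"
  assumes "compact K" "C \<subseteq> K" "C \<noteq> {}" "bdd_above ((\<lambda>v. X v \<omega>) ` C)"
  shows "\<exists>v. maximal_point X C K \<omega> v"
proof -
  obtain c :: "nat \<Rightarrow> 'h" where "\<And>n. c n \<in> C" "(\<lambda>n. X (c n) \<omega>) \<longlonglongrightarrow> (SUP v\<in>C. X v \<omega>)"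
    using near_supremum_sequence[OF assms(3,4)] by blast
  then show ?thesis
    using maximal_point_limit[of K C X \<omega> c] assms unfolding support_function_def by blast
qed

text \<open>
Without a gap there would be a maximising sequence outside the ball, and it would accumulate at a
second maximal point.
\<close>

lemma sup_gap_off_maximal_point:
  fixes X :: "'h::metric_space \<Rightarrow> 'w \<Rightarrow> real"
  assumes K: "compact K" "C \<subseteq> K" and bdd: "bdd_above ((\<lambda>v. X v \<omega>) ` C)"
    and unique: "unique_maximal_point X C K \<omega> v" and e: "0 < e"
  obtains \<delta> where "0 < \<delta>" "\<And>u. u \<in> C \<Longrightarrow> e \<le> dist u v \<Longrightarrow> X u \<omega> \<le> support_function X C \<omega> - \<delta>"
proof -
  let ?h = "support_function X C \<omega>"
  have "\<exists>\<delta>>0. \<forall>u\<in>C. e \<le> dist u v \<longrightarrow> X u \<omega> \<le> ?h - \<delta>"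
  proof (rule ccontr)
    assume "\<not> ?thesis"
    then have "\<exists>u\<in>C. e \<le> dist u v \<and> ?h - 1 / real (Suc n) < X u \<omega>" for n
      by (force simp: not_le)
    then obtain c where c: "\<And>n. c n \<in> C" "\<And>n. e \<le> dist (c n) v" "\<And>n. ?h - 1 / real (Suc n) < X (c n) \<omega>"
      by metis
    have "(\<lambda>n. ?h - 1 / real (Suc n)) \<longlonglongrightarrow> ?h - 0"
      using LIMSEQ_inverse_real_of_nat by (intro tendsto_intros) (simp add: divide_inverse)
    then have "(\<lambda>n. X (c n) \<omega>) \<longlonglongrightarrow> ?h"
      unfolding diff_zero by (rule tendsto_sandwich[OF _ _ _ tendsto_const, rotated 2])
       (use c bdd in \<open>auto intro!: always_eventually cSUP_upper intro: less_imp_le simp: algebra_simps support_function_def\<close>)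
    then obtain w r where "strict_mono r" and w: "(c \<circ> r) \<longlonglongrightarrow> w" "maximal_point X C K \<omega> w"
      by (rule maximal_point_limit[of K C X \<omega> c, OF K bdd c(1)])
    have "w = v" using unique w by (simp add: unique_maximal_point_def)
    then have "eventually (\<lambda>n. dist (c (r n)) v < e) sequentially"
      using tendstoD[OF w(1) e] by simp
    then obtain n where "dist (c (r n)) v < e" by (auto simp: eventually_sequentially)
    with c(2)[of "r n"] show False by simp
  qed
  then show thesis using that by blast
qed

section \<open>Calculus of smooth functions of finitely many variables\<close>

text \<open>
Integrate \<open>F (s + 1) - F s = \<integral>r\<in>{0..1}. F' (s + r)\<close> over all \<open>s\<close>.  By translation
invariance the left side gives \<open>0\<close>, and by Fubini the right side gives the integral of \<open>F'\<close>.
\<close>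

lemma integral_deriv_eq_0:
  fixes F F' :: "real \<Rightarrow> real"
  assumes F: "integrable lborel F" and F': "integrable lborel F'"
    and deriv: "\<And>x. (F has_real_derivative F' x) (at x)" and cont: "\<And>x. isCont F' x"
  shows "(\<integral>x. F' x \<partial>lborel) = 0"
proof -
  note [measurable] = borel_measurable_integrable[OF F']
  let ?I = "indicator {0..1} :: real \<Rightarrow> real"
  have int_shift: "integrable lborel (\<lambda>s. g (s + r))" "(\<integral>s. g (s + r) \<partial>lborel) = (\<integral>s. g s \<partial>lborel)"
    if "integrable lborel g" for g :: "real \<Rightarrow> real" and r
    using lborel_integrable_real_affine[OF that, of 1 r] lborel_integral_real_affine[of 1 g r]
    by (simp_all add: add.commute)
  have shift: "(\<integral>r. F' (s + r) * ?I r \<partial>lborel) = F (s + 1) - F s" for s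
  proof -
    have "(\<integral>r. F' (s + r) * ?I r \<partial>lborel) = F (s + 1) - F (s + 0)"
    proof (rule integral_FTC_Icc_real)
      show "((\<lambda>r. F (s + r)) has_real_derivative F' (s + r)) (at r)" for r
        using DERIV_shift[of F "F' (s + r)" r s] deriv[of "s + r"] by (simp add: add.commute)
      show "isCont (\<lambda>r. F' (s + r)) r" for r
        by (intro continuous_intros isCont_o2[OF _ cont])
    qed simp
    then show ?thesis by simp
  qed
  have "(\<integral>s. (\<integral>r. F' (s + r) * ?I r \<partial>lborel) \<partial>lborel) = (\<integral>r. (\<integral>s. F' (s + r) * ?I r \<partial>lborel) \<partial>lborel)"
  proof (rule lborel_pair.Fubini_integral[where f="\<lambda>r s. F' (s + r) * ?I r"])
    show "integrable (lborel \<Otimes>\<^sub>M lborel) (\<lambda>(r, s). F' (s + r) * ?I r)"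
    proof (rule lborel_pair.Fubini_integrable)
      have "(\<integral>s. norm (F' (s + r) * ?I r) \<partial>lborel) = (\<integral>s. \<bar>F' s\<bar> \<partial>lborel) * ?I r" for r
        using int_shift(2)[of "\<lambda>s. \<bar>F' s\<bar>" r] F' by (simp add: abs_mult)
      moreover have "integrable lborel (\<lambda>r. (\<integral>s. \<bar>F' s\<bar> \<partial>lborel) * ?I r)" by simp
      ultimately show "integrable lborel (\<lambda>r. \<integral>s. norm (case (r, s) of (r, s) \<Rightarrow> F' (s + r) * ?I r) \<partial>lborel)"
        by simp
    qed (use int_shift[OF F'] in auto)
  qed
  also have "\<dots> = (\<integral>r. (\<integral>s. F' s \<partial>lborel) * ?I r \<partial>lborel)"
    using int_shift[OF F'] by simp
  also have "\<dots> = (\<integral>s. F' s \<partial>lborel)" by simp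
  finally have "(\<integral>s. F' s \<partial>lborel) = (\<integral>s. F (s + 1) - F s \<partial>lborel)"
    by (simp add: shift)
  also have "\<dots> = 0" using int_shift[OF F, of 1] F by simp
  finally show ?thesis .
qed

lemma integrable_std_normal_iff:
  fixes f :: "real \<Rightarrow> real"
  assumes "f \<in> borel_measurable borel"
  shows "integrable std_normal_distribution f \<longleftrightarrow> integrable lborel (\<lambda>x. std_normal_density x * f x)"
    and "(\<integral>x. f x \<partial>std_normal_distribution) = (\<integral>x. std_normal_density x * f x \<partial>lborel)"
  using assms by (simp_all add: integrable_density integral_density)

text \<open>
The function \<open>s \<mapsto> \<phi> s f s\<close>, with \<open>\<phi>\<close> the normal density, has the derivative
\<open>\<phi> s (f' s - s f s)\<close>, because \<open>\<phi>' s = - s \<phi> s\<close>.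
\<close>

lemma gaussian_integration_by_parts:
  fixes f f' :: "real \<Rightarrow> real"
  assumes deriv: "\<And>x. (f has_real_derivative f' x) (at x)" and cont: "continuous_on UNIV f'"
    and int: "integrable std_normal_distribution f" "integrable std_normal_distribution f'"
      "integrable std_normal_distribution (\<lambda>x. x * f x)"
  shows "(\<integral>x. x * f x \<partial>std_normal_distribution) = (\<integral>x. f' x \<partial>std_normal_distribution)"
proof -
  let ?d = "std_normal_density"
  have "continuous_on UNIV f" using DERIV_isCont[OF deriv] by (simp add: continuous_at_imp_continuous_on)
  then have [measurable]: "f \<in> borel_measurable borel" "f' \<in> borel_measurable borel"
    using cont by (auto intro: borel_measurable_continuous_onI)
  have d': "(?d has_real_derivative - x * ?d x) (at x)" for x
    unfolding std_normal_density_def by (auto intro!: derivative_eq_intros simp: field_simps)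
  have i: "integrable lborel (\<lambda>x. ?d x * f x)" "integrable lborel (\<lambda>x. ?d x * f' x)"
    "integrable lborel (\<lambda>x. ?d x * (x * f x))"
    using int by (simp_all add: integrable_std_normal_iff)
  have "(\<integral>x. ?d x * f' x - ?d x * (x * f x) \<partial>lborel) = 0"
  proof (rule integral_deriv_eq_0)
    show "((\<lambda>x. ?d x * f x) has_real_derivative ?d x * f' x - ?d x * (x * f x)) (at x)" for x
      by (rule derivative_eq_intros deriv d' refl)+ (simp add: algebra_simps)
    have "continuous_on UNIV (\<lambda>x. ?d x * f' x - ?d x * (x * f x))"
      using \<open>continuous_on UNIV f\<close> cont unfolding std_normal_density_def by (intro continuous_intros) auto
    then show "isCont (\<lambda>x. ?d x * f' x - ?d x * (x * f x)) x" for x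
      by (simp add: continuous_on_eq_continuous_at)
  qed (use i in auto)
  then show ?thesis
    using i by (simp add: integrable_std_normal_iff)
qed

lemma smooth_cong: "smooth_polynomial_growth n f \<Longrightarrow> (\<And>i. i < n \<Longrightarrow> x i = y i) \<Longrightarrow> f x = f y"
  by (simp add: smooth_polynomial_growth_def)

lemma smooth_continuous: "smooth_polynomial_growth n f \<Longrightarrow> continuous_on UNIV f"
  unfolding smooth_polynomial_growth_def iterated_partial_deriv_def
  by (metis empty_set empty_subsetI foldr.simps(1) id_apply)

lemma smooth_growth:
  assumes "smooth_polynomial_growth n f"
  obtains C k where "\<And>x. \<bar>f x\<bar> \<le> C * (1 + (\<Sum>i<n. \<bar>x i\<bar>)) ^ k"
proof -
  have "\<exists>C k. \<forall>x. \<bar>iterated_partial_deriv [] f x\<bar> \<le> C * (1 + (\<Sum>i<n. \<bar>x i\<bar>)) ^ k"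
    using assms unfolding smooth_polynomial_growth_def by (metis empty_set empty_subsetI)
  then show thesis using that by (auto simp: iterated_partial_deriv_def)
qed

lemma smooth_partial_deriv:
  assumes f: "smooth_polynomial_growth n f" and "i < n"
  shows "smooth_polynomial_growth n (partial_deriv i f)"
  unfolding smooth_polynomial_growth_def
proof (intro conjI allI impI)
  show "partial_deriv i f x = partial_deriv i f y" if "\<forall>i<n. x i = y i" for x y
  proof -
    have "(\<lambda>t. f (x(i := t))) = (\<lambda>t. f (y(i := t)))"
      using that by (intro ext smooth_cong[OF f]) auto
    then show ?thesis using that \<open>i < n\<close> by (simp add: partial_deriv_def)
  qed
  fix js assume "set js \<subseteq> {..<n}"
  then have *: "set (js @ [i]) \<subseteq> {..<n}" using \<open>i < n\<close> by simp
  have eq: "iterated_partial_deriv js (partial_deriv i f) = iterated_partial_deriv (js @ [i]) f"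
    by (simp add: iterated_partial_deriv_def)
  have f': "\<forall>is. set is \<subseteq> {..<n} \<longrightarrow>
        continuous_on UNIV (iterated_partial_deriv is f) \<and>
        (\<forall>x. \<forall>i<n. (\<lambda>t. iterated_partial_deriv is f (x(i := t))) field_differentiable at (x i)) \<and>
        (\<exists>C k. \<forall>x. \<bar>iterated_partial_deriv is f x\<bar> \<le> C * (1 + (\<Sum>i<n. \<bar>x i\<bar>)) ^ k)"
    using f unfolding smooth_polynomial_growth_def by blast
  note f'' = f'[rule_format, OF *]
  show "continuous_on UNIV (iterated_partial_deriv js (partial_deriv i f))"
    "\<exists>C k. \<forall>x. \<bar>iterated_partial_deriv js (partial_deriv i f) x\<bar> \<le> C * (1 + (\<Sum>i<n. \<bar>x i\<bar>)) ^ k"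
    unfolding eq using f'' by blast+
  show "(\<lambda>t. iterated_partial_deriv js (partial_deriv i f) (x(l := t))) field_differentiable at (x l)"
    if "l < n" for l x
    unfolding eq using f'' that by blast
qed

lemma smooth_has_partial_deriv:
  assumes f: "smooth_polynomial_growth n f" and "i < n"
  shows "((\<lambda>t. f (x(i := t))) has_real_derivative partial_deriv i f (x(i := s))) (at s)"
proof -
  have "\<forall>x. \<forall>i<n. (\<lambda>t. iterated_partial_deriv [] f (x(i := t))) field_differentiable at (x i)"
    using f unfolding smooth_polynomial_growth_def by (metis empty_set empty_subsetI)
  then have "(\<lambda>t. f ((x(i := s))(i := t))) field_differentiable at ((x(i := s)) i)"
    using \<open>i < n\<close> unfolding iterated_partial_deriv_def foldr.simps id_apply by blast
  then show ?thesis
    by (simp add: partial_deriv_def DERIV_deriv_iff_field_differentiable)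
qed

text \<open>
Sequence space carries no norm, so there is no total derivative to compose with.  Instead one lets
one coordinate after the other move; each step is the criterion that a function of two real variables
with a continuous partial derivative is differentiable.
\<close>

lemma chain_rule_partial:
  assumes f: "smooth_polynomial_growth n f"
  shows "((\<lambda>s. f (\<lambda>i. y i + a i * s)) has_real_derivative
           (\<Sum>j<n. a j * partial_deriv j f (\<lambda>i. y i + a i * s))) (at s)"
proof -
  have "((\<lambda>s. f (\<lambda>i. if i < m then y i + a i * s else z i)) has_real_derivative
           (\<Sum>j<m. a j * partial_deriv j f (\<lambda>i. if i < m then y i + a i * s else z i))) (at s)"
    if "m \<le> n" for m z s
    using that
  proof (induction m arbitrary: z s)
    case 0
    then show ?case by simp
  next
    case (Suc m)
    then have m: "m < n" by simp
    \<comment> \<open>The coordinate \<open>m\<close> gets a parameter of its own; the curve of the next step is the diagonal \<open>u = t\<close>.\<close>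
    define P where "P u t i = (if i < m then y i + a i * u else (z(m := y m + a m * t)) i)" for u t i
    have P_upd: "P u t = (P u t')(m := y m + a m * t)" for u t t'
      by (auto simp: P_def fun_eq_iff)
    have P_diag: "P u u = (\<lambda>i. if i < Suc m then y i + a i * u else z i)" for u
      by (auto simp: P_def fun_eq_iff less_Suc_eq)
    let ?fy = "\<lambda>u t. blinfun_scaleR_left (a m * partial_deriv m f (P u t))"
    have cP: "continuous_on UNIV (\<lambda>p. P (fst p) (snd p))"
    proof (rule continuous_on_coordinatewise_then_product)
      show "continuous_on UNIV (\<lambda>p. P (fst p) (snd p) i)" for i
        unfolding P_def by (cases "i < m"; cases "i = m") (auto intro!: continuous_intros)
    qed
    have fx: "((\<lambda>u. f (P u s)) has_derivative (\<lambda>tu. (\<Sum>j<m. a j * partial_deriv j f (P s s)) * tu)) (at s within UNIV)"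
        using Suc.IH[of "z(m := y m + a m * s)" s] m unfolding P_def has_field_derivative_def by simp
    have fy: "((\<lambda>t. f (P u t)) has_derivative blinfun_apply (?fy u t)) (at t within UNIV)" for u t
      proof -
        have "((\<lambda>t'. f ((P u t)(m := y m + a m * t'))) has_real_derivative
            partial_deriv m f ((P u t)(m := y m + a m * t)) * (a m)) (at t)"
          by (rule DERIV_chain2[OF smooth_has_partial_deriv[OF f m]]) (auto intro!: derivative_eq_intros)
        then show ?thesis
          by (simp add: has_field_derivative_def P_upd[symmetric] mult.commute[of _ "a m"] mult_commute_abs)
      qed
      have "continuous_on UNIV (\<lambda>p. partial_deriv m f (P (fst p) (snd p)))"
        by (rule continuous_on_compose2[OF smooth_continuous[OF smooth_partial_deriv[OF f m]] cP]) auto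
      then have "continuous_on UNIV (\<lambda>p. ?fy (fst p) (snd p))"
        by (intro bounded_linear.continuous_on[OF bounded_linear_blinfun_scaleR_left] continuous_intros)
    then have cont: "continuous (at (s, s) within UNIV \<times> UNIV) (\<lambda>(u, t). ?fy u t)"
        by (simp add: continuous_on_eq_continuous_within split_beta')
    have "((\<lambda>(u, t). f (P u t)) has_derivative
       (\<lambda>(tu, tt). (\<Sum>j<m. a j * partial_deriv j f (P s s)) * tu + ?fy s s tt)) (at (s, s) within UNIV \<times> UNIV)"
      by (rule has_derivative_partialsI[where f="\<lambda>u t. f (P u t)" and fy="?fy", OF fx fy cont]) auto
    then have H: "((\<lambda>p. f (P (fst p) (snd p))) has_derivative
       (\<lambda>(tu, tt). (\<Sum>j<m. a j * partial_deriv j f (P s s)) * tu + ?fy s s tt)) (at (s, s))"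
      by (simp add: split_beta')
    have "((\<lambda>u. (u, u)) has_derivative (\<lambda>t. (t, t))) (at s)"
      by (auto intro!: derivative_eq_intros)
    from has_derivative_compose[OF this H]
    have "((\<lambda>u. f (P u u)) has_derivative (\<lambda>t. (\<Sum>j<m. a j * partial_deriv j f (P s s)) * t + t * (a m * partial_deriv m f (P s s)))) (at s)"
      by simp
    moreover have "(\<lambda>t. (\<Sum>j<m. a j * partial_deriv j f (P s s)) * t + t * (a m * partial_deriv m f (P s s))) =
      (*) (\<Sum>j<Suc m. a j * partial_deriv j f (P s s))"
      by (auto simp: fun_eq_iff algebra_simps)
    ultimately show ?case
      unfolding has_field_derivative_def P_diag by simp
  qed
  from this[of n "\<lambda>_. 0" s] have *: "((\<lambda>s. f (\<lambda>i. if i < n then y i + a i * s else 0)) has_real_derivative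
           (\<Sum>j<n. a j * partial_deriv j f (\<lambda>i. if i < n then y i + a i * s else 0))) (at s)" by simp
  have c: "g (\<lambda>i. if i < n then y i + a i * s else 0) = g (\<lambda>i. y i + a i * s)" if "smooth_polynomial_growth n g" for g s
    by (rule smooth_cong[OF that]) simp
  have "(\<Sum>j<n. a j * partial_deriv j f (\<lambda>i. if i < n then y i + a i * s else 0)) =
    (\<Sum>j<n. a j * partial_deriv j f (\<lambda>i. y i + a i * s))"
    by (intro sum.cong refl) (simp add: c[OF smooth_partial_deriv[OF f]])
  with * show ?thesis using c[OF f] by simp
qed

section \<open>Gaussian integration by parts\<close>

context isonormal
begin

text \<open>
Having moments of all orders is stable under sums and products, which settles every integrability
question about smooth functionals.
\<close>

definition finite_moments :: "('w \<Rightarrow> real) \<Rightarrow> bool" where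
  "finite_moments Z \<longleftrightarrow> Z \<in> borel_measurable M \<and> (\<forall>k. integrable M (\<lambda>\<omega>. \<bar>Z \<omega>\<bar> ^ k))"

lemma finite_moments_measurable: "finite_moments Z \<Longrightarrow> Z \<in> borel_measurable M"
  by (simp add: finite_moments_def)

lemma finite_moments_integrable: "finite_moments Z \<Longrightarrow> integrable M Z"
proof -
  assume Z: "finite_moments Z"
  then have "integrable M (\<lambda>\<omega>. \<bar>Z \<omega>\<bar> ^ 1)" unfolding finite_moments_def by blast
  then show "integrable M Z"
    using integrable_abs_cancel[OF _ finite_moments_measurable[OF Z]] by simp
qed

lemma finite_moments_const: "finite_moments (\<lambda>_. c)"
  by (simp add: finite_moments_def)

lemma finite_moments_bound:
  assumes "finite_moments Z" "W \<in> borel_measurable M" "\<And>\<omega>. \<bar>W \<omega>\<bar> \<le> \<bar>Z \<omega>\<bar>"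
  shows "finite_moments W"
  unfolding finite_moments_def
proof (intro conjI allI)
  fix k
  have [measurable]: "W \<in> borel_measurable M" by fact
  show "integrable M (\<lambda>\<omega>. \<bar>W \<omega>\<bar> ^ k)"
  proof (rule Bochner_Integration.integrable_bound)
    show "integrable M (\<lambda>\<omega>. \<bar>Z \<omega>\<bar> ^ k)" using assms(1) by (simp add: finite_moments_def)
  qed (use assms(3) in \<open>auto intro!: power_mono\<close>)
qed fact

lemma finite_moments_add:
  assumes "finite_moments Z" "finite_moments W"
  shows "finite_moments (\<lambda>\<omega>. Z \<omega> + W \<omega>)"
  unfolding finite_moments_def
proof (intro conjI allI)
  have [measurable]: "Z \<in> borel_measurable M" "W \<in> borel_measurable M"
    using assms by (auto dest: finite_moments_measurable)
  show "(\<lambda>\<omega>. Z \<omega> + W \<omega>) \<in> borel_measurable M" by measurable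
  fix k
  show "integrable M (\<lambda>\<omega>. \<bar>Z \<omega> + W \<omega>\<bar> ^ k)"
  proof (rule Bochner_Integration.integrable_bound)
    show "integrable M (\<lambda>\<omega>. 2 ^ k * (\<bar>Z \<omega>\<bar> ^ k + \<bar>W \<omega>\<bar> ^ k))"
      using assms by (auto simp: finite_moments_def)
    have "\<bar>a + b\<bar> ^ k \<le> 2 ^ k * (\<bar>a\<bar> ^ k + \<bar>b\<bar> ^ k)" for a b :: real
    proof -
      have "\<bar>a + b\<bar> ^ k \<le> (2 * max \<bar>a\<bar> \<bar>b\<bar>) ^ k" by (intro power_mono) auto
      also have "\<dots> = 2 ^ k * max \<bar>a\<bar> \<bar>b\<bar> ^ k" by (simp add: power_mult_distrib)
      also have "\<dots> \<le> 2 ^ k * (\<bar>a\<bar> ^ k + \<bar>b\<bar> ^ k)" by (intro mult_left_mono) (auto simp: max_def)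
      finally show ?thesis .
    qed
    then show "AE \<omega> in M. norm (\<bar>Z \<omega> + W \<omega>\<bar> ^ k) \<le> norm (2 ^ k * (\<bar>Z \<omega>\<bar> ^ k + \<bar>W \<omega>\<bar> ^ k))"
      by auto
  qed measurable
qed

lemma finite_moments_mult:
  assumes "finite_moments Z" "finite_moments W"
  shows "finite_moments (\<lambda>\<omega>. Z \<omega> * W \<omega>)"
  unfolding finite_moments_def
proof (intro conjI allI)
  have [measurable]: "Z \<in> borel_measurable M" "W \<in> borel_measurable M"
    using assms by (auto dest: finite_moments_measurable)
  show "(\<lambda>\<omega>. Z \<omega> * W \<omega>) \<in> borel_measurable M" by measurable
  fix k
  show "integrable M (\<lambda>\<omega>. \<bar>Z \<omega> * W \<omega>\<bar> ^ k)"
  proof (rule Bochner_Integration.integrable_bound)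
    show "integrable M (\<lambda>\<omega>. \<bar>Z \<omega>\<bar> ^ (2 * k) + \<bar>W \<omega>\<bar> ^ (2 * k))"
      using assms by (auto simp: finite_moments_def)
    have "\<bar>a * b\<bar> ^ k \<le> \<bar>a\<bar> ^ (2 * k) + \<bar>b\<bar> ^ (2 * k)" for a b :: real
    proof -
      have "x * y \<le> x\<^sup>2 + y\<^sup>2" if "0 \<le> x" "0 \<le> y" for x y :: real
        using sum_squares_bound[of x y] mult_nonneg_nonneg[OF that] by linarith
      from this[of "\<bar>a\<bar> ^ k" "\<bar>b\<bar> ^ k"] show ?thesis
        by (simp add: abs_mult power_mult_distrib mult.commute[of 2] flip: power_mult)
    qed
    then show "AE \<omega> in M. norm (\<bar>Z \<omega> * W \<omega>\<bar> ^ k) \<le> norm (\<bar>Z \<omega>\<bar> ^ (2 * k) + \<bar>W \<omega>\<bar> ^ (2 * k))"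
      by (intro AE_I2) simp
  qed measurable
qed

lemma finite_moments_sum:
  "(\<And>i. i \<in> S \<Longrightarrow> finite_moments (Z i)) \<Longrightarrow> finite_moments (\<lambda>\<omega>. \<Sum>i\<in>S. Z i \<omega>)"
  by (induction S rule: infinite_finite_induct) (auto intro!: finite_moments_const finite_moments_add)

lemma finite_moments_diff:
  assumes "finite_moments Z" "finite_moments W"
  shows "finite_moments (\<lambda>\<omega>. Z \<omega> - W \<omega>)"
  using finite_moments_add[OF assms(1) finite_moments_mult[OF finite_moments_const[of "- 1"] assms(2)]]
  by simp

lemma finite_moments_power: "finite_moments Z \<Longrightarrow> finite_moments (\<lambda>\<omega>. Z \<omega> ^ k)"
  by (induction k) (auto intro!: finite_moments_const finite_moments_mult)

lemma finite_moments_abs: "finite_moments Z \<Longrightarrow> finite_moments (\<lambda>\<omega>. \<bar>Z \<omega>\<bar>)"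
  by (auto simp: finite_moments_def)

lemma finite_moments_X: "finite_moments (X v)"
  unfolding finite_moments_def
proof (intro conjI allI)
  fix k
  show "integrable M (\<lambda>\<omega>. \<bar>X v \<omega>\<bar> ^ k)"
  proof (cases "v = 0")
    case True
    have "integrable M (\<lambda>\<omega>. \<bar>0::real\<bar> ^ k)" by simp
    then show ?thesis
      by (rule integrable_cong_AE_imp) (use X_zero True in auto)
  next
    case False
    have "integrable M (\<lambda>\<omega>. \<bar>X v \<omega> / norm v\<bar> ^ k)"
      using integrable_std_normal_moment_abs[of k]
      by (subst distributed_integrable[OF X_standardized[OF False], symmetric]) auto
    then have "integrable M (\<lambda>\<omega>. norm v ^ k * \<bar>X v \<omega> / norm v\<bar> ^ k)" by simp
    then show ?thesis using False by (simp flip: power_mult_distrib)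
  qed
qed simp

lemma measurable_smooth [measurable]:
  assumes "smooth_polynomial_growth n f"
  shows "f \<in> borel_measurable (PiM UNIV (\<lambda>_. borel))"
  using borel_measurable_continuous_onI[OF smooth_continuous[OF assms]] sets_PiM_equal_borel
  by (metis measurable_cong_sets)

lemma measurable_smooth_path:
  assumes "smooth_polynomial_growth n f"
  shows "(\<lambda>z. f (\<lambda>i. z (v i))) \<in> borel_measurable (PiM UNIV (\<lambda>_::'h. borel))"
  by (rule measurable_compose[OF _ measurable_smooth[OF assms]], rule measurable_process) measurable

lemma measurable_smooth_X:
  assumes "smooth_polynomial_growth n f"
  shows "(\<lambda>\<omega>. f (\<lambda>i. X (v i) \<omega>)) \<in> borel_measurable M"
  using measurable_compose[OF measurable_path measurable_smooth_path[OF assms]] by simp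

lemma finite_moments_smooth:
  assumes f: "smooth_polynomial_growth n f"
  shows "finite_moments (\<lambda>\<omega>. f (\<lambda>i. X (v i) \<omega>))"
proof -
  obtain C k where C: "\<And>x. \<bar>f x\<bar> \<le> C * (1 + (\<Sum>i<n. \<bar>x i\<bar>)) ^ k"
    using smooth_growth[OF f] by blast
  show ?thesis
  proof (rule finite_moments_bound)
    show "finite_moments (\<lambda>\<omega>. C * (1 + (\<Sum>i<n. \<bar>X (v i) \<omega>\<bar>)) ^ k)"
      by (intro finite_moments_mult finite_moments_power finite_moments_add finite_moments_sum
          finite_moments_abs finite_moments_X finite_moments_const)
    show "\<bar>f (\<lambda>i. X (v i) \<omega>)\<bar> \<le> \<bar>C * (1 + (\<Sum>i<n. \<bar>X (v i) \<omega>\<bar>)) ^ k\<bar>" for \<omega>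
      by (rule order_trans[OF C abs_ge_self])
  qed (rule measurable_smooth_X[OF f])
qed

lemma decoupled_integral:
  fixes \<Phi> :: "('h \<Rightarrow> real) \<Rightarrow> real"
  assumes w: "norm w = 1" and \<Phi>[measurable]: "\<Phi> \<in> borel_measurable (PiM UNIV (\<lambda>_. borel))"
    and int: "integrable M (\<lambda>\<omega>. \<Phi> (\<lambda>v. X v \<omega>))"
  defines "T \<equiv> \<lambda>\<omega> s v. X (v - (v \<bullet> w) *\<^sub>R w) \<omega> + (v \<bullet> w) * s"
  shows "AE \<omega> in M. integrable std_normal_distribution (\<lambda>s. \<Phi> (T \<omega> s))"
    and "(\<integral>\<omega>. \<Phi> (\<lambda>v. X v \<omega>) \<partial>M) = (\<integral>\<omega>. (\<integral>s. \<Phi> (T \<omega> s) \<partial>std_normal_distribution) \<partial>M)"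
    and "(\<lambda>\<omega>. (\<integral>s. \<Phi> (T \<omega> s) \<partial>std_normal_distribution)) \<in> borel_measurable M"
proof -
  interpret G: real_distribution std_normal_distribution by (rule real_dist_normal_dist)
  interpret P: pair_prob_space M std_normal_distribution ..
  let ?D = "PiM UNIV (\<lambda>_. borel) :: ('h \<Rightarrow> real) measure"
  define T' where "T' = (\<lambda>p v. X (v - (v \<bullet> w) *\<^sub>R w) (fst p) + (v \<bullet> w) * snd p)"
  have T'[measurable]: "T' \<in> measurable (M \<Otimes>\<^sub>M std_normal_distribution) ?D"
    unfolding T'_def by (rule measurable_process) measurable
  have TT: "T' (\<omega>, s) = T \<omega> s" for \<omega> s by (simp add: T_def T'_def)
  have law: "distr M ?D (\<lambda>\<omega> v. X v \<omega>) = distr (M \<Otimes>\<^sub>M std_normal_distribution) ?D T'"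
    unfolding T'_def by (rule law_decouple[OF w])
  have "integrable (distr M ?D (\<lambda>\<omega> v. X v \<omega>)) \<Phi>"
    using int by (subst integrable_distr_eq) auto
  then have i: "integrable (M \<Otimes>\<^sub>M std_normal_distribution) (\<lambda>p. \<Phi> (T' p))"
    unfolding law by (subst (asm) integrable_distr_eq) auto
  show "AE \<omega> in M. integrable std_normal_distribution (\<lambda>s. \<Phi> (T \<omega> s))"
    using P.AE_integrable_fst'[OF i] by (simp add: TT)
  have "(\<integral>\<omega>. \<Phi> (\<lambda>v. X v \<omega>) \<partial>M) = (\<integral>z. \<Phi> z \<partial>distr M ?D (\<lambda>\<omega> v. X v \<omega>))"
    by (subst integral_distr) auto
  also have "\<dots> = (\<integral>p. \<Phi> (T' p) \<partial>(M \<Otimes>\<^sub>M std_normal_distribution))"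
    unfolding law by (subst integral_distr) auto
  also have "\<dots> = (\<integral>\<omega>. (\<integral>s. \<Phi> (T \<omega> s) \<partial>std_normal_distribution) \<partial>M)"
    using P.integral_fst'[OF i] by (simp add: TT)
  finally show "(\<integral>\<omega>. \<Phi> (\<lambda>v. X v \<omega>) \<partial>M) = (\<integral>\<omega>. (\<integral>s. \<Phi> (T \<omega> s) \<partial>std_normal_distribution) \<partial>M)" .
  show "(\<lambda>\<omega>. (\<integral>s. \<Phi> (T \<omega> s) \<partial>std_normal_distribution)) \<in> borel_measurable M"
    using borel_measurable_integrable[OF P.integrable_fst'[OF i]] by (simp add: TT)
qed

text \<open>
The scalar product with \<open>w\<close> of the Malliavin derivative of \<open>f (X (v 0), X (v 1), \<dots>)\<close>.
\<close>

definition directional_derivative :: "'h \<Rightarrow> nat \<Rightarrow> ((nat \<Rightarrow> real) \<Rightarrow> real) \<Rightarrow> (nat \<Rightarrow> 'h) \<Rightarrow> 'w \<Rightarrow> real" where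
  "directional_derivative w n f v \<omega> = (\<Sum>j<n. (v j \<bullet> w) * partial_deriv j f (\<lambda>i. X (v i) \<omega>))"

lemma finite_moments_directional_derivative:
  "smooth_polynomial_growth n f \<Longrightarrow> finite_moments (directional_derivative w n f v)"
  unfolding directional_derivative_def
  by (intro finite_moments_sum finite_moments_mult finite_moments_const finite_moments_smooth
      smooth_partial_deriv) auto

text \<open>
After \<open>law_decouple\<close> the product \<open>f g\<close> is, for a fixed state of the orthogonal component, a
function of the single standard normal variable \<open>X w\<close>, and the chain rule identifies its derivative
with the directional derivative of the product.
\<close>

lemma integration_by_parts:
  assumes w: "norm w = 1" and f: "smooth_polynomial_growth n f" and g: "smooth_polynomial_growth k g"
  shows "(\<integral>\<omega>. X w \<omega> * (f (\<lambda>i. X (v i) \<omega>) * g (\<lambda>i. X (u i) \<omega>)) \<partial>M) =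
    (\<integral>\<omega>. directional_derivative w n f v \<omega> * g (\<lambda>i. X (u i) \<omega>) + f (\<lambda>i. X (v i) \<omega>) * directional_derivative w k g u \<omega> \<partial>M)"
proof -
  let ?D = "PiM UNIV (\<lambda>_. borel) :: ('h \<Rightarrow> real) measure"
  define \<Phi>0 where "\<Phi>0 z = f (\<lambda>i. z (v i)) * g (\<lambda>i. z (u i))" for z :: "'h \<Rightarrow> real"
  define \<Phi>1 where "\<Phi>1 z = z w * \<Phi>0 z" for z
  define \<Phi>2 where "\<Phi>2 z = (\<Sum>j<n. (v j \<bullet> w) * partial_deriv j f (\<lambda>i. z (v i))) * g (\<lambda>i. z (u i)) +
     f (\<lambda>i. z (v i)) * (\<Sum>j<k. (u j \<bullet> w) * partial_deriv j g (\<lambda>i. z (u i)))" for z :: "'h \<Rightarrow> real"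
  note smooth_f = f smooth_partial_deriv[OF f] and smooth_g = g smooth_partial_deriv[OF g]
  note [measurable] = smooth_f[THEN measurable_smooth_path] smooth_g[THEN measurable_smooth_path]
  have meas: "\<Phi>0 \<in> borel_measurable ?D" "\<Phi>1 \<in> borel_measurable ?D" "\<Phi>2 \<in> borel_measurable ?D"
    unfolding \<Phi>0_def[abs_def] \<Phi>1_def[abs_def] \<Phi>2_def[abs_def]
    by (measurable; fail)+
  have fm: "finite_moments (\<lambda>\<omega>. f (\<lambda>i. X (v i) \<omega>))" "finite_moments (\<lambda>\<omega>. g (\<lambda>i. X (u i) \<omega>))"
    "finite_moments (directional_derivative w n f v)" "finite_moments (directional_derivative w k g u)"
    using f g by (auto intro: finite_moments_smooth finite_moments_directional_derivative)
  have int: "integrable M (\<lambda>\<omega>. \<Phi>0 (\<lambda>v. X v \<omega>))" "integrable M (\<lambda>\<omega>. \<Phi>1 (\<lambda>v. X v \<omega>))"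
    "integrable M (\<lambda>\<omega>. \<Phi>2 (\<lambda>v. X v \<omega>))"
    unfolding \<Phi>0_def \<Phi>1_def \<Phi>2_def directional_derivative_def[symmetric]
    by (intro finite_moments_integrable finite_moments_mult finite_moments_add finite_moments_X fm)+
  define T where "T = (\<lambda>\<omega> s v. X (v - (v \<bullet> w) *\<^sub>R w) \<omega> + (v \<bullet> w) * s)"
  have dec: "AE \<omega> in M. integrable std_normal_distribution (\<lambda>s. \<Phi> (T \<omega> s))"
    "(\<integral>\<omega>. \<Phi> (\<lambda>v. X v \<omega>) \<partial>M) = (\<integral>\<omega>. (\<integral>s. \<Phi> (T \<omega> s) \<partial>std_normal_distribution) \<partial>M)"
    "(\<lambda>\<omega>. (\<integral>s. \<Phi> (T \<omega> s) \<partial>std_normal_distribution)) \<in> borel_measurable M"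
    if "\<Phi> \<in> borel_measurable ?D" "integrable M (\<lambda>\<omega>. \<Phi> (\<lambda>v. X v \<omega>))" for \<Phi> :: "('h \<Rightarrow> real) \<Rightarrow> real"
    unfolding T_def by (rule decoupled_integral[OF w that])+
  have ww: "w \<bullet> w = 1" using w by (simp add: dot_square_norm)
  have "(\<integral>\<omega>. \<Phi>1 (\<lambda>v. X v \<omega>) \<partial>M) = (\<integral>\<omega>. (\<integral>s. \<Phi>1 (T \<omega> s) \<partial>std_normal_distribution) \<partial>M)"
    by (rule dec(2)[OF meas(2) int(2)])
  also have "\<dots> = (\<integral>\<omega>. (\<integral>s. \<Phi>2 (T \<omega> s) \<partial>std_normal_distribution) \<partial>M)"
  proof (rule integral_cong_AE)
    show "AE \<omega> in M. (\<integral>s. \<Phi>1 (T \<omega> s) \<partial>std_normal_distribution) = (\<integral>s. \<Phi>2 (T \<omega> s) \<partial>std_normal_distribution)"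
      using X_zero dec(1)[OF meas(1) int(1)] dec(1)[OF meas(2) int(2)] dec(1)[OF meas(3) int(3)]
    proof eventually_elim
      case (elim \<omega>)
      \<comment> \<open>The orthogonal part of \<open>w\<close> is \<open>0\<close>, so \<open>X\<close> vanishes there almost surely, though not identically.\<close>
      have s: "T \<omega> s w = s" for s using elim(1) ww by (simp add: T_def)
      have cT: "continuous_on UNIV (\<lambda>s. (\<lambda>i. T \<omega> s (v i)))" for v :: "nat \<Rightarrow> 'h"
        unfolding T_def by (intro continuous_on_coordinatewise_then_product continuous_intros)
      have "(\<integral>s. s * \<Phi>0 (T \<omega> s) \<partial>std_normal_distribution) = (\<integral>s. \<Phi>2 (T \<omega> s) \<partial>std_normal_distribution)"
      proof (rule gaussian_integration_by_parts)
        show "((\<lambda>s. \<Phi>0 (T \<omega> s)) has_real_derivative \<Phi>2 (T \<omega> s)) (at s)" for s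
          unfolding \<Phi>0_def \<Phi>2_def T_def
          by (rule derivative_eq_intros chain_rule_partial[OF f] chain_rule_partial[OF g] refl)+
             (simp add: algebra_simps)
        have c: "continuous_on UNIV (\<lambda>s. h (\<lambda>i. T \<omega> s (v i)))" if "smooth_polynomial_growth m h" for m h and v :: "nat \<Rightarrow> 'h"
          by (rule continuous_on_compose2[OF smooth_continuous[OF that] cT]) auto
        show "continuous_on UNIV (\<lambda>s. \<Phi>2 (T \<omega> s))"
          unfolding \<Phi>2_def using smooth_f smooth_g
          by (intro continuous_intros) (auto intro: c)
      qed (use elim in \<open>auto simp: \<Phi>1_def s\<close>)
      then show ?case by (simp add: \<Phi>1_def s)
    qed
  qed (use dec(3)[OF meas(2) int(2)] dec(3)[OF meas(3) int(3)] in auto)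
  also have "\<dots> = (\<integral>\<omega>. \<Phi>2 (\<lambda>v. X v \<omega>) \<partial>M)"
    by (rule dec(2)[OF meas(3) int(3), symmetric])
  finally show ?thesis
    by (simp add: \<Phi>1_def \<Phi>0_def \<Phi>2_def directional_derivative_def)
qed

end

section \<open>Closability of the Malliavin derivative\<close>

lemma square_integrable_mult:
  fixes f g :: "'a \<Rightarrow> real"
  assumes [measurable]: "f \<in> borel_measurable M" "g \<in> borel_measurable M"
    and "integrable M (\<lambda>x. (f x)\<^sup>2)" "integrable M (\<lambda>x. (g x)\<^sup>2)"
  shows "integrable M (\<lambda>x. f x * g x)"
proof (rule Bochner_Integration.integrable_bound)
  show "integrable M (\<lambda>x. (f x)\<^sup>2 + (g x)\<^sup>2)" using assms by simp
  have "\<bar>a * b\<bar> \<le> a\<^sup>2 + b\<^sup>2" for a b :: real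
    using sum_squares_bound[of "\<bar>a\<bar>" "\<bar>b\<bar>"] mult_nonneg_nonneg[of "\<bar>a\<bar>" "\<bar>b\<bar>"]
    unfolding abs_mult power2_abs by linarith
  then show "AE x in M. norm (f x * g x) \<le> norm ((f x)\<^sup>2 + (g x)\<^sup>2)" by simp
qed measurable

lemma square_integrable_nn:
  fixes f :: "'a \<Rightarrow> real"
  assumes [measurable]: "f \<in> borel_measurable M" and fin: "(\<integral>\<^sup>+x. ennreal ((norm (f x))\<^sup>2) \<partial>M) < \<infinity>"
  shows "integrable M (\<lambda>x. (f x)\<^sup>2)" "(\<integral>x. (f x)\<^sup>2 \<partial>M) = enn2real (\<integral>\<^sup>+x. ennreal ((norm (f x))\<^sup>2) \<partial>M)"
proof -
  show "integrable M (\<lambda>x. (f x)\<^sup>2)"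
    using fin by (intro integrableI_bounded) auto
  show "(\<integral>x. (f x)\<^sup>2 \<partial>M) = enn2real (\<integral>\<^sup>+x. ennreal ((norm (f x))\<^sup>2) \<partial>M)"
    by (subst integral_eq_nn_integral) auto
qed

text \<open>
The Cauchy-Schwarz inequality in the form \<open>\<bar>x y\<bar> \<le> x\<^sup>2 / d + d y\<^sup>2\<close>.
\<close>

lemma L2_tendsto_0_pairing:
  fixes R :: "nat \<Rightarrow> 'a \<Rightarrow> real"
  assumes R[measurable]: "\<And>m. R m \<in> borel_measurable M" and G[measurable]: "G \<in> borel_measurable M"
    and G2: "integrable M (\<lambda>x. (G x)\<^sup>2)" and lim: "L2_tendsto M R (\<lambda>_. 0)"
  shows "(\<lambda>m. \<integral>x. R m x * G x \<partial>M) \<longlonglongrightarrow> 0"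
proof -
  define a where "a m = (\<integral>\<^sup>+x. ennreal ((norm (R m x))\<^sup>2) \<partial>M)" for m
  define r where "r m = enn2real (a m)" for m
  \<comment> \<open>The summand \<open>1 / (m + 1)\<close> keeps \<open>d m\<close> positive when \<open>r m = 0\<close>.\<close>
  define d where "d m = sqrt (r m) + 1 / real (Suc m)" for m
  define B where "B = (\<integral>x. (G x)\<^sup>2 \<partial>M)"
  have a: "a \<longlonglongrightarrow> 0" using lim by (simp add: L2_tendsto_def a_def[abs_def])
  then have ev: "eventually (\<lambda>m. a m < \<infinity>) sequentially" by (rule order_tendstoD) simp
  have "r \<longlonglongrightarrow> 0" using tendsto_enn2real[OF a[folded ennreal_0]] by (simp add: r_def[abs_def])
  have d0: "d \<longlonglongrightarrow> sqrt 0 + 0"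
    unfolding d_def using LIMSEQ_inverse_real_of_nat \<open>r \<longlonglongrightarrow> 0\<close>
    by (intro tendsto_intros) (auto simp: divide_inverse)
  show ?thesis
  proof (rule Lim_null_comparison)
    show "(\<lambda>m. sqrt (r m) + d m * B) \<longlonglongrightarrow> 0"
      using tendsto_add[OF tendsto_real_sqrt[OF \<open>r \<longlonglongrightarrow> 0\<close>] tendsto_mult_right[OF d0, of B]] by simp
    show "eventually (\<lambda>m. norm (\<integral>x. R m x * G x \<partial>M) \<le> sqrt (r m) + d m * B) sequentially"
      using ev
    proof eventually_elim
      case (elim m)
      note R2 = square_integrable_nn[OF R elim[unfolded a_def]]
      have r0: "0 \<le> r m" by (simp add: r_def)
      have d: "0 < d m" "sqrt (r m) \<le> d m" using r0 by (auto simp: d_def intro: add_nonneg_pos)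
      have i: "integrable M (\<lambda>x. R m x * G x)"
        by (rule square_integrable_mult) (use R2 G2 in auto)
      have le: "\<bar>x * y\<bar> \<le> x\<^sup>2 / d m + d m * y\<^sup>2" for x y
      proof -
        have "0 \<le> (\<bar>x\<bar> - d m * \<bar>y\<bar>)\<^sup>2 / d m" using d by simp
        also have "\<dots> = x\<^sup>2 / d m + d m * y\<^sup>2 - 2 * \<bar>x * y\<bar>"
          using d by (simp add: power2_diff abs_mult field_simps power2_eq_square)
        finally show ?thesis using abs_ge_zero[of "x * y"] by linarith
      qed
      have "norm (\<integral>x. R m x * G x \<partial>M) \<le> (\<integral>x. \<bar>R m x * G x\<bar> \<partial>M)"
        using integral_abs_bound[of M "\<lambda>x. R m x * G x"] by simp
      also have "\<dots> \<le> (\<integral>x. (R m x)\<^sup>2 / d m + d m * (G x)\<^sup>2 \<partial>M)"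
        using i R2 G2 le by (intro integral_mono) auto
      also have "\<dots> = r m / d m + d m * B"
        using R2 G2 by (simp add: B_def r_def a_def)
      also have "r m / d m \<le> sqrt (r m)"
      proof -
        have "r m = sqrt (r m) * sqrt (r m)" using r0 by simp
        also have "\<dots> \<le> sqrt (r m) * d m" using d r0 by (intro mult_left_mono) auto
        finally show ?thesis using d by (simp add: field_simps)
      qed
      finally show ?case by simp
    qed
  qed
qed

lemma L2_tendsto_diff:
  fixes F F' :: "nat \<Rightarrow> 'a \<Rightarrow> 'b::{real_normed_vector, second_countable_topology}"
  assumes [measurable]: "\<And>m. F m \<in> borel_measurable M" "\<And>m. F' m \<in> borel_measurable M"
    "f \<in> borel_measurable M" "f' \<in> borel_measurable M"
    and lim: "L2_tendsto M F f" "L2_tendsto M F' f'"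
  shows "L2_tendsto M (\<lambda>m x. F m x - F' m x) (\<lambda>x. f x - f' x)"
  unfolding L2_tendsto_def
proof (rule tendsto_sandwich[OF _ _ tendsto_const])
  let ?a = "\<lambda>m. \<integral>\<^sup>+x. ennreal ((norm (F m x - f x))\<^sup>2) \<partial>M"
  let ?b = "\<lambda>m. \<integral>\<^sup>+x. ennreal ((norm (F' m x - f' x))\<^sup>2) \<partial>M"
  have "(\<lambda>m. 2 * ?a m + 2 * ?b m) \<longlonglongrightarrow> 2 * 0 + 2 * 0"
    using lim unfolding L2_tendsto_def by (intro tendsto_add ennreal_tendsto_cmult) auto
  then show "(\<lambda>m. 2 * ?a m + 2 * ?b m) \<longlonglongrightarrow> 0" by simp
  have "(norm (x - y))\<^sup>2 \<le> 2 * (norm x)\<^sup>2 + 2 * (norm y)\<^sup>2" for x y :: 'b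
  proof -
    have "(norm (x - y))\<^sup>2 \<le> (norm x + norm y)\<^sup>2" by (intro power_mono norm_triangle_ineq4) simp
    also have "\<dots> \<le> 2 * (norm x)\<^sup>2 + 2 * (norm y)\<^sup>2"
      using sum_squares_bound[of "norm x" "norm y"] by (simp add: power2_sum)
    finally show ?thesis .
  qed
  from this[of "F m x - f x" "F' m x - f' x" for m x]
  have "ennreal ((norm (F m x - F' m x - (f x - f' x)))\<^sup>2) \<le>
      2 * ennreal ((norm (F m x - f x))\<^sup>2) + 2 * ennreal ((norm (F' m x - f' x))\<^sup>2)" for m x
    by (simp add: algebra_simps ennreal_leI flip: ennreal_plus ennreal_mult ennreal_numeral)
  then have "(\<integral>\<^sup>+x. ennreal ((norm (F m x - F' m x - (f x - f' x)))\<^sup>2) \<partial>M) \<le>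
     (\<integral>\<^sup>+x. 2 * ennreal ((norm (F m x - f x))\<^sup>2) + 2 * ennreal ((norm (F' m x - f' x))\<^sup>2) \<partial>M)" for m
    by (intro nn_integral_mono)
  also have "\<dots> m = 2 * ?a m + 2 * ?b m" for m
    by (simp add: nn_integral_add nn_integral_cmult)
  finally show "\<forall>\<^sub>F m in sequentially. (\<integral>\<^sup>+x. ennreal ((norm (F m x - F' m x - (f x - f' x)))\<^sup>2) \<partial>M) \<le> 2 * ?a m + 2 * ?b m"
    by (intro always_eventually allI)
qed auto

lemma L2_tendsto_inner:
  fixes F :: "nat \<Rightarrow> 'a \<Rightarrow> 'b::real_inner"
  assumes "norm w = 1" and lim: "L2_tendsto M F f"
  shows "L2_tendsto M (\<lambda>m x. F m x \<bullet> w) (\<lambda>x. f x \<bullet> w)"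
  unfolding L2_tendsto_def
proof (rule tendsto_sandwich[OF _ _ tendsto_const])
  show "(\<lambda>m. \<integral>\<^sup>+x. ennreal ((norm (F m x - f x))\<^sup>2) \<partial>M) \<longlonglongrightarrow> 0"
    using lim by (simp add: L2_tendsto_def)
  have "(norm (x \<bullet> w - y \<bullet> w))\<^sup>2 \<le> (norm (x - y))\<^sup>2" for x y
    using Cauchy_Schwarz_ineq2[of "x - y" w] assms(1)
    by (intro power_mono) (auto simp: inner_diff_left)
  then show "\<forall>\<^sub>F m in sequentially. (\<integral>\<^sup>+x. ennreal ((norm (F m x \<bullet> w - f x \<bullet> w))\<^sup>2) \<partial>M) \<le> (\<integral>\<^sup>+x. ennreal ((norm (F m x - f x))\<^sup>2) \<partial>M)"
    by (intro always_eventually allI nn_integral_mono ennreal_leI)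
qed auto

context isonormal
begin

lemma finite_moments_square: "finite_moments Z \<Longrightarrow> integrable M (\<lambda>\<omega>. (Z \<omega>)\<^sup>2)"
  by (intro finite_moments_integrable finite_moments_power)

lemma smooth_malliavin_measurable:
  assumes "smooth_malliavin_derivative X F U"
  shows "finite_moments F" "U \<in> borel_measurable M"
proof -
  obtain n f v where f: "smooth_polynomial_growth n f" and F: "F = (\<lambda>\<omega>. f (\<lambda>i. X (v i) \<omega>))"
    and U: "U = (\<lambda>\<omega>. \<Sum>j<n. partial_deriv j f (\<lambda>i. X (v i) \<omega>) *\<^sub>R v j)"
    using assms unfolding smooth_malliavin_derivative_def by blast
  show "finite_moments F" unfolding F by (rule finite_moments_smooth[OF f])
  show "U \<in> borel_measurable M"
    unfolding U
    by (intro borel_measurable_sum borel_measurable_scaleR borel_measurable_const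
        measurable_smooth_X[OF smooth_partial_deriv[OF f]]) auto
qed

lemma smooth_malliavin_inner:
  assumes "smooth_malliavin_derivative X F U"
  obtains n f v where "smooth_polynomial_growth n f" "F = (\<lambda>\<omega>. f (\<lambda>i. X (v i) \<omega>))"
    "(\<lambda>\<omega>. U \<omega> \<bullet> w) = directional_derivative w n f v"
proof -
  obtain n f v where f: "smooth_polynomial_growth n f" and F: "F = (\<lambda>\<omega>. f (\<lambda>i. X (v i) \<omega>))"
    and U: "U = (\<lambda>\<omega>. \<Sum>j<n. partial_deriv j f (\<lambda>i. X (v i) \<omega>) *\<^sub>R v j)"
    using assms unfolding smooth_malliavin_derivative_def by blast
  have "(\<lambda>\<omega>. U \<omega> \<bullet> w) = directional_derivative w n f v"
    by (simp add: U directional_derivative_def fun_eq_iff inner_sum_left mult.commute)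
  with f F show thesis by (rule that)
qed

text \<open>
The random variable \<open>X w G - D\<^sub>w G\<close>, with \<open>G = g (X (u 0), X (u 1), \<dots>)\<close>, is the divergence of
\<open>G w\<close>.  The right side depends on \<open>F\<close> but not on its derivative, which is what makes the
derivative closable.
\<close>

lemma smooth_malliavin_duality:
  assumes w: "norm w = 1" and FU: "smooth_malliavin_derivative X F U" and g: "smooth_polynomial_growth k g"
  shows "(\<integral>\<omega>. (U \<omega> \<bullet> w) * g (\<lambda>i. X (u i) \<omega>) \<partial>M) =
    (\<integral>\<omega>. F \<omega> * (X w \<omega> * g (\<lambda>i. X (u i) \<omega>) - directional_derivative w k g u \<omega>) \<partial>M)"
proof -
  obtain n f v where f: "smooth_polynomial_growth n f" and F: "F = (\<lambda>\<omega>. f (\<lambda>i. X (v i) \<omega>))"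
    and U: "(\<lambda>\<omega>. U \<omega> \<bullet> w) = directional_derivative w n f v"
    using smooth_malliavin_inner[OF FU] .
  have fm: "finite_moments F" "finite_moments (\<lambda>\<omega>. g (\<lambda>i. X (u i) \<omega>))"
    "finite_moments (directional_derivative w n f v)" "finite_moments (directional_derivative w k g u)" "finite_moments (X w)"
    unfolding F using f g by (auto intro: finite_moments_smooth finite_moments_directional_derivative finite_moments_X)
  have "(\<integral>\<omega>. X w \<omega> * (F \<omega> * g (\<lambda>i. X (u i) \<omega>)) \<partial>M) =
    (\<integral>\<omega>. directional_derivative w n f v \<omega> * g (\<lambda>i. X (u i) \<omega>) \<partial>M) + (\<integral>\<omega>. F \<omega> * directional_derivative w k g u \<omega> \<partial>M)"
    unfolding F using integration_by_parts[OF w f g, of v u] fm[unfolded F]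
    by (simp add: finite_moments_integrable finite_moments_mult)
  moreover have "(\<integral>\<omega>. F \<omega> * (X w \<omega> * g (\<lambda>i. X (u i) \<omega>) - directional_derivative w k g u \<omega>) \<partial>M) =
    (\<integral>\<omega>. X w \<omega> * (F \<omega> * g (\<lambda>i. X (u i) \<omega>)) \<partial>M) - (\<integral>\<omega>. F \<omega> * directional_derivative w k g u \<omega> \<partial>M)"
    using fm by (subst Bochner_Integration.integral_diff[symmetric])
      (auto simp: finite_moments_integrable finite_moments_mult algebra_simps)
  ultimately show ?thesis using U by (simp add: fun_eq_iff)
qed

text \<open>
Let \<open>R m\<close> and \<open>V m\<close> be the differences of the approximations and of their derivatives in direction
\<open>w\<close>, so that \<open>R m\<close> tends to \<open>0\<close> and \<open>V m\<close> to \<open>Z\<close>.  By duality, \<open>E (V m G) = E (R m H)\<close> for every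
smooth functional \<open>G\<close>, where \<open>H\<close> is square integrable and does not depend on \<open>m\<close>; hence
\<open>E (Z G) = 0\<close>.  Now \<open>V m\<close> itself is a combination of smooth functionals, so \<open>E (Z V m) = 0\<close>, and
in the limit \<open>E (Z\<^sup>2) = 0\<close>.
\<close>

lemma malliavin_closable_direction:
  assumes w: "norm w = 1"
    and smooth: "\<And>m. smooth_malliavin_derivative X (F m) (U m)" "\<And>m. smooth_malliavin_derivative X (F' m) (U' m)"
    and F: "L2_tendsto M F \<phi>" "L2_tendsto M F' \<phi>" and U: "L2_tendsto M U u" "L2_tendsto M U' u'"
    and [measurable]: "\<phi> \<in> borel_measurable M" "u \<in> borel_measurable M" "u' \<in> borel_measurable M"
  shows "AE \<omega> in M. (u \<omega> - u' \<omega>) \<bullet> w = 0"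
proof -
  note fmF = smooth(1)[THEN smooth_malliavin_measurable(1)] smooth(2)[THEN smooth_malliavin_measurable(1)]
  note [measurable] = smooth(1)[THEN smooth_malliavin_measurable(2)] smooth(2)[THEN smooth_malliavin_measurable(2)]
    fmF[THEN finite_moments_measurable]
  have fmU: "finite_moments (\<lambda>\<omega>. U m \<omega> \<bullet> w)" "finite_moments (\<lambda>\<omega>. U' m \<omega> \<bullet> w)" for m
    using smooth_malliavin_inner[OF smooth(1)[of m], of w] smooth_malliavin_inner[OF smooth(2)[of m], of w]
      finite_moments_directional_derivative by metis+
  define R where "R m \<omega> = F m \<omega> - F' m \<omega>" for m \<omega>
  define V where "V m \<omega> = U m \<omega> \<bullet> w - U' m \<omega> \<bullet> w" for m \<omega>
  define Z where "Z \<omega> = u \<omega> \<bullet> w - u' \<omega> \<bullet> w" for \<omega>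
  have [measurable]: "R m \<in> borel_measurable M" "V m \<in> borel_measurable M" "Z \<in> borel_measurable M" for m
    unfolding R_def[abs_def] V_def[abs_def] Z_def[abs_def] by measurable
  have R: "L2_tendsto M R (\<lambda>_. 0)"
    using L2_tendsto_diff[OF _ _ _ _ F] by (simp add: R_def[abs_def])
  have V: "L2_tendsto M V Z"
    unfolding V_def[abs_def] Z_def[abs_def] by (intro L2_tendsto_diff L2_tendsto_inner w U) measurable
  have fmV: "finite_moments (V m)" for m
    unfolding V_def[abs_def] by (intro finite_moments_diff fmU)
  have Z2: "integrable M (\<lambda>\<omega>. (Z \<omega>)\<^sup>2)"
  proof -
    have "eventually (\<lambda>m. (\<integral>\<^sup>+\<omega>. ennreal ((norm (V m \<omega> - Z \<omega>))\<^sup>2) \<partial>M) < \<infinity>) sequentially"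
      using V unfolding L2_tendsto_def by (rule order_tendstoD) simp
    then obtain m where "(\<integral>\<^sup>+\<omega>. ennreal ((norm (V m \<omega> - Z \<omega>))\<^sup>2) \<partial>M) < \<infinity>"
      by (auto simp: eventually_sequentially)
    then have i: "integrable M (\<lambda>\<omega>. (V m \<omega> - Z \<omega>)\<^sup>2)"
      by (intro square_integrable_nn) auto
    show ?thesis
    proof (rule Bochner_Integration.integrable_bound)
      show "integrable M (\<lambda>\<omega>. 2 * (V m \<omega> - Z \<omega>)\<^sup>2 + 2 * (V m \<omega>)\<^sup>2)"
        using i finite_moments_square[OF fmV[of m]] by simp
      have "b\<^sup>2 \<le> 2 * (a - b)\<^sup>2 + 2 * a\<^sup>2" for a b :: real
        using zero_le_power2[of "2 * a - b"] by (simp add: power2_diff power_mult_distrib)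
      then show "AE \<omega> in M. norm ((Z \<omega>)\<^sup>2) \<le> norm (2 * (V m \<omega> - Z \<omega>)\<^sup>2 + 2 * (V m \<omega>)\<^sup>2)" by simp
    qed measurable
  qed
  have VZ: "L2_tendsto M (\<lambda>m \<omega>. V m \<omega> - Z \<omega>) (\<lambda>_. 0)" using V by (simp add: L2_tendsto_def)
  have ZG_int: "integrable M (\<lambda>\<omega>. Z \<omega> * G \<omega>)" if "finite_moments G" for G
    by (rule square_integrable_mult[OF _ _ Z2 finite_moments_square[OF that]])
       (use that finite_moments_measurable in auto)
  have ZG: "(\<integral>\<omega>. Z \<omega> * g (\<lambda>i. X (a i) \<omega>) \<partial>M) = 0" if g: "smooth_polynomial_growth k g" for k g a
  proof -
    let ?G = "\<lambda>\<omega>. g (\<lambda>i. X (a i) \<omega>)"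
    define H where "H \<omega> = X w \<omega> * ?G \<omega> - directional_derivative w k g a \<omega>" for \<omega>
    have fm: "finite_moments ?G" "finite_moments H"
      unfolding H_def[abs_def] using g
      by (auto intro!: finite_moments_diff finite_moments_mult finite_moments_X finite_moments_smooth finite_moments_directional_derivative)
    note [measurable] = fm[THEN finite_moments_measurable]
    have "(\<integral>\<omega>. V m \<omega> * ?G \<omega> \<partial>M) = (\<integral>\<omega>. R m \<omega> * H \<omega> \<partial>M)" for m
    proof -
      have "(\<integral>\<omega>. V m \<omega> * ?G \<omega> \<partial>M) = (\<integral>\<omega>. (U m \<omega> \<bullet> w) * ?G \<omega> \<partial>M) - (\<integral>\<omega>. (U' m \<omega> \<bullet> w) * ?G \<omega> \<partial>M)"
        unfolding V_def left_diff_distrib using fm fmU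
        by (intro Bochner_Integration.integral_diff finite_moments_integrable finite_moments_mult) auto
      also have "\<dots> = (\<integral>\<omega>. F m \<omega> * H \<omega> \<partial>M) - (\<integral>\<omega>. F' m \<omega> * H \<omega> \<partial>M)"
        unfolding H_def by (simp only: smooth_malliavin_duality[OF w smooth(1) g] smooth_malliavin_duality[OF w smooth(2) g])
      also have "\<dots> = (\<integral>\<omega>. R m \<omega> * H \<omega> \<partial>M)"
        unfolding R_def left_diff_distrib using fm fmF
        by (intro Bochner_Integration.integral_diff[symmetric] finite_moments_integrable finite_moments_mult) auto
      finally show ?thesis .
    qed
    then have "(\<lambda>m. \<integral>\<omega>. V m \<omega> * ?G \<omega> \<partial>M) \<longlonglongrightarrow> 0"
      using L2_tendsto_0_pairing[OF _ _ finite_moments_square[OF fm(2)] R] by simp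
    moreover have "(\<lambda>m. \<integral>\<omega>. (V m \<omega> - Z \<omega>) * ?G \<omega> \<partial>M) \<longlonglongrightarrow> 0"
      by (rule L2_tendsto_0_pairing[OF _ _ finite_moments_square[OF fm(1)] VZ]) measurable
    ultimately have "(\<lambda>m. (\<integral>\<omega>. V m \<omega> * ?G \<omega> \<partial>M) - (\<integral>\<omega>. (V m \<omega> - Z \<omega>) * ?G \<omega> \<partial>M)) \<longlonglongrightarrow> 0 - 0"
      by (rule tendsto_diff)
    moreover have "(\<integral>\<omega>. V m \<omega> * ?G \<omega> \<partial>M) - (\<integral>\<omega>. (V m \<omega> - Z \<omega>) * ?G \<omega> \<partial>M) = (\<integral>\<omega>. Z \<omega> * ?G \<omega> \<partial>M)" for m
      unfolding left_diff_distrib using ZG_int[OF fm(1)] finite_moments_integrable[OF finite_moments_mult[OF fmV fm(1)]]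
      by (subst Bochner_Integration.integral_diff) auto
    ultimately show ?thesis by (simp add: LIMSEQ_const_iff)
  qed
  have Zdir: "(\<integral>\<omega>. Z \<omega> * directional_derivative w n f v \<omega> \<partial>M) = 0" if f: "smooth_polynomial_growth n f" for n f v
  proof -
    have "(\<integral>\<omega>. Z \<omega> * directional_derivative w n f v \<omega> \<partial>M) =
      (\<integral>\<omega>. (\<Sum>j<n. (v j \<bullet> w) * (Z \<omega> * partial_deriv j f (\<lambda>i. X (v i) \<omega>))) \<partial>M)"
      by (simp add: directional_derivative_def sum_distrib_left mult.left_commute)
    also have "\<dots> = (\<Sum>j<n. (v j \<bullet> w) * (\<integral>\<omega>. Z \<omega> * partial_deriv j f (\<lambda>i. X (v i) \<omega>) \<partial>M))"
      by (subst Bochner_Integration.integral_sum)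
         (auto intro!: ZG_int finite_moments_smooth smooth_partial_deriv[OF f])
    also have "\<dots> = 0" using ZG[OF smooth_partial_deriv[OF f]] by simp
    finally show ?thesis .
  qed
  have "(\<integral>\<omega>. V m \<omega> * Z \<omega> \<partial>M) = 0" for m
  proof -
    have zero: "(\<integral>\<omega>. Z \<omega> * (U\<^sub>0 \<omega> \<bullet> w) \<partial>M) = 0" if sm: "smooth_malliavin_derivative X F\<^sub>0 U\<^sub>0" for F\<^sub>0 U\<^sub>0
    proof -
      obtain n f v where f: "smooth_polynomial_growth n f" and "F\<^sub>0 = (\<lambda>\<omega>. f (\<lambda>i. X (v i) \<omega>))"
        and eq: "(\<lambda>\<omega>. U\<^sub>0 \<omega> \<bullet> w) = directional_derivative w n f v"
        using smooth_malliavin_inner[OF sm] .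
      show ?thesis using Zdir[OF f, of v] fun_cong[OF eq] by simp
    qed
    have "(\<integral>\<omega>. Z \<omega> * (U m \<omega> \<bullet> w) \<partial>M) = 0" "(\<integral>\<omega>. Z \<omega> * (U' m \<omega> \<bullet> w) \<partial>M) = 0"
      using zero smooth by blast+
    moreover have "(\<integral>\<omega>. V m \<omega> * Z \<omega> \<partial>M) = (\<integral>\<omega>. Z \<omega> * (U m \<omega> \<bullet> w) \<partial>M) - (\<integral>\<omega>. Z \<omega> * (U' m \<omega> \<bullet> w) \<partial>M)"
      by (subst Bochner_Integration.integral_diff[symmetric])
         (auto intro!: ZG_int fmU simp: V_def algebra_simps)
    ultimately show ?thesis by simp
  qed
  moreover have "(\<lambda>m. \<integral>\<omega>. (V m \<omega> - Z \<omega>) * Z \<omega> \<partial>M) \<longlonglongrightarrow> 0"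
    by (rule L2_tendsto_0_pairing[OF _ _ Z2 VZ]) measurable
  moreover have "(\<integral>\<omega>. (V m \<omega> - Z \<omega>) * Z \<omega> \<partial>M) = (\<integral>\<omega>. V m \<omega> * Z \<omega> \<partial>M) - (\<integral>\<omega>. (Z \<omega>)\<^sup>2 \<partial>M)" for m
    unfolding left_diff_distrib power2_eq_square using ZG_int[OF fmV[of m]] Z2
    by (intro Bochner_Integration.integral_diff) (auto simp: mult.commute power2_eq_square)
  ultimately have "(\<integral>\<omega>. (Z \<omega>)\<^sup>2 \<partial>M) = 0" by (simp add: LIMSEQ_const_iff)
  then have "AE \<omega> in M. (Z \<omega>)\<^sup>2 = 0"
    using integral_nonneg_eq_0_iff_AE[OF Z2] by simp
  then show ?thesis by eventually_elim (simp add: Z_def inner_diff_left)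
qed

text \<open>
A vector orthogonal to a countable dense set of directions is zero.
\<close>

lemma malliavin_derivative_unique:
  assumes "has_malliavin_derivative M X \<phi> u" "has_malliavin_derivative M X \<phi> u'"
  shows "AE \<omega> in M. u \<omega> = u' \<omega>"
proof -
  obtain D :: "'h set" where D: "countable D" "\<And>S. open S \<Longrightarrow> S \<noteq> {} \<Longrightarrow> \<exists>d\<in>D. d \<in> S"
    using countable_dense_exists by blast
  have "AE \<omega> in M. \<forall>d\<in>D. (u \<omega> - u' \<omega>) \<bullet> d = 0"
  proof (subst AE_ball_countable[OF D(1)], intro ballI)
    fix d assume "d \<in> D"
    show "AE \<omega> in M. (u \<omega> - u' \<omega>) \<bullet> d = 0"
    proof (cases "d = 0")
      case False
      then have "norm (d /\<^sub>R norm d) = 1" by simp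
      then have "AE \<omega> in M. (u \<omega> - u' \<omega>) \<bullet> (d /\<^sub>R norm d) = 0"
      proof -
        obtain F U where "\<And>m. smooth_malliavin_derivative X (F m) (U m)" "L2_tendsto M F \<phi>" "L2_tendsto M U u"
          using assms(1) unfolding has_malliavin_derivative_def by blast
        moreover obtain F' U' where "\<And>m. smooth_malliavin_derivative X (F' m) (U' m)" "L2_tendsto M F' \<phi>" "L2_tendsto M U' u'"
          using assms(2) unfolding has_malliavin_derivative_def by blast
        ultimately show ?thesis
          using assms by (intro malliavin_closable_direction[OF \<open>norm (d /\<^sub>R norm d) = 1\<close>, of F U F' U' \<phi> u u'])
            (auto simp: has_malliavin_derivative_def)
      qed
      then show ?thesis using False by simp
    qed simp
  qed
  then show ?thesis
  proof eventually_elim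
    case (elim \<omega>)
    let ?z = "u \<omega> - u' \<omega>"
    have "?z = 0"
    proof (rule ccontr)
      assume z: "?z \<noteq> 0"
      have "open {d. 0 < ?z \<bullet> d}" by (intro open_Collect_less continuous_intros)
      moreover have "?z \<in> {d. 0 < ?z \<bullet> d}" using z by simp
      ultimately obtain d where "d \<in> D" "0 < ?z \<bullet> d" using D(2)[of "{d. 0 < ?z \<bullet> d}"] by blast
      with elim show False by auto
    qed
    then show ?case by simp
  qed
qed

end

section \<open>Smooth approximation of maxima by log-sum-exp\<close>

text \<open>
The gradient of \<open>log_sum_exp\<close>; \<open>\<beta>\<close> is the inverse temperature.
\<close>

definition gibbs_weight :: "nat \<Rightarrow> real \<Rightarrow> nat \<Rightarrow> (nat \<Rightarrow> real) \<Rightarrow> real" where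
  "gibbs_weight n \<beta> i x = exp (\<beta> * x i) / (\<Sum>j<n. exp (\<beta> * x j))"

definition log_sum_exp :: "nat \<Rightarrow> real \<Rightarrow> (nat \<Rightarrow> real) \<Rightarrow> real" where
  "log_sum_exp n \<beta> x = ln (\<Sum>j<n. exp (\<beta> * x j)) / \<beta>"

lemma sum_exp_pos: "0 < n \<Longrightarrow> 0 < (\<Sum>j<n. exp (\<beta> * x j :: real))" for n :: nat
  by (intro sum_pos) auto

lemma gibbs_weight_nonneg: "0 \<le> gibbs_weight n \<beta> i x"
  by (auto simp: gibbs_weight_def intro!: divide_nonneg_nonneg sum_nonneg)

lemma gibbs_weight_sum: "0 < n \<Longrightarrow> (\<Sum>i<n. gibbs_weight n \<beta> i x) = 1"
  using sum_exp_pos[of n \<beta> x] by (simp add: gibbs_weight_def flip: sum_divide_distrib)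

lemma gibbs_weight_le:
  assumes "i < n" "j < n"
  shows "gibbs_weight n \<beta> i x \<le> exp (\<beta> * (x i - x j))"
proof -
  have "exp (\<beta> * x j) \<le> (\<Sum>j<n. exp (\<beta> * x j))"
    using assms by (intro member_le_sum) auto
  then have "gibbs_weight n \<beta> i x \<le> exp (\<beta> * x i) / exp (\<beta> * x j)"
    unfolding gibbs_weight_def by (intro divide_left_mono mult_pos_pos) (auto intro: less_le_trans[OF exp_gt_zero])
  then show ?thesis by (simp add: exp_diff right_diff_distrib)
qed

lemma gibbs_weight_le_1: "i < n \<Longrightarrow> gibbs_weight n \<beta> i x \<le> 1"
  using gibbs_weight_le[of i n i \<beta> x] by simp

lemma log_sum_exp_ge:
  assumes "0 < \<beta>" "i < n"
  shows "x i \<le> log_sum_exp n \<beta> x"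
proof -
  have "exp (\<beta> * x i) \<le> (\<Sum>j<n. exp (\<beta> * x j))"
    using assms by (intro member_le_sum) auto
  then have "\<beta> * x i \<le> ln (\<Sum>j<n. exp (\<beta> * x j))"
    using assms sum_exp_pos[of n \<beta> x] by (subst ln_ge_iff) auto
  then show ?thesis using assms by (simp add: log_sum_exp_def field_simps)
qed

lemma log_sum_exp_le:
  assumes "0 < \<beta>" "0 < n" and b: "\<And>i. i < n \<Longrightarrow> x i \<le> b"
  shows "log_sum_exp n \<beta> x \<le> b + ln (real n) / \<beta>"
proof -
  have "(\<Sum>j<n. exp (\<beta> * x j)) \<le> (\<Sum>j<n. exp (\<beta> * b))"
    using b assms by (intro sum_mono) auto
  then have "ln (\<Sum>j<n. exp (\<beta> * x j)) \<le> ln (real n * exp (\<beta> * b))"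
    using sum_exp_pos[of n \<beta> x] assms by (subst ln_le_cancel_iff) auto
  also have "\<dots> = ln (real n) + \<beta> * b" using assms by (subst ln_mult) auto
  finally show ?thesis using assms by (simp add: log_sum_exp_def field_simps)
qed

lemma continuous_on_coordinate: "continuous_on UNIV (\<lambda>x :: nat \<Rightarrow> real. x i)"
  by simp

lemma has_deriv_exp_coordinate:
  "((\<lambda>t. exp (\<beta> * (x(l := t)) j)) has_real_derivative (if j = l then \<beta> * exp (\<beta> * s) else 0)) (at s)"
  for x :: "nat \<Rightarrow> real"
  by (cases "j = l") (auto intro!: derivative_eq_intros)

lemma has_deriv_sum_exp:
  fixes x :: "nat \<Rightarrow> real"
  assumes "l < n"
  shows "((\<lambda>t. \<Sum>j<n. exp (\<beta> * (x(l := t)) j)) has_real_derivative \<beta> * exp (\<beta> * s)) (at s)"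
proof -
  have "((\<lambda>t. \<Sum>j<n. exp (\<beta> * (x(l := t)) j)) has_real_derivative (\<Sum>j<n. if j = l then \<beta> * exp (\<beta> * s) else 0)) (at s)"
    by (intro DERIV_sum has_deriv_exp_coordinate)
  then show ?thesis using assms by simp
qed

lemma has_deriv_gibbs_weight:
  assumes "l < n"
  shows "((\<lambda>t. gibbs_weight n \<beta> i (x(l := t))) has_real_derivative
    (if i = l then \<beta> else 0) * gibbs_weight n \<beta> i (x(l := s)) +
    (- \<beta>) * (gibbs_weight n \<beta> i (x(l := s)) * gibbs_weight n \<beta> l (x(l := s)))) (at s)"
proof -
  have S: "(\<Sum>j<n. exp (\<beta> * (x(l := s)) j)) \<noteq> 0"
    using sum_exp_pos[of n \<beta> "x(l := s)"] assms by simp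
  show ?thesis
    unfolding gibbs_weight_def
    by (rule DERIV_cong[OF DERIV_divide[OF has_deriv_exp_coordinate has_deriv_sum_exp[OF assms] S]])
       (use S in \<open>auto simp: field_simps power2_eq_square\<close>)
qed

lemma has_deriv_log_sum_exp:
  assumes "l < n" "0 < \<beta>"
  shows "((\<lambda>t. log_sum_exp n \<beta> (x(l := t))) has_real_derivative gibbs_weight n \<beta> l (x(l := s))) (at s)"
proof -
  have S: "0 < (\<Sum>j<n. exp (\<beta> * (x(l := s)) j))"
    using sum_exp_pos[of n \<beta> "x(l := s)"] assms by simp
  show ?thesis
    unfolding log_sum_exp_def gibbs_weight_def
    by (rule DERIV_cong[OF DERIV_cdivide[OF DERIV_chain2[OF DERIV_ln[OF S] has_deriv_sum_exp[OF assms(1)]]]])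
       (use assms in \<open>auto simp: field_simps\<close>)
qed

text \<open>
Partial derivatives of a Gibbs weight, the first partial derivatives of \<open>log_sum_exp\<close>, are polynomials in the Gibbs weights.  So the algebra generated
by the weights is closed under differentiation, and as it consists of bounded continuous functions, all
the derivatives required by \<open>smooth_polynomial_growth\<close> are under control at once.
\<close>

inductive gibbs_polynomial :: "nat \<Rightarrow> real \<Rightarrow> ((nat \<Rightarrow> real) \<Rightarrow> real) \<Rightarrow> bool" for n \<beta> where
  const: "gibbs_polynomial n \<beta> (\<lambda>_. c)"
| weight: "i < n \<Longrightarrow> gibbs_polynomial n \<beta> (gibbs_weight n \<beta> i)"
| add: "gibbs_polynomial n \<beta> p \<Longrightarrow> gibbs_polynomial n \<beta> q \<Longrightarrow> gibbs_polynomial n \<beta> (\<lambda>x. p x + q x)"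
| mult: "gibbs_polynomial n \<beta> p \<Longrightarrow> gibbs_polynomial n \<beta> q \<Longrightarrow> gibbs_polynomial n \<beta> (\<lambda>x. p x * q x)"

lemma gibbs_polynomial_continuous:
  "gibbs_polynomial n \<beta> q \<Longrightarrow> continuous_on UNIV q"
proof (induction rule: gibbs_polynomial.induct)
  case (weight i)
  then have "(\<Sum>j<n. exp (\<beta> * x j)) \<noteq> 0" for x using sum_exp_pos[of n \<beta> x] by simp
  then show ?case unfolding gibbs_weight_def[abs_def] by (intro continuous_intros continuous_on_coordinate) auto
qed (auto intro!: continuous_intros)

lemma gibbs_polynomial_bounded:
  "gibbs_polynomial n \<beta> q \<Longrightarrow> \<exists>B. \<forall>x. \<bar>q x\<bar> \<le> B"
proof (induction rule: gibbs_polynomial.induct)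
  case (weight i)
  then show ?case using gibbs_weight_nonneg gibbs_weight_le_1 by (intro exI[of _ 1]) simp
next
  case (add p q)
  then obtain A B where "\<And>x. \<bar>p x\<bar> \<le> A" "\<And>x. \<bar>q x\<bar> \<le> B" by blast
  then show ?case by (intro exI[of _ "A + B"]) (meson abs_triangle_ineq add_mono order_trans)
next
  case (mult p q)
  then obtain A B where "\<And>x. \<bar>p x\<bar> \<le> A" "\<And>x. \<bar>q x\<bar> \<le> B" by blast
  then show ?case by (intro exI[of _ "A * B"]) (auto simp: abs_mult intro!: mult_mono intro: order_trans[OF abs_ge_zero])
qed auto

lemma gibbs_polynomial_deriv:
  assumes "gibbs_polynomial n \<beta> q" "l < n"
  shows "\<exists>q'. gibbs_polynomial n \<beta> q' \<and> (\<forall>x s. ((\<lambda>t. q (x(l := t))) has_real_derivative q' (x(l := s))) (at s))"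
  using assms(1)
proof (induction rule: gibbs_polynomial.induct)
  case (const c)
  show ?case by (rule exI[of _ "\<lambda>_. 0"]) (auto intro: gibbs_polynomial.const)
next
  case (weight i)
  show ?case
    by (rule exI[of _ "\<lambda>x. (if i = l then \<beta> else 0) * gibbs_weight n \<beta> i x + (- \<beta>) * (gibbs_weight n \<beta> i x * gibbs_weight n \<beta> l x)"])
       (intro conjI allI gibbs_polynomial.intros has_deriv_gibbs_weight weight assms(2))
next
  case (add p q)
  then obtain p' q' where
    "gibbs_polynomial n \<beta> p'" "\<And>x s. ((\<lambda>t. p (x(l := t))) has_real_derivative p' (x(l := s))) (at s)"
    "gibbs_polynomial n \<beta> q'" "\<And>x s. ((\<lambda>t. q (x(l := t))) has_real_derivative q' (x(l := s))) (at s)" by blast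
  then show ?case
    by (intro exI[of _ "\<lambda>x. p' x + q' x"] conjI allI gibbs_polynomial.intros DERIV_add)
next
  case (mult p q)
  then obtain p' q' where
    "gibbs_polynomial n \<beta> p'" "\<And>x s. ((\<lambda>t. p (x(l := t))) has_real_derivative p' (x(l := s))) (at s)"
    "gibbs_polynomial n \<beta> q'" "\<And>x s. ((\<lambda>t. q (x(l := t))) has_real_derivative q' (x(l := s))) (at s)" by blast
  with mult.hyps show ?case
    by (intro exI[of _ "\<lambda>x. p' x * q x + q' x * p x"] conjI allI gibbs_polynomial.intros DERIV_mult)
qed

lemma partial_deriv_eqI:
  assumes "\<And>x s. ((\<lambda>t. q (x(l := t))) has_real_derivative q' (x(l := s))) (at s)"
  shows "partial_deriv l q = q'"
proof
  fix x
  show "partial_deriv l q x = q' x"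
    using DERIV_imp_deriv[OF assms[of x "x l"]] by (simp add: partial_deriv_def)
qed

lemma gibbs_polynomial_iterated:
  "gibbs_polynomial n \<beta> q \<Longrightarrow> set is \<subseteq> {..<n} \<Longrightarrow> gibbs_polynomial n \<beta> (iterated_partial_deriv is q)"
proof (induction "is")
  case Nil
  then show ?case by (simp add: iterated_partial_deriv_def)
next
  case (Cons l ls)
  then have "gibbs_polynomial n \<beta> (iterated_partial_deriv ls q)" "l < n" by auto
  from gibbs_polynomial_deriv[OF this] obtain q' where q': "gibbs_polynomial n \<beta> q'"
    "\<And>x s. ((\<lambda>t. iterated_partial_deriv ls q (x(l := t))) has_real_derivative q' (x(l := s))) (at s)" by blast
  have "iterated_partial_deriv (l # ls) q = partial_deriv l (iterated_partial_deriv ls q)"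
    by (simp add: iterated_partial_deriv_def)
  also have "\<dots> = q'" by (rule partial_deriv_eqI[OF q'(2)])
  finally show ?case using q'(1) by simp
qed

lemma partial_deriv_log_sum_exp:
  "l < n \<Longrightarrow> 0 < \<beta> \<Longrightarrow> partial_deriv l (log_sum_exp n \<beta>) = gibbs_weight n \<beta> l"
  by (rule partial_deriv_eqI) (rule has_deriv_log_sum_exp)

lemma log_sum_exp_smooth:
  assumes n: "0 < n" and \<beta>: "0 < \<beta>"
  shows "smooth_polynomial_growth n (log_sum_exp n \<beta>)"
  unfolding smooth_polynomial_growth_def
proof (intro conjI allI impI)
  show "log_sum_exp n \<beta> x = log_sum_exp n \<beta> y" if "\<forall>i<n. x i = y i" for x y
    using that by (simp add: log_sum_exp_def)
  fix js assume js: "set js \<subseteq> {..<n}"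
  let ?D = "iterated_partial_deriv js (log_sum_exp n \<beta>)"
  have S: "(\<Sum>j<n. exp (\<beta> * x j)) \<noteq> 0" for x using sum_exp_pos[of n \<beta> x] n by simp
  consider "js = []" | "gibbs_polynomial n \<beta> (iterated_partial_deriv js (log_sum_exp n \<beta>))"
  proof (cases js rule: rev_cases)
    case (snoc ls l)
    then have "iterated_partial_deriv js (log_sum_exp n \<beta>) = iterated_partial_deriv ls (gibbs_weight n \<beta> l)"
      using js \<beta> by (simp add: iterated_partial_deriv_def partial_deriv_log_sum_exp)
    then show thesis using that(2) gibbs_polynomial_iterated[OF gibbs_polynomial.weight[of l n \<beta>], of ls] js snoc by auto
  qed (use that in auto)
  then have "continuous_on UNIV (?D) \<and> (\<forall>x. \<forall>l<n. (\<lambda>t. ?D (x(l := t))) field_differentiable at (x l)) \<and>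
    (\<exists>C k. \<forall>x. \<bar>?D x\<bar> \<le> C * (1 + (\<Sum>i<n. \<bar>x i\<bar>)) ^ k)"
  proof cases
    case 1
    then have eq: "iterated_partial_deriv js (log_sum_exp n \<beta>) = log_sum_exp n \<beta>"
      by (simp add: iterated_partial_deriv_def)
    have "continuous_on UNIV ?D"
      unfolding eq unfolding log_sum_exp_def[abs_def] using S \<beta>
      by (auto intro!: continuous_intros continuous_on_coordinate)
    moreover have "(\<lambda>t. ?D (x(l := t))) field_differentiable at (x l)" if "l < n" for x l
      unfolding eq field_differentiable_def using has_deriv_log_sum_exp[OF that \<beta>] by blast
    moreover have "\<exists>C k. \<forall>x. \<bar>?D x\<bar> \<le> C * (1 + (\<Sum>i<n. \<bar>x i\<bar>)) ^ k"
    proof (intro exI allI)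
      fix x :: "nat \<Rightarrow> real"
      let ?s = "\<Sum>i<n. \<bar>x i\<bar>"
      have le: "\<bar>x i\<bar> \<le> ?s" if "i < n" for i using that by (intro member_le_sum) auto
      have L: "0 \<le> ln (real n) / \<beta>" using n \<beta> by simp
      have "log_sum_exp n \<beta> x \<le> ?s + ln (real n) / \<beta>"
        using le by (intro log_sum_exp_le \<beta> n) (auto simp: abs_le_iff)
      moreover have "- ?s \<le> log_sum_exp n \<beta> x"
        using log_sum_exp_ge[OF \<beta> n, of x] le[OF n] by (auto simp: abs_le_iff)
      ultimately have "\<bar>log_sum_exp n \<beta> x\<bar> \<le> ?s + ln (real n) / \<beta>" using L by auto
      also have "\<dots> \<le> (1 + ln (real n) / \<beta>) * (1 + ?s) ^ 1"
      proof -
        have "t + a \<le> (1 + a) * (1 + t)" if "0 \<le> a" "0 \<le> t" for a t :: real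
          using mult_nonneg_nonneg[OF that] by (simp add: algebra_simps)
        from this[OF L sum_nonneg[of "{..<n}" "\<lambda>i. \<bar>x i\<bar>"]] show ?thesis by simp
      qed
      finally show "\<bar>iterated_partial_deriv js (log_sum_exp n \<beta>) x\<bar> \<le> (1 + ln (real n) / \<beta>) * (1 + ?s) ^ 1"
        unfolding eq .
    qed
    ultimately show ?thesis by blast
  next
    case 2
    have "continuous_on UNIV ?D"
      using gibbs_polynomial_continuous[OF 2] by simp
    moreover have "(\<lambda>t. ?D (x(l := t))) field_differentiable at (x l)" if "l < n" for x l
      unfolding field_differentiable_def using gibbs_polynomial_deriv[OF 2 that] by blast
    moreover obtain B where "\<And>x. \<bar>iterated_partial_deriv js (log_sum_exp n \<beta>) x\<bar> \<le> B"
      using gibbs_polynomial_bounded[OF 2] by blast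
    then have "\<exists>C k. \<forall>x. \<bar>?D x\<bar> \<le> C * (1 + (\<Sum>i<n. \<bar>x i\<bar>)) ^ k"
      by (intro exI[of _ B] exI[of _ 0]) simp
    ultimately show ?thesis by blast
  qed
  then show "continuous_on UNIV ?D" "\<And>x l. l < n \<Longrightarrow> (\<lambda>t. ?D (x(l := t))) field_differentiable at (x l)"
    "\<exists>C k. \<forall>x. \<bar>?D x\<bar> \<le> C * (1 + (\<Sum>i<n. \<bar>x i\<bar>)) ^ k"
    by blast+
qed

section \<open>The derivative of the support function\<close>

lemma gibbs_barycentre_norm_le:
  assumes "0 < n" "\<And>i. i < n \<Longrightarrow> norm (c i) \<le> B"
  shows "norm (\<Sum>i<n. gibbs_weight n \<beta> i x *\<^sub>R c i) \<le> B"
proof -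
  have "norm (\<Sum>i<n. gibbs_weight n \<beta> i x *\<^sub>R c i) \<le> (\<Sum>i<n. gibbs_weight n \<beta> i x * B)"
    using assms gibbs_weight_nonneg
    by (intro order_trans[OF norm_sum] sum_mono) (auto intro!: mult_left_mono)
  also have "\<dots> = B" using gibbs_weight_sum[OF assms(1), of \<beta> x] by (simp flip: sum_distrib_right)
  finally show ?thesis .
qed

text \<open>
Pick \<open>j\<close> with \<open>X (c j) > h - \<delta> / 2\<close>.  A point at distance at least \<open>e / 2\<close> from \<open>v\<close> has
\<open>X \<le> h - \<delta>\<close>, so its weight is at most \<open>exp (- n \<delta> / 2)\<close> by comparison with \<open>c j\<close>.  With \<open>n\<close>
points at inverse temperature \<open>n\<close> the total weight of these points tends to \<open>0\<close>.
\<close>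

lemma gibbs_barycentre_tendsto_maximal_point:
  fixes X :: "'h::real_normed_vector \<Rightarrow> 'w \<Rightarrow> real" and c :: "nat \<Rightarrow> 'h"
  assumes K: "compact K" "C \<subseteq> K" and c: "range c = C"
    and bdd: "bdd_above ((\<lambda>v. X v \<omega>) ` C)" and v: "unique_maximal_point X C K \<omega> v"
  shows "(\<lambda>m. \<Sum>i<Suc m. gibbs_weight (Suc m) (real (Suc m)) i (\<lambda>i. X (c i) \<omega>) *\<^sub>R c i) \<longlonglongrightarrow> v"
proof (rule LIMSEQ_I)
  fix e :: real assume "0 < e"
  define p where "p m i = gibbs_weight (Suc m) (real (Suc m)) i (\<lambda>i. X (c i) \<omega>)" for m i
  let ?h = "support_function X C \<omega>"
  obtain B where B: "\<And>x. x \<in> K \<Longrightarrow> norm x \<le> B" using compact_imp_bounded[OF K(1)] by (auto simp: bounded_iff)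
  have cK: "c i \<in> K" for i using c K(2) by auto
  have vK: "v \<in> K" using v by (simp add: unique_maximal_point_def maximal_point_def)
  obtain \<delta> where \<delta>: "0 < \<delta>" "\<And>u. u \<in> C \<Longrightarrow> e / 2 \<le> dist u v \<Longrightarrow> X u \<omega> \<le> ?h - \<delta>"
    using sup_gap_off_maximal_point[OF K bdd v, of "e / 2"] \<open>0 < e\<close> by auto
  have "\<exists>u\<in>C. ?h - \<delta> / 2 < X u \<omega>"
    using less_cSUP_iff[OF _ bdd, of "?h - \<delta> / 2"] c \<delta>(1) by (auto simp: support_function_def)
  then obtain j where j: "?h - \<delta> / 2 < X (c j) \<omega>" using c by auto
  have "(\<lambda>m. (2 * B) * (real (Suc m) * exp (- (real (Suc m) * (\<delta> / 2))))) \<longlonglongrightarrow> 0"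
    using \<delta>(1) by real_asymp
  then have "\<forall>\<^sub>F m in sequentially. (2 * B) * (real (Suc m) * exp (- (real (Suc m) * (\<delta> / 2)))) < e / 2"
    by (rule order_tendstoD) (use \<open>0 < e\<close> in simp)
  then obtain m0 where m0: "\<And>m. m \<ge> m0 \<Longrightarrow> (2 * B) * (real (Suc m) * exp (- (real (Suc m) * (\<delta> / 2)))) < e / 2"
    by (auto simp: eventually_sequentially)
  have "norm ((\<Sum>i<Suc m. p m i *\<^sub>R c i) - v) < e" if m: "m \<ge> max m0 j" for m
  proof -
    have p1: "(\<Sum>i<Suc m. p m i) = 1" unfolding p_def by (rule gibbs_weight_sum) simp
    have p0: "0 \<le> p m i" for i unfolding p_def by (rule gibbs_weight_nonneg)
    have each: "p m i * norm (c i - v) \<le> p m i * (e / 2) + (2 * B) * exp (- (real (Suc m) * (\<delta> / 2)))" if i: "i < Suc m" for i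
    proof (cases "e / 2 \<le> dist (c i) v")
      case True
      then have "X (c i) \<omega> \<le> ?h - \<delta>" using \<delta>(2)[of "c i"] c by auto
      then have "real (Suc m) * (X (c i) \<omega> - X (c j) \<omega>) \<le> real (Suc m) * (- (\<delta> / 2))"
        using j by (intro mult_left_mono) auto
      then have "p m i \<le> exp (- (real (Suc m) * (\<delta> / 2)))"
        using gibbs_weight_le[OF i, of j "real (Suc m)" "\<lambda>i. X (c i) \<omega>"] m
        unfolding p_def by (auto intro: order_trans)
      moreover have "norm (c i - v) \<le> 2 * B"
        using norm_triangle_ineq4[of "c i" v] B[OF cK[of i]] B[OF vK] by linarith
      ultimately have "p m i * norm (c i - v) \<le> exp (- (real (Suc m) * (\<delta> / 2))) * (2 * B)"
        by (intro mult_mono) auto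
      then show ?thesis
        using mult_nonneg_nonneg[OF p0[of i], of "e / 2"] \<open>0 < e\<close>
        unfolding mult.commute[of "2 * B"] by linarith
    next
      case False
      then have "p m i * norm (c i - v) \<le> p m i * (e / 2)"
        using p0 by (intro mult_left_mono) (auto simp: dist_norm)
      moreover have "0 \<le> B" using B[OF vK] norm_ge_zero[of v] by linarith
      then have "0 \<le> (2 * B) * exp (- (real (Suc m) * (\<delta> / 2)))" by simp
      ultimately show ?thesis by linarith
    qed
    have "(\<Sum>i<Suc m. p m i *\<^sub>R c i) - v = (\<Sum>i<Suc m. p m i *\<^sub>R (c i - v))"
      using p1 by (simp only: scaleR_diff_right sum_subtractf scaleR_sum_left[symmetric]) simp
    then have "norm ((\<Sum>i<Suc m. p m i *\<^sub>R c i) - v) \<le> (\<Sum>i<Suc m. p m i * norm (c i - v))"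
      using norm_sum[of "\<lambda>i. p m i *\<^sub>R (c i - v)" "{..<Suc m}"] p0 by simp
    also have "\<dots> \<le> (\<Sum>i<Suc m. p m i * (e / 2) + (2 * B) * exp (- (real (Suc m) * (\<delta> / 2))))"
      by (intro sum_mono each) simp
    also have "\<dots> = (\<Sum>i<Suc m. p m i) * (e / 2) + (2 * B) * (real (Suc m) * exp (- (real (Suc m) * (\<delta> / 2))))"
      unfolding sum.distrib sum_distrib_right by simp
    also have "\<dots> < e" using m0[of m] m unfolding p1 by simp
    finally show ?thesis .
  qed
  then show "\<exists>no. \<forall>n\<ge>no. norm ((\<Sum>i<Suc n. gibbs_weight (Suc n) (real (Suc n)) i (\<lambda>i. X (c i) \<omega>) *\<^sub>R c i) - v) < e"
    unfolding p_def by blast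
qed

lemma log_sum_exp_tendsto_support_function:
  assumes c: "range c = C" and bdd: "bdd_above ((\<lambda>v. X v \<omega>) ` C)"
  shows "(\<lambda>m. log_sum_exp (Suc m) (real (Suc m)) (\<lambda>i. X (c i) \<omega>)) \<longlonglongrightarrow> support_function X C \<omega>"
    and "X (c 0) \<omega> \<le> log_sum_exp (Suc m) (real (Suc m)) (\<lambda>i. X (c i) \<omega>)"
    and "log_sum_exp (Suc m) (real (Suc m)) (\<lambda>i. X (c i) \<omega>) \<le> support_function X C \<omega> + 1"
proof -
  let ?h = "support_function X C \<omega>" and ?L = "\<lambda>m. log_sum_exp (Suc m) (real (Suc m)) (\<lambda>i. X (c i) \<omega>)"
  have h: "X (c i) \<omega> \<le> ?h" for i
    unfolding support_function_def using bdd c by (auto intro!: cSUP_upper)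
  have upper: "?L m \<le> ?h + ln (real (Suc m)) / real (Suc m)" for m
    by (rule log_sum_exp_le) (use h in auto)
  have lower: "X (c i) \<omega> \<le> ?L m" if "i \<le> m" for i m
    using log_sum_exp_ge[of "real (Suc m)" i "Suc m" "\<lambda>i. X (c i) \<omega>"] that by simp
  show "X (c 0) \<omega> \<le> ?L m" by (rule lower) simp
  have "ln (real (Suc m)) \<le> real (Suc m)" using ln_le_minus_one[of "real (Suc m)"] by simp
  then have "ln (real (Suc m)) / real (Suc m) \<le> 1" by (simp add: divide_le_eq_1)
  with upper[of m] show "?L m \<le> ?h + 1" by linarith
  show "?L \<longlonglongrightarrow> ?h"
  proof (rule order_tendstoI)
    fix y assume "y < ?h"
    then have "\<exists>u\<in>C. y < X u \<omega>"
      using less_cSUP_iff[OF _ bdd, of y] c by (auto simp: support_function_def)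
    then obtain i where "y < X (c i) \<omega>" using c by auto
    then show "\<forall>\<^sub>F m in sequentially. y < ?L m"
      using lower[of i] by (auto simp: eventually_sequentially intro: less_le_trans)
  next
    fix y assume y: "?h < y"
    have "(\<lambda>m. ?h + ln (real (Suc m)) / real (Suc m)) \<longlonglongrightarrow> ?h + 0"
      by (intro tendsto_add tendsto_const) real_asymp
    then have "\<forall>\<^sub>F m in sequentially. ?h + ln (real (Suc m)) / real (Suc m) < y"
      by (rule order_tendstoD) (use y in simp)
    then show "\<forall>\<^sub>F m in sequentially. ?L m < y"
      by (rule eventually_mono) (rule le_less_trans[OF upper])
  qed
qed

context isonormal
begin

text \<open>
The real supremum of a set that is not bounded above is an unspecified real, but always the same one,
so measurability can be checked separately on the measurable set of states where \<open>C\<close> is bounded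
above and on its complement.
\<close>

lemma measurable_support_function:
  assumes "countable C" "C \<noteq> {}"
  shows "support_function X C \<in> borel_measurable M"
proof -
  have nat_bound: "bdd_above ((\<lambda>v. X v \<omega>) ` C) \<longleftrightarrow> (\<exists>n::nat. \<forall>v\<in>C. X v \<omega> \<le> real n)" for \<omega>
    by (auto simp: bdd_above_def) (meson order_trans real_arch_simple)
  have "support_function X C = (\<lambda>\<omega>. if \<exists>n::nat. \<forall>v\<in>C. X v \<omega> \<le> real n
      then real_of_ereal (SUP v\<in>C. ereal (X v \<omega>)) else (LEAST z. False))"
  proof
    fix \<omega>
    show "support_function X C \<omega> = (if \<exists>n::nat. \<forall>v\<in>C. X v \<omega> \<le> real n
      then real_of_ereal (SUP v\<in>C. ereal (X v \<omega>)) else (LEAST z. False))"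
    proof (cases "bdd_above ((\<lambda>v. X v \<omega>) ` C)")
      case True
      then show ?thesis using ereal_cSUP[OF assms(2) True] nat_bound[of \<omega>] by (simp add: support_function_def)
    next
      case False
      then have "(\<lambda>z. \<forall>x\<in>(\<lambda>v. X v \<omega>) ` C. x \<le> z) = (\<lambda>z. False)"
        unfolding bdd_above_def by (intro ext) blast
      then have "support_function X C \<omega> = (LEAST z. False)"
        unfolding support_function_def Sup_real_def by (rule arg_cong)
      moreover have "(\<exists>n::nat. \<forall>v\<in>C. X v \<omega> \<le> real n) = False"
        unfolding nat_bound[symmetric] using False by simp
      ultimately show ?thesis by (simp only: if_False)
    qed
  qed
  moreover have "(\<lambda>\<omega>. if \<exists>n::nat. \<forall>v\<in>C. X v \<omega> \<le> real n
      then real_of_ereal (SUP v\<in>C. ereal (X v \<omega>)) else (LEAST z. False)) \<in> borel_measurable M"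
    using assms(1) by measurable
  ultimately show ?thesis by simp
qed

text \<open>
The dominating functions are a constant for the derivatives, since barycentres of points of \<open>K\<close> are
bounded, and the one from \<open>sup_square_integrable\<close> for the functions.
\<close>

lemma support_function_malliavin_derivative:
  fixes c :: "nat \<Rightarrow> 'h"
  assumes K: "compact K" "C \<subseteq> K" and c: "range c = C"
    and bdd: "AE \<omega> in M. bdd_above ((\<lambda>v. X v \<omega>) ` C)"
    and unique: "AE \<omega> in M. \<exists>v. unique_maximal_point X C K \<omega> v"
  obtains u where "has_malliavin_derivative M X (support_function X C) u"
    "AE \<omega> in M. unique_maximal_point X C K \<omega> (u \<omega>)"
proof -
  define F where "F m \<omega> = log_sum_exp (Suc m) (real (Suc m)) (\<lambda>i. X (c i) \<omega>)" for m \<omega>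
  define p where "p m i \<omega> = gibbs_weight (Suc m) (real (Suc m)) i (\<lambda>i. X (c i) \<omega>)" for m i \<omega>
  define U where "U m \<omega> = (\<Sum>i<Suc m. p m i \<omega> *\<^sub>R c i)" for m \<omega>
  define u where "u \<omega> = lim (\<lambda>m. U m \<omega>)" for \<omega>
  let ?h = "support_function X C"
  have cC: "countable C" "C \<noteq> {}" using c by auto
  have smooth: "smooth_malliavin_derivative X (F m) (U m)" for m
    unfolding smooth_malliavin_derivative_def
  proof (intro exI[of _ "Suc m"] exI[of _ "log_sum_exp (Suc m) (real (Suc m))"] exI[of _ c] conjI)
    show "smooth_polynomial_growth (Suc m) (log_sum_exp (Suc m) (real (Suc m)))"
      by (rule log_sum_exp_smooth) auto
    show "U m = (\<lambda>\<omega>. \<Sum>j<Suc m. partial_deriv j (log_sum_exp (Suc m) (real (Suc m))) (\<lambda>i. X (c i) \<omega>) *\<^sub>R c j)"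
      unfolding U_def p_def by (intro ext sum.cong refl) (simp add: partial_deriv_log_sum_exp)
  qed (simp add: F_def fun_eq_iff)
  note [measurable] = smooth_malliavin_measurable(2)[OF smooth]
    finite_moments_measurable[OF smooth_malliavin_measurable(1)[OF smooth]] measurable_support_function[OF cC]
  have u[measurable]: "u \<in> borel_measurable M" unfolding u_def[abs_def] by measurable
  have U_lim: "AE \<omega> in M. (\<lambda>m. U m \<omega>) \<longlonglongrightarrow> u \<omega> \<and> unique_maximal_point X C K \<omega> (u \<omega>)"
    using bdd unique
  proof eventually_elim
    case (elim \<omega>)
    then obtain v where v: "unique_maximal_point X C K \<omega> v" by blast
    have lim: "(\<lambda>m. U m \<omega>) \<longlonglongrightarrow> v"
      unfolding U_def p_def by (rule gibbs_barycentre_tendsto_maximal_point[OF K c elim(1) v])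
    then have "u \<omega> = v" unfolding u_def by (rule limI)
    with v lim show ?case by simp
  qed
  obtain B where B: "\<And>x. x \<in> K \<Longrightarrow> norm x \<le> B" using compact_imp_bounded[OF K(1)] by (auto simp: bounded_iff)
  have normU: "norm (U m \<omega>) \<le> B" for m \<omega>
    unfolding U_def p_def by (rule gibbs_barycentre_norm_le) (use B K(2) c in auto)
  have "L2_tendsto M U u"
    unfolding L2_tendsto_def
  proof -
    have "(\<lambda>m. \<integral>\<^sup>+\<omega>. ennreal ((norm (U m \<omega> - u \<omega>))\<^sup>2) \<partial>M) \<longlonglongrightarrow> (\<integral>\<^sup>+\<omega>. 0 \<partial>M)"
    proof (rule nn_integral_dominated_convergence[where w="\<lambda>_. ennreal ((2 * B)\<^sup>2)"])
      show "AE \<omega> in M. ennreal ((norm (U m \<omega> - u \<omega>))\<^sup>2) \<le> ennreal ((2 * B)\<^sup>2)" for m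
        using U_lim
      proof eventually_elim
        case (elim \<omega>)
        then have "norm (u \<omega>) \<le> B" using B by (simp add: unique_maximal_point_def maximal_point_def)
        then have "norm (U m \<omega> - u \<omega>) \<le> 2 * B" using normU[of m \<omega>] norm_triangle_ineq4[of "U m \<omega>" "u \<omega>"] by linarith
        then show ?case by (intro ennreal_leI power_mono) auto
      qed
      show "AE \<omega> in M. (\<lambda>m. ennreal ((norm (U m \<omega> - u \<omega>))\<^sup>2)) \<longlonglongrightarrow> 0"
        using U_lim
      proof eventually_elim
        case (elim \<omega>)
        then have "(\<lambda>m. (norm (U m \<omega> - u \<omega>))\<^sup>2) \<longlonglongrightarrow> (norm (u \<omega> - u \<omega>))\<^sup>2"
          by (intro tendsto_intros) auto
        then show ?case using tendsto_ennrealI by fastforce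
      qed
    qed (auto simp: emeasure_space_1)
    then show "(\<lambda>m. \<integral>\<^sup>+\<omega>. ennreal ((norm (U m \<omega> - u \<omega>))\<^sup>2) \<partial>M) \<longlonglongrightarrow> 0" by simp
  qed
  moreover have "L2_tendsto M F ?h"
    unfolding L2_tendsto_def
  proof -
    have "AE \<omega> in M. bdd_above (range (\<lambda>i. X (c i) \<omega>))"
      using bdd unfolding c[symmetric] image_image .
    then obtain Z where Z: "integrable M Z" "AE \<omega> in M. \<forall>i. (X (c i) \<omega>)\<^sup>2 \<le> Z \<omega>"
      by (rule sup_square_integrable)
    note [measurable] = borel_measurable_integrable[OF Z(1)]
    have "(\<lambda>m. \<integral>\<^sup>+\<omega>. ennreal ((norm (F m \<omega> - ?h \<omega>))\<^sup>2) \<partial>M) \<longlonglongrightarrow> (\<integral>\<^sup>+\<omega>. 0 \<partial>M)"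
    proof (rule nn_integral_dominated_convergence[where w="\<lambda>\<omega>. ennreal (8 * Z \<omega> + 2)"])
      show "AE \<omega> in M. ennreal ((norm (F m \<omega> - ?h \<omega>))\<^sup>2) \<le> ennreal (8 * Z \<omega> + 2)" for m
        using Z(2) bdd
      proof eventually_elim
        case (elim \<omega>)
        have le: "\<bar>X (c i) \<omega>\<bar> \<le> sqrt (Z \<omega>)" for i using elim(1) by (intro real_le_rsqrt) simp
        have Z0: "0 \<le> Z \<omega>" using elim(1) zero_le_power2 order_trans by blast
        have "?h \<omega> \<le> sqrt (Z \<omega>)"
          unfolding support_function_def using cC(2) le c by (intro cSUP_least) (auto simp: abs_le_iff)
        moreover have "X (c 0) \<omega> \<le> ?h \<omega>"
          unfolding support_function_def using elim(2) c by (auto intro!: cSUP_upper)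
        ultimately have "\<bar>F m \<omega> - ?h \<omega>\<bar> \<le> 2 * sqrt (Z \<omega>) + 1"
          using log_sum_exp_tendsto_support_function(2,3)[of c C X \<omega> m, OF c elim(2)] le[of 0] unfolding F_def by linarith
        then have "(norm (F m \<omega> - ?h \<omega>))\<^sup>2 \<le> (2 * sqrt (Z \<omega>) + 1)\<^sup>2" by (intro power_mono) auto
        also have "\<dots> \<le> 8 * Z \<omega> + 2"
          using Z0 zero_le_power2[of "2 * sqrt (Z \<omega>) - 1"] by (simp add: power2_sum power2_diff power_mult_distrib)
        finally show ?case by (rule ennreal_leI)
      qed
      have "AE \<omega> in M. 0 \<le> 8 * Z \<omega> + 2"
        using Z(2)
      proof eventually_elim
        case (elim \<omega>)
        then show ?case using zero_le_power2[of "X (c 0) \<omega>"] order_trans[of 0 "(X (c 0) \<omega>)\<^sup>2" "Z \<omega>"] by simp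
      qed
      then have "(\<integral>\<^sup>+\<omega>. ennreal (8 * Z \<omega> + 2) \<partial>M) = ennreal (\<integral>\<omega>. 8 * Z \<omega> + 2 \<partial>M)"
        using Z(1) by (intro nn_integral_eq_integral) auto
      then show "(\<integral>\<^sup>+\<omega>. ennreal (8 * Z \<omega> + 2) \<partial>M) < \<infinity>" by simp
      show "AE \<omega> in M. (\<lambda>m. ennreal ((norm (F m \<omega> - ?h \<omega>))\<^sup>2)) \<longlonglongrightarrow> 0"
        using bdd
      proof eventually_elim
        case (elim \<omega>)
        have "(\<lambda>m. (norm (F m \<omega> - ?h \<omega>))\<^sup>2) \<longlonglongrightarrow> (norm (?h \<omega> - ?h \<omega>))\<^sup>2"
          using log_sum_exp_tendsto_support_function(1)[of c C X \<omega>, OF c elim] unfolding F_def by (intro tendsto_intros) auto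
        then show ?case using tendsto_ennrealI by fastforce
      qed
    qed measurable
    then show "(\<lambda>m. \<integral>\<^sup>+\<omega>. ennreal ((norm (F m \<omega> - ?h \<omega>))\<^sup>2) \<partial>M) \<longlonglongrightarrow> 0" by simp
  qed
  ultimately have "has_malliavin_derivative M X ?h u"
    unfolding has_malliavin_derivative_def using smooth measurable_support_function[OF cC] u by blast
  with U_lim show thesis by (intro that) auto
qed

end

theorem proposition4p12:
  fixes M :: "'w measure"
    and X :: "'h::{real_inner, banach, second_countable_topology} \<Rightarrow> 'w \<Rightarrow> real"
    and K C :: "'h set"
  assumes "infinite_dimensional TYPE('h)"
    and "prob_space M"
    and "isonormal_gaussian_process M X"
    and "convex_body K"
    and "gaussian_bounded M X K"
    and "countable_dense_subset C K"
  shows "AE \<omega> in M.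
    unique_maximal_point X C K \<omega> (malliavin_derivative M X (support_function X C) \<omega>)"
proof -
  interpret isonormal M X
    using assms(2,3) by (simp add: isonormal_def isonormal_axioms_def)
  have K: "K \<noteq> {}" "compact K" using assms(4) by (auto simp: convex_body_def)
  have C: "countable C" "C \<subseteq> K" "K \<subseteq> closure C" using assms(6) by (auto simp: countable_dense_subset_def)
  then have ne: "C \<noteq> {}" using K by auto
  have bdd: "AE \<omega> in M. bdd_above ((\<lambda>v. X v \<omega>) ` C)"
    using assms(5) C by (simp add: gaussian_bounded_def)
  have unique: "AE \<omega> in M. \<exists>v. unique_maximal_point X C K \<omega> v"
    using bdd maximal_point_unique[OF assms(6) bdd]
  proof eventually_elim
    case (elim \<omega>)
    obtain v where "maximal_point X C K \<omega> v"
      using maximal_point_exists[of K C X \<omega>, OF K(2) C(2) ne elim(1)] by blast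
    with elim(2) show ?case unfolding unique_maximal_point_def by blast
  qed
  obtain u where u: "has_malliavin_derivative M X (support_function X C) u"
    and max: "AE \<omega> in M. unique_maximal_point X C K \<omega> (u \<omega>)"
    using support_function_malliavin_derivative[OF K(2) C(2) range_from_nat_into[OF ne C(1)] bdd unique] .
  have "has_malliavin_derivative M X (support_function X C) (malliavin_derivative M X (support_function X C))"
    unfolding malliavin_derivative_def by (rule someI[of _ u]) (rule u)
  from malliavin_derivative_unique[OF this u] max show ?thesis
    by eventually_elim simp
qed

end
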